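(* Let $\Gamma$ be the boundary of the triangle, $\mathfrak{L}(\Gamma)$ its Lie model with its action of the symmetric group $\Sigma_3=\langle\sigma,\tau\rangle$, and $\mathfrak{L}_2$ the Lie model of the triangle $\Delta^2$. Let $\Omega$ be a $\Sigma_3$-invariant Maurer-Cartan element in $\mathfrak{L}(\Gamma)$. Then the cdgl $\mathfrak{L}_2$ is a $\Sigma_3$-cdgl isomorphic to the cdgl $(\mathfrak{L}(\Gamma)\,\widehat{\coprod}\,\mathbb L(e'),d)$ satisfying the following properties: (i) for some element $\beta$ of degree $0$ of this cdgl, we have $$de'=-[\Omega,e']+\beta\ast x_1\ast x_2\ast x_3\ast(-\beta);$$ (ii) $\sigma(e')=e'$ and $\tau(e')=-e'$.
   Context: All vector spaces are over $\mathbb Q$ and $\mathbb Z$-graded; $|x|$ is the degree of $x$. Graded Lie brackets satisfy $[x,y]=-(-1)^{|x||y|}[y,x]$ and the graded Jacobi identity; $\mathrm{ad}_x(y)=[x,y]$. Differentials are graded derivations of degree $-1$ with square zero. For a graded vector space $V$, $\mathbb L(V)$ is the free graded Lie algebra, $\mathbb L^{i}(V)$ the subspace of elements of bracket length $i$, and $\widehat{\mathbb L}(V)=\varprojlim_i \mathbb L(V)/\mathbb L^{\ge i}(V)$. A cdgl (complete differential graded Lie algebra) is such a complete free graded Lie algebra $L=\widehat{\mathbb L}(V)$ endowed with a differential $d$. For a group $G$, a $G$-cdgl is a cdgl $(L,d)$ with a $G$-action such that $\varphi[v,w]=[\varphi(v),\varphi(w)]$ and $\varphi(dv)=d(\varphi(v))$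 for all $v,w\in L$, $\varphi\in G$. For $L=\widehat{\mathbb L}(V)$, the completed coproduct $L\,\widehat{\coprod}\,\mathbb L(e')$ is $\widehat{\mathbb L}(V\oplus\mathbb Q e')$ as a graded Lie algebra; here $|e'|=1$, and the differential and the $\Sigma_3$-action on $\mathfrak{L}(\Gamma)\,\widehat{\coprod}\,\mathbb L(e')$ extend those of $\mathfrak{L}(\Gamma)$. For elements $x,y$ of degree $0$ in a complete free Lie algebra, the Baker-Campbell-Hausdorff product is $x\ast y=\log(e^xe^y)$; it is associative. A Maurer-Cartan element of a cdgl $(L,d)$ is an element $a\in L_{-1}$ with $da+\frac12[a,a]=0$. LS-interval (Lawrence-Sullivan): the cdgl $(\widehat{\mathbb L}(a,b,x),d)$ with $|a|=|b|=-1$, $|x|=0$, $da=-\frac12[a,a]$, $db=-\frac12[b,b]$ and $dx=\frac{\mathrm{ad}_x}{1-e^{\mathrm{ad}_x}}(a)+\frac{\mathrm{ad}_x}{1-e^{-\mathrm{ad}_x}}(b)$ (fractions read as formal power series in $\mathrm{ad}_x$). $\mathfrak{L}(\Gamma)=(\widehat{\mathbb L}(v_1,v_2,v_3,x_1,x_2,x_3),d)$ with $|v_i|=-1$, $|x_i|=0$, the $v_i$ Maurer-Cartan elements, and $(v_1,v_2,x_1)$, $(v_2,v_3,x_2)$, $(v_3,v_1,x_3)$ generating LS-intervals (as $(a,b,x)$). The group $\Sigma_3=\langle\sigma,\tau\mid\sigma^3,\tau^2,\sigma\tau=\tau\sigma^{-1}\rangle$ acts on the cdgl $\mathfrak{L}(\Gamma)$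 by $\sigma(v_i)=v_{i+1}$, $\sigma(x_i)=x_{i+1}$ (indices mod 3), $\tau(v_1)=v_1$, $\tau(v_2)=v_3$, $\tau(v_3)=v_2$, $\tau(x_1)=-x_3$, $\tau(x_2)=-x_2$, $\tau(x_3)=-x_1$. $\mathfrak{L}_2=(\widehat{\mathbb L}(v_1,v_2,v_3,x_1,x_2,x_3,e),d)$ with $|e|=1$, where $d$ extends the differential of $\mathfrak{L}(\Gamma)$ and $de=-[v_1,e]+x_1\ast x_2\ast x_3$.
   Formalization: The Maurer-Cartan element Ω is additionally assumed to have nonzero linear part; for Ω with zero linear part (e.g. Ω = 0) the claim is false, since the length-two part of d(de') is then a nonzero bracket -[v, x1+x2+x3]. *)

theory Defs
  imports
    "HOL-Computational_Algebra.Formal_Power_Series"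
    "HOL-Algebra.Group_Action"
    "HOL-Algebra.Sym_Groups"
begin

section \<open>Noncommutative formal power series: the completed tensor algebra\<close>

text \<open>
  A series assigns a rational coefficient to every word in the generators.  It stands for an
  element of the completion, by word length, of the tensor algebra on the generators.
  Multiplication is the Cauchy product for concatenation.
\<close>

typedef 'g series = "UNIV :: ('g list \<Rightarrow> rat) set"
  morphisms wcoeff Series ..

setup_lifting type_definition_series

lemma series_eqI: "(\<And>w. wcoeff f w = wcoeff g w) \<Longrightarrow> f = g"
  by transfer auto

instantiation series :: (type) ring_1
begin

lift_definition zero_series :: "'a series" is "\<lambda>w. 0" .
lift_definition one_series :: "'a series" is "\<lambda>w. if w = [] then 1 else 0" .
lift_definition plus_series :: "'a series \<Rightarrow> 'a series \<Rightarrow> 'a series"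
  is "\<lambda>f g w. f w + g w" .
lift_definition minus_series :: "'a series \<Rightarrow> 'a series \<Rightarrow> 'a series"
  is "\<lambda>f g w. f w - g w" .
lift_definition uminus_series :: "'a series \<Rightarrow> 'a series" is "\<lambda>f w. - f w" .
lift_definition times_series :: "'a series \<Rightarrow> 'a series \<Rightarrow> 'a series"
  is "\<lambda>f g w. \<Sum>i\<le>length w. f (take i w) * g (drop i w)" .

instance
proof
  fix a b c :: "'a series"
  show "a * b * c = a * (b * c)"
  proof (transfer, rule ext)
    fix f g h :: "'a list \<Rightarrow> rat" and w :: "'a list"
    let ?n = "length w"
    define F where "F i j k = f (take i w) * g (take j (drop i w)) * h (drop (?n - k) w)"
      for i j k
    have "(\<Sum>i\<le>?n. (\<Sum>j\<le>length (take i w). f (take j (take i w)) * g (drop j (take i w)))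
            * h (drop i w)) = (\<Sum>i=0..?n. \<Sum>j=0..i. F j (i - j) (?n - i))"
      by (auto simp: F_def sum_distrib_right atMost_atLeast0 drop_take min_def intro!: sum.cong
               split: if_splits)
    also have "\<dots> = (\<Sum>i=0..?n. \<Sum>j=0..?n - i. F i j (?n - i - j))"
      by (rule fps_mult_assoc_lemma)
    also have "\<dots> = (\<Sum>i\<le>?n. f (take i w) * (\<Sum>j\<le>length (drop i w).
        g (take j (drop i w)) * h (drop j (drop i w))))"
      by (auto simp: F_def sum_distrib_left atMost_atLeast0 mult.assoc add.commute
               intro!: sum.cong)
    finally show "(\<Sum>i\<le>?n. (\<Sum>j\<le>length (take i w). f (take j (take i w)) * g (drop j (take i w)))
            * h (drop i w)) = (\<Sum>i\<le>?n. f (take i w) * (\<Sum>j\<le>length (drop i w).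
        g (take j (drop i w)) * h (drop j (drop i w))))" .
  qed
  show "1 * a = a"
  proof (transfer, rule ext)
    fix f :: "'a list \<Rightarrow> rat" and w :: "'a list"
    have "(\<Sum>i\<le>length w. (if take i w = [] then 1 else 0) * f (drop i w))
        = (\<Sum>i\<le>length w. if i = 0 then f w else 0)"
      by (intro sum.cong) auto
    then show "(\<Sum>i\<le>length w. (if take i w = [] then 1 else 0) * f (drop i w)) = f w"
      by simp
  qed
  show "a * 1 = a"
  proof (transfer, rule ext)
    fix f :: "'a list \<Rightarrow> rat" and w :: "'a list"
    have "(\<Sum>i\<le>length w. f (take i w) * (if drop i w = [] then 1 else 0))
        = (\<Sum>i\<le>length w. if i = length w then f w else 0)"
      by (intro sum.cong) auto
    then show "(\<Sum>i\<le>length w. f (take i w) * (if drop i w = [] then 1 else 0)) = f w"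
      by simp
  qed
  show "(a + b) * c = a * c + b * c"
    by transfer (auto simp: algebra_simps sum.distrib)
  show "a * (b + c) = a * b + a * c"
    by transfer (auto simp: algebra_simps sum.distrib)
  show "(0::'a series) \<noteq> 1"
    by transfer (auto simp: fun_eq_iff)
qed (transfer; auto simp: algebra_simps)+

end

lift_definition scale :: "rat \<Rightarrow> 'g series \<Rightarrow> 'g series" is "\<lambda>c f w. c * f w" .

lift_definition gen :: "'g \<Rightarrow> 'g series" is "\<lambda>g w. if w = [g] then 1 else 0" .

lift_definition lcomp :: "nat \<Rightarrow> 'g series \<Rightarrow> 'g series"
  is "\<lambda>i f w. if length w = i then f w else 0" .

text \<open>
  \<open>fps_app a f\<close> is the substitution \<open>\<Sum>k. a\<^sub>k f\<^sup>k\<close>.  It is meant for \<open>f\<close> without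
  constant term; then \<open>f\<^sup>k\<close> has no words shorter than \<open>k\<close>, so that the truncated sum is the
  full one.
\<close>

definition fps_app :: "rat fps \<Rightarrow> 'g series \<Rightarrow> 'g series" where
  "fps_app a f = Series (\<lambda>w. \<Sum>k\<le>length w. fps_nth a k * wcoeff (f ^ k) w)"

definition sexp :: "'g series \<Rightarrow> 'g series" where
  "sexp f = fps_app (fps_exp 1) f"

text \<open>\<open>fps_ln 1\<close> is the power series of \<open>log (1 + X)\<close>.\<close>

definition slog :: "'g series \<Rightarrow> 'g series" where
  "slog f = fps_app (fps_ln 1) (f - 1)"

definition bch :: "'g series \<Rightarrow> 'g series \<Rightarrow> 'g series"  (infixl \<open>\<star>\<close> 70) where
  "x \<star> y = slog (sexp x * sexp y)"


section \<open>Complete free graded Lie algebras\<close>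

class graded_gen =
  fixes gdeg :: "'a \<Rightarrow> int"

definition wdeg :: "'g::graded_gen list \<Rightarrow> int" where
  "wdeg w = sum_list (map gdeg w)"

definition homog :: "int \<Rightarrow> 'g::graded_gen series \<Rightarrow> bool" where
  "homog n f \<longleftrightarrow> (\<forall>w. wcoeff f w \<noteq> 0 \<longrightarrow> wdeg w = n)"

text \<open>
  The bilinear extension of the graded commutator \<open>[u, v] = u v - (-1)\<^bsup>|u||v|\<^esup> v u\<close> of words.
\<close>

lift_definition gbracket :: "'g::graded_gen series \<Rightarrow> 'g series \<Rightarrow> 'g series"
  is "\<lambda>f g w. \<Sum>i\<le>length w. f (take i w) * g (drop i w)
        - (- 1) powi (wdeg (take i w) * wdeg (drop i w)) * (g (take i w) * f (drop i w))" .

text \<open>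
  The free graded Lie algebra on the graded vector space with basis \<open>S\<close>, realized as the
  graded Lie subalgebra generated by \<open>S\<close> in the tensor algebra.
\<close>

inductive_set free_lie :: "'g::graded_gen set \<Rightarrow> 'g series set" for S where
  gen: "s \<in> S \<Longrightarrow> gen s \<in> free_lie S"
| zero: "0 \<in> free_lie S"
| add: "\<lbrakk>x \<in> free_lie S; y \<in> free_lie S\<rbrakk> \<Longrightarrow> x + y \<in> free_lie S"
| scale: "x \<in> free_lie S \<Longrightarrow> scale c x \<in> free_lie S"
| bracket: "\<lbrakk>x \<in> free_lie S; y \<in> free_lie S\<rbrakk> \<Longrightarrow> gbracket x y \<in> free_lie S"

text \<open>
  The completion with respect to bracket length.  The free Lie algebra is the direct sum of its
  bracket-length components, so the inverse limit of its truncations consists of the series all of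
  whose length components are Lie elements.  The limit is taken in graded vector spaces, i.e.
  degree by degree: an element is a finite sum of homogeneous ones.
\<close>

definition Lhat :: "'g::graded_gen set \<Rightarrow> 'g series set" where
  "Lhat S = {f. (\<forall>i. lcomp i f \<in> free_lie S) \<and> finite {wdeg w | w. wcoeff f w \<noteq> 0}}"

definition Lhat_deg :: "'g::graded_gen set \<Rightarrow> int \<Rightarrow> 'g series set" where
  "Lhat_deg S n = {f \<in> Lhat S. homog n f}"

text \<open>
  \<open>fps_ad a x y\<close> is \<open>a(ad\<^sub>x)(y)\<close>, for \<open>x\<close> without constant term (as holds in \<open>Lhat\<close>); again
  the omitted terms vanish.
\<close>

definition fps_ad ::
    "rat fps \<Rightarrow> 'g::graded_gen series \<Rightarrow> 'g series \<Rightarrow> 'g series" where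
  "fps_ad a x y = Series (\<lambda>w. \<Sum>k\<le>length w. fps_nth a k * wcoeff ((gbracket x ^^ k) y) w)"


section \<open>Complete differential graded Lie algebras\<close>

text \<open>Linear maps of degree \<open>k\<close> between complete free graded Lie algebras; values outside of the
  domain \<open>Lhat S\<close> are irrelevant throughout.\<close>

definition graded_linear ::
    "'g::graded_gen set \<Rightarrow> 'g set \<Rightarrow> int \<Rightarrow> ('g series \<Rightarrow> 'g series) \<Rightarrow> bool" where
  "graded_linear S T k f \<longleftrightarrow>
     (\<forall>x\<in>Lhat S. f x \<in> Lhat T) \<and>
     (\<forall>x\<in>Lhat S. \<forall>y\<in>Lhat S. f (x + y) = f x + f y) \<and>
     (\<forall>c. \<forall>x\<in>Lhat S. f (scale c x) = scale c (f x)) \<and>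
     (\<forall>n. \<forall>x\<in>Lhat_deg S n. f x \<in> Lhat_deg T (n + k))"

definition cdgl :: "'g::graded_gen set \<Rightarrow> ('g series \<Rightarrow> 'g series) \<Rightarrow> bool" where
  "cdgl S d \<longleftrightarrow>
     graded_linear S S (- 1) d \<and>
     (\<forall>n. \<forall>x\<in>Lhat_deg S n. \<forall>y\<in>Lhat S.
        d (gbracket x y) = gbracket (d x) y + scale ((- 1) powi n) (gbracket x (d y))) \<and>
     (\<forall>x\<in>Lhat S. d (d x) = 0)"

definition cdgl_hom ::
    "'g::graded_gen set \<Rightarrow> ('g series \<Rightarrow> 'g series) \<Rightarrow> 'g set \<Rightarrow> ('g series \<Rightarrow> 'g series)
      \<Rightarrow> ('g series \<Rightarrow> 'g series) \<Rightarrow> bool" where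
  "cdgl_hom S d T d' \<phi> \<longleftrightarrow>
     graded_linear S T 0 \<phi> \<and>
     (\<forall>x\<in>Lhat S. \<forall>y\<in>Lhat S. \<phi> (gbracket x y) = gbracket (\<phi> x) (\<phi> y)) \<and>
     (\<forall>x\<in>Lhat S. \<phi> (d x) = d' (\<phi> x))"

definition cdgl_iso ::
    "'g::graded_gen set \<Rightarrow> ('g series \<Rightarrow> 'g series) \<Rightarrow> 'g set \<Rightarrow> ('g series \<Rightarrow> 'g series)
      \<Rightarrow> ('g series \<Rightarrow> 'g series) \<Rightarrow> bool" where
  "cdgl_iso S d T d' \<phi> \<longleftrightarrow> cdgl_hom S d T d' \<phi> \<and> bij_betw \<phi> (Lhat S) (Lhat T)"

definition gcdgl ::
    "('a, 'b) monoid_scheme \<Rightarrow> 'g::graded_gen set \<Rightarrow> ('g series \<Rightarrow> 'g series)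
      \<Rightarrow> ('a \<Rightarrow> 'g series \<Rightarrow> 'g series) \<Rightarrow> bool" where
  "gcdgl G S d \<rho> \<longleftrightarrow>
     cdgl S d \<and> group_action G (Lhat S) \<rho> \<and> (\<forall>g\<in>carrier G. cdgl_hom S d S d (\<rho> g))"

definition gcdgl_iso ::
    "('a, 'b) monoid_scheme
      \<Rightarrow> 'g::graded_gen set \<Rightarrow> ('g series \<Rightarrow> 'g series) \<Rightarrow> ('a \<Rightarrow> 'g series \<Rightarrow> 'g series)
      \<Rightarrow> 'g set \<Rightarrow> ('g series \<Rightarrow> 'g series) \<Rightarrow> ('a \<Rightarrow> 'g series \<Rightarrow> 'g series)
      \<Rightarrow> ('g series \<Rightarrow> 'g series) \<Rightarrow> bool" where
  "gcdgl_iso G S d \<rho> T d' \<rho>' \<phi> \<longleftrightarrow>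
     cdgl_iso S d T d' \<phi> \<and>
     (\<forall>g\<in>carrier G. \<forall>x\<in>Lhat S. \<phi> (\<rho> g x) = \<rho>' g (\<phi> x))"

definition maurer_cartan ::
    "'g::graded_gen set \<Rightarrow> ('g series \<Rightarrow> 'g series) \<Rightarrow> 'g series \<Rightarrow> bool" where
  "maurer_cartan S d a \<longleftrightarrow>
     a \<in> Lhat_deg S (- 1) \<and> d a + scale (1/2) (gbracket a a) = 0"

text \<open>
  Division of formal power series cancels the common factor \<open>X\<close>, so the two quotients below are
  the power series \<open>-1 + X/2 - \<dots>\<close> and \<open>1 + X/2 + \<dots>\<close>.
\<close>

definition LS_interval ::
    "('g::graded_gen series \<Rightarrow> 'g series) \<Rightarrow> 'g \<Rightarrow> 'g \<Rightarrow> 'g \<Rightarrow> bool" where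
  "LS_interval d a b x \<longleftrightarrow>
     gdeg a = - 1 \<and> gdeg b = - 1 \<and> gdeg x = 0 \<and>
     d (gen a) = - scale (1/2) (gbracket (gen a) (gen a)) \<and>
     d (gen b) = - scale (1/2) (gbracket (gen b) (gen b)) \<and>
     d (gen x) = fps_ad (fps_X / (1 - fps_exp 1)) (gen x) (gen a)
               + fps_ad (fps_X / (1 - fps_exp (- 1))) (gen x) (gen b)"


section \<open>The models of the triangle and of its boundary\<close>

datatype tri_gen = V1 | V2 | V3 | X1 | X2 | X3 | E | E'

instantiation tri_gen :: graded_gen
begin

fun gdeg_tri_gen :: "tri_gen \<Rightarrow> int" where
  "gdeg V1 = - 1" | "gdeg V2 = - 1" | "gdeg V3 = - 1"
| "gdeg X1 = 0" | "gdeg X2 = 0" | "gdeg X3 = 0"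
| "gdeg E = 1" | "gdeg E' = 1"

instance ..

end

abbreviation "v1 \<equiv> gen V1"
abbreviation "v2 \<equiv> gen V2"
abbreviation "v3 \<equiv> gen V3"
abbreviation "x1 \<equiv> gen X1"
abbreviation "x2 \<equiv> gen X2"
abbreviation "x3 \<equiv> gen X3"
abbreviation "e \<equiv> gen E"
abbreviation "e' \<equiv> gen E'"

definition Gam :: "tri_gen set" where
  "Gam = {V1, V2, V3, X1, X2, X3}"

definition L_Gamma :: "(tri_gen series \<Rightarrow> tri_gen series) \<Rightarrow> bool" where
  "L_Gamma d \<longleftrightarrow>
     cdgl Gam d \<and>
     maurer_cartan Gam d v1 \<and> maurer_cartan Gam d v2 \<and> maurer_cartan Gam d v3 \<and>
     LS_interval d V1 V2 X1 \<and> LS_interval d V2 V3 X2 \<and> LS_interval d V3 V1 X3"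

abbreviation Sigma3 :: "(nat \<Rightarrow> nat) monoid" where
  "Sigma3 \<equiv> sym_group 3"

definition \<sigma> :: "nat \<Rightarrow> nat" where
  "\<sigma> = (\<lambda>i. if i = 1 then 2 else if i = 2 then 3 else if i = 3 then 1 else i)"

definition \<tau> :: "nat \<Rightarrow> nat" where
  "\<tau> = transpose 2 3"

lemma Sigma3_relations:
  "\<sigma> \<in> carrier Sigma3" "\<tau> \<in> carrier Sigma3"
  "\<sigma> \<circ> \<sigma> \<circ> \<sigma> = id" "\<tau> \<circ> \<tau> = id" "\<sigma> \<circ> \<tau> = \<tau> \<circ> (\<sigma> \<circ> \<sigma>)"
proof -
  show "\<sigma> \<circ> \<sigma> \<circ> \<sigma> = id"
    by (auto simp: \<sigma>_def fun_eq_iff)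
  show "\<sigma> \<in> carrier Sigma3"
    unfolding sym_group_carrier
    by (rule inj_imp_permutes) (auto simp: \<sigma>_def inj_on_def split: if_splits)
  show "\<tau> \<in> carrier Sigma3"
    unfolding sym_group_carrier \<tau>_def by (intro permutes_swap_id) auto
  show "\<tau> \<circ> \<tau> = id"
    by (simp add: \<tau>_def)
  show "\<sigma> \<circ> \<tau> = \<tau> \<circ> (\<sigma> \<circ> \<sigma>)"
    by (auto simp: \<sigma>_def \<tau>_def transpose_def fun_eq_iff)
qed

definition Sigma3_action ::
    "(tri_gen series \<Rightarrow> tri_gen series)
      \<Rightarrow> ((nat \<Rightarrow> nat) \<Rightarrow> tri_gen series \<Rightarrow> tri_gen series) \<Rightarrow> bool" where
  "Sigma3_action d \<rho> \<longleftrightarrow>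
     gcdgl Sigma3 Gam d \<rho> \<and>
     \<rho> \<sigma> v1 = v2 \<and> \<rho> \<sigma> v2 = v3 \<and> \<rho> \<sigma> v3 = v1 \<and>
     \<rho> \<sigma> x1 = x2 \<and> \<rho> \<sigma> x2 = x3 \<and> \<rho> \<sigma> x3 = x1 \<and>
     \<rho> \<tau> v1 = v1 \<and> \<rho> \<tau> v2 = v3 \<and> \<rho> \<tau> v3 = v2 \<and>
     \<rho> \<tau> x1 = - x3 \<and> \<rho> \<tau> x2 = - x2 \<and> \<rho> \<tau> x3 = - x1"

definition L_2 ::
    "(tri_gen series \<Rightarrow> tri_gen series) \<Rightarrow> (tri_gen series \<Rightarrow> tri_gen series) \<Rightarrow> bool" where
  "L_2 d d\<^sub>2 \<longleftrightarrow>
     cdgl (insert E Gam) d\<^sub>2 \<and> (\<forall>x\<in>Lhat Gam. d\<^sub>2 x = d x) \<and>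
     d\<^sub>2 e = - gbracket v1 e + x1 \<star> x2 \<star> x3"

text \<open>
  The linear part of a series.  Maurer-Cartan elements with vanishing linear part, such as
  \<open>0\<close>, cannot occur as the twisting element \<open>\<Omega>\<close> of an attached generator: if
  \<open>d e' = - [\<Omega>, e'] + \<beta> \<star> x1 \<star> x2 \<star> x3 \<star> (- \<beta>)\<close> and \<open>\<Omega>\<close> has no linear part, then the part
  of \<open>d (d e')\<close> of length two is \<open>- [v, x1 + x2 + x3]\<close>, for a combination \<open>v\<close> of \<open>v1\<close>, \<open>v2\<close>,
  \<open>v3\<close> whose coefficients add up to one, and hence \<open>d (d e') \<noteq> 0\<close>.
\<close>

definition linear_part :: "'g series \<Rightarrow> 'g series" where
  "linear_part f = lcomp 1 f"

end

theory Submission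
  imports Defs "HOL-Library.Multiset"
begin

text \<open>
  A change of generators turns \<open>L(\<Gamma>)\<close> into a model with generators \<open>v1\<close>, the closed
  loop \<open>x1 \<star> x2 \<star> x3\<close>, the edges \<open>x1\<close>, \<open>x3\<close> and their boundaries.  There the derivation
  sending the two boundaries back to the edges contracts everything except \<open>v1\<close> and the loop.
  Two consequences carry the proof.  First, an element \<open>\<Omega>\<close> as in the theorem is gauge equivalent
  to \<open>v1\<close>: the gauge \<open>exp \<alpha>\<close> is the solution of \<open>N (exp \<alpha>) = \<lambda> exp \<alpha>\<close>, where \<open>N\<close> is the
  weight counting the contracted generators and \<open>\<lambda>\<close> is minus the contraction applied to \<open>\<Omega>\<close>.
  Secondly, the degree zero cycles of the differential twisted by \<open>v1\<close> are power series in the loop.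
  The gauges \<open>exp \<alpha>\<close> and \<open>g (exp \<alpha>)\<close>, for \<open>g \<in> \<Sigma>\<^sub>3\<close>, differ by such a cycle,
  up to an edge moving the base point, so that
  conjugating the loop by \<open>exp \<alpha>\<close> makes it invariant under \<open>\<sigma>\<close> and anti-invariant
  under \<open>\<tau>\<close>.  Finally \<open>e' = exp (ad\<^sub>\<alpha>) e\<close>, which determines the isomorphism.
\<close>

section \<open>The series algebra\<close>

text \<open>Gauges are exponentials, hence not Lie elements. The differential and the action, known
  only on \<open>Lhat\<close>, are therefore extended to a continuous odd derivation and to
  continuous algebra maps of all series. There the Lawrence-Sullivan formula becomes
  \<open>D (sexp x) = sexp x * b - a * sexp x\<close>: edges and gauges are transports between
  Maurer-Cartan elements that compose by multiplication, and the Bernoulli numbers disappear. The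
  price is the way back: what is constructed has to be recognized as Lie, which the Dynkin operator
  makes possible. No equivariant gauge is chosen and nothing is averaged. Two gauges from
  \<open>v1\<close> to \<Omega> differ by a factor commuting with the loop, so the conjugated loop
  depends on \<Omega> alone and inherits its symmetry. The sign in \<open>\<tau> e' = - e'\<close>
  reflects that \<tau> runs through the loop backwards. The linear part of \<Omega> matters because
  the weight-zero part of \<Omega> in the model is again a Maurer-Cartan element and could be
  \<open>0\<close> as well as \<open>v1\<close>; a nonzero linear part, spread evenly over the
  vertices by invariance, excludes \<open>0\<close>.\<close>

lemma wcoeff_zero [simp]: "wcoeff 0 w = 0"
  by transfer simp

lemma wcoeff_one: "wcoeff 1 w = (if w = [] then 1 else 0)"
  by transfer simp

lemma wcoeff_add [simp]: "wcoeff (f + g) w = wcoeff f w + wcoeff g w"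
  by transfer simp

lemma wcoeff_diff [simp]: "wcoeff (f - g) w = wcoeff f w - wcoeff g w"
  by transfer simp

lemma wcoeff_uminus [simp]: "wcoeff (- f) w = - wcoeff f w"
  by transfer simp

lemma wcoeff_scale [simp]: "wcoeff (scale c f) w = c * wcoeff f w"
  by transfer simp

lemma wcoeff_mult: "wcoeff (f * g) w = (\<Sum>i\<le>length w. wcoeff f (take i w) * wcoeff g (drop i w))"
  by transfer simp

lemma wcoeff_gen: "wcoeff (gen s) w = (if w = [s] then 1 else 0)"
  by transfer simp

lemma wcoeff_lcomp: "wcoeff (lcomp i f) w = (if length w = i then wcoeff f w else 0)"
  by transfer simp

lemma wcoeff_Series [simp]: "wcoeff (Series F) w = F w"
  by (simp add: Series_inverse)

lemma wcoeff_sum [simp]: "wcoeff (sum f A) w = (\<Sum>a\<in>A. wcoeff (f a) w)"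
  by (induction A rule: infinite_finite_induct) auto

lemma scale_simps [simp]:
  "scale c (f + g) = scale c f + scale c g"
  "scale c (f - g) = scale c f - scale c g"
  "scale c (- f) = - scale c f"
  "scale c (scale b f) = scale (c * b) f"
  "scale 1 f = f"
  "scale 0 f = 0"
  "scale c 0 = 0"
  "scale c f * g = scale c (f * g)"
  "f * scale c g = scale c (f * g)"
  "scale (- c) f = - scale c f"
  by (rule series_eqI; simp add: wcoeff_mult sum_distrib_left algebra_simps)+

lemma scale_sum: "scale c (sum f A) = (\<Sum>a\<in>A. scale c (f a))"
  by (rule series_eqI) (simp add: sum_distrib_left)

lemma scale_add_left: "scale (b + c) f = scale b f + scale c f"
  by (rule series_eqI) (simp add: algebra_simps)

lemma scale_half_double: "scale (1/2) (f + f) = f"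
  by (rule series_eqI) simp

section \<open>Monomials and the word-length filtration\<close>

definition mon :: "'g list \<Rightarrow> 'g series" where
  "mon u = Series (\<lambda>w. if w = u then 1 else 0)"

lemma wcoeff_mon: "wcoeff (mon u) w = (if w = u then 1 else 0)"
  by (simp add: mon_def)

lemma mon_Nil: "mon [] = 1"
  by (rule series_eqI) (simp add: wcoeff_mon wcoeff_one)

lemma mon_single: "mon [s] = gen s"
  by (rule series_eqI) (simp add: wcoeff_mon wcoeff_gen)

lemma mon_append: "mon (u @ v) = mon u * mon v"
proof (rule series_eqI)
  fix w
  have "wcoeff (mon u * mon v) w
      = (\<Sum>i\<le>length w. if take i w = u \<and> drop i w = v then 1 else 0)"
    unfolding wcoeff_mult by (intro sum.cong) (auto simp: wcoeff_mon)
  also have "\<dots> = (\<Sum>i\<le>length w. if i = length u \<and> w = u @ v then 1 else 0)"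
    by (intro sum.cong refl if_cong)
       (metis (no_types, lifting) append_eq_conv_conj append_take_drop_id atMost_iff length_take min.absorb2)
  also have "\<dots> = wcoeff (mon (u @ v)) w"
    by (auto simp: wcoeff_mon)
  finally show "wcoeff (mon (u @ v)) w = wcoeff (mon u * mon v) w" ..
qed

lemma mon_Cons: "mon (s # u) = gen s * mon u"
  using mon_append[of "[s]" u] by (simp add: mon_single)

lemma mon_replicate: "mon (replicate n s) = gen s ^ n"
  by (induction n) (auto simp: mon_Nil mon_Cons)

text \<open>The filtration replaces a topology: continuous maps respect its steps, limits agree with
  their approximants modulo them, and an element of all of them is zero.\<close>

definition fil :: "nat \<Rightarrow> 'g series set" where
  "fil n = {f. \<forall>w. length w < n \<longrightarrow> wcoeff f w = 0}"

lemma fil_0 [simp]: "f \<in> fil 0"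
  by (simp add: fil_def)

lemma fil_closed [simp, intro]:
  "0 \<in> fil n"
  "f \<in> fil n \<Longrightarrow> g \<in> fil n \<Longrightarrow> f + g \<in> fil n"
  "f \<in> fil n \<Longrightarrow> g \<in> fil n \<Longrightarrow> f - g \<in> fil n"
  "f \<in> fil n \<Longrightarrow> - f \<in> fil n"
  "f \<in> fil n \<Longrightarrow> scale c f \<in> fil n"
  by (auto simp: fil_def)

lemma fil_sum: "(\<And>a. a \<in> A \<Longrightarrow> f a \<in> fil n) \<Longrightarrow> sum f A \<in> fil n"
  by (simp add: fil_def)

lemma fil_mono: "f \<in> fil m \<Longrightarrow> n \<le> m \<Longrightarrow> f \<in> fil n"
  by (auto simp: fil_def)

lemma fil_mult: "f \<in> fil m \<Longrightarrow> g \<in> fil n \<Longrightarrow> f * g \<in> fil (m + n)"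
  unfolding fil_def
proof safe
  fix w :: "'a list"
  assume f: "\<forall>w. length w < m \<longrightarrow> wcoeff f w = 0"
    and g: "\<forall>w. length w < n \<longrightarrow> wcoeff g w = 0" and w: "length w < m + n"
  show "wcoeff (f * g) w = 0"
    unfolding wcoeff_mult
  proof (intro sum.neutral ballI)
    fix i
    assume "i \<in> {..length w}"
    then have "length (take i w) < m \<or> length (drop i w) < n"
      using w by auto
    then show "wcoeff f (take i w) * wcoeff g (drop i w) = 0"
      using f g by (metis mult_zero_left mult_zero_right)
  qed
qed

lemma fil_mult_left: "f \<in> fil n \<Longrightarrow> f * g \<in> fil n"
  using fil_mult[of f n g 0] by simp

lemma fil_mult_right: "g \<in> fil n \<Longrightarrow> f * g \<in> fil n"
  using fil_mult[of f 0 g n] by simp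

lemma fil_power: "f \<in> fil 1 \<Longrightarrow> f ^ n \<in> fil n"
  by (induction n) (use fil_mult[of f 1] in auto)

lemma fil_gen: "gen s \<in> fil 1"
  by (auto simp: fil_def wcoeff_gen)

lemma fil_mon: "mon u \<in> fil (length u)"
  by (auto simp: fil_def wcoeff_mon)

lemma fil_coeff: "f \<in> fil n \<Longrightarrow> length w < n \<Longrightarrow> wcoeff f w = 0"
  by (auto simp: fil_def)

lemma fil_all_zero: "(\<And>n. f \<in> fil n) \<Longrightarrow> f = 0"
  by (rule series_eqI) (use fil_coeff in force)

lemma fil_1_iff: "f \<in> fil 1 \<longleftrightarrow> wcoeff f [] = 0"
  by (auto simp: fil_def)

section \<open>Continuous linear maps\<close>

text \<open>Continuity in the strong form of not lowering the filtration. Over a finite alphabet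
  such a map is determined by its values on monomials, so identities between maps reduce to
  words.\<close>

definition clin :: "('g series \<Rightarrow> 'h series) \<Rightarrow> bool" where
  "clin L \<longleftrightarrow> (\<forall>f g. L (f + g) = L f + L g) \<and> (\<forall>c f. L (scale c f) = scale c (L f)) \<and>
     (\<forall>n f. f \<in> fil n \<longrightarrow> L f \<in> fil n)"

lemma clinI:
  "(\<And>f g. L (f + g) = L f + L g) \<Longrightarrow> (\<And>c f. L (scale c f) = scale c (L f)) \<Longrightarrow>
   (\<And>n f. f \<in> fil n \<Longrightarrow> L f \<in> fil n) \<Longrightarrow> clin L"
  by (simp add: clin_def)

lemma clinD:
  assumes "clin L"
  shows "L (f + g) = L f + L g" "L (scale c f) = scale c (L f)" "f \<in> fil n \<Longrightarrow> L f \<in> fil n"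
    "L 0 = 0" "L (- f) = - L f" "L (f - g) = L f - L g" "L (sum h A) = (\<Sum>a\<in>A. L (h a))"
proof -
  show add: "L (f + g) = L f + L g" for f g
    using assms by (simp add: clin_def)
  show sc: "L (scale c f) = scale c (L f)" for c f
    using assms by (simp add: clin_def)
  show "f \<in> fil n \<Longrightarrow> L f \<in> fil n"
    using assms by (simp add: clin_def)
  show z: "L 0 = 0"
    using add[of 0 0] by simp
  show um: "L (- f) = - L f" for f
    using add[of f "- f"] z by (simp add: minus_unique)
  show "L (f - g) = L f - L g"
    using add[of f "- g"] um by simp
  show "L (sum h A) = (\<Sum>a\<in>A. L (h a))"
    by (induction A rule: infinite_finite_induct) (auto simp: z add)
qed

lemma clin_id: "clin (\<lambda>f. f)"
  by (simp add: clin_def)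

lemma clin_comp: "clin L \<Longrightarrow> clin M \<Longrightarrow> clin (\<lambda>f. L (M f))"
  by (simp add: clin_def)

lemma clin_add: "clin L \<Longrightarrow> clin M \<Longrightarrow> clin (\<lambda>f. L f + M f)"
  by (simp add: clin_def)

lemma clin_diff: "clin L \<Longrightarrow> clin M \<Longrightarrow> clin (\<lambda>f. L f - M f)"
  by (auto simp: clin_def)

lemma clin_sum: "(\<And>a. clin (L a)) \<Longrightarrow> clin (\<lambda>f. \<Sum>a\<in>A. L a f)"
  by (rule clinI) (simp_all add: clinD sum.distrib scale_sum fil_sum)

lemma clin_mult_right: "clin L \<Longrightarrow> clin (\<lambda>f. L f * g)"
  by (auto simp: clin_def algebra_simps fil_mult_left)

lemma clin_mult_left: "clin L \<Longrightarrow> clin (\<lambda>f. g * L f)"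
  by (auto simp: clin_def algebra_simps fil_mult_right)

lemma clin_scale: "clin L \<Longrightarrow> clin (\<lambda>f. scale c (L f))"
  by (auto simp: clin_def mult.commute)

lemma clin_pow:
  fixes L :: "'g series \<Rightarrow> 'g series"
  assumes "clin L"
  shows "clin (L ^^ n)"
proof (induction n)
  case 0
  show ?case
    by (simp add: clin_def)
next
  case (Suc n)
  then show ?case
    using clin_comp[OF assms Suc] by (simp add: comp_def)
qed

lemmas clin_intros = clin_id clin_add clin_diff clin_mult_right clin_mult_left clin_scale

section \<open>Truncations, extension from words, and limits\<close>

lemma finite_words [simp]: "finite {u :: 'g::finite list. length u \<le> n}"
  using finite_lists_length_le[of "UNIV :: 'g set" n] by simp

lemma finite_words_less [simp]: "finite {u :: 'g::finite list. length u < n}"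
  by (rule finite_subset[OF _ finite_words[of n]]) auto

definition trunc :: "nat \<Rightarrow> 'g series \<Rightarrow> 'g series" where
  "trunc n f = (\<Sum>u | length u < n. scale (wcoeff f u) (mon u))"

lemma wcoeff_trunc: "wcoeff (trunc n f) (w :: 'g::finite list) = (if length w < n then wcoeff f w else 0)"
  by (simp add: trunc_def wcoeff_mon if_distrib[of "\<lambda>x. _ * x"] cong: if_cong)

lemma trunc_fil: "f - trunc n f \<in> fil n" for f :: "'g::finite series"
  by (simp add: fil_def wcoeff_trunc)

text \<open>The part of \<open>f\<close> on words longer than \<open>w\<close> stays in
  \<open>fil (Suc (length w))\<close> under \<open>L\<close> and cannot reach the coefficient at
  \<open>w\<close>.\<close>

lemma clin_wcoeff:
  fixes L :: "'g::finite series \<Rightarrow> 'h series"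
  assumes "clin L"
  shows "wcoeff (L f) w = (\<Sum>u | length u \<le> length w. wcoeff f u * wcoeff (L (mon u)) w)"
proof -
  have "L f - L (trunc (Suc (length w)) f) \<in> fil (Suc (length w))"
    using clinD(3)[OF assms trunc_fil] clinD(6)[OF assms] by metis
  then have "wcoeff (L f) w = wcoeff (L (trunc (Suc (length w)) f)) w"
    using fil_coeff[of _ "Suc (length w)" w] by fastforce
  also have "\<dots> = (\<Sum>u | length u \<le> length w. wcoeff f u * wcoeff (L (mon u)) w)"
    by (simp add: trunc_def clinD(7)[OF assms] clinD(2)[OF assms] less_Suc_eq_le)
  finally show ?thesis .
qed

lemma clin_eq_on:
  fixes L M :: "'g::finite series \<Rightarrow> 'h series"
  assumes "clin L" "clin M" "\<And>u. wcoeff f u \<noteq> 0 \<Longrightarrow> L (mon u) = M (mon u)"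
  shows "L f = M f"
proof (rule series_eqI)
  fix w
  have "wcoeff f u * wcoeff (L (mon u)) w = wcoeff f u * wcoeff (M (mon u)) w" for u
    using assms(3)[of u] by (cases "wcoeff f u = 0") auto
  then show "wcoeff (L f) w = wcoeff (M f) w"
    by (simp only: clin_wcoeff[OF assms(1), of f] clin_wcoeff[OF assms(2), of f])
qed

lemma clin_eqI:
  fixes L M :: "'g::finite series \<Rightarrow> 'h series"
  assumes "clin L" "clin M" "\<And>u. L (mon u) = M (mon u)"
  shows "L f = M f"
  by (rule clin_eq_on[OF assms(1,2)]) (rule assms(3))

text \<open>The bound on \<open>u\<close> makes the sum finite. It drops nothing when
  \<open>F u\<close> has no words shorter than \<open>u\<close>, the condition under which
  \<open>lext_mon\<close> recovers \<open>F\<close>.\<close>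

definition lext :: "('g list \<Rightarrow> 'h series) \<Rightarrow> 'g series \<Rightarrow> 'h series" where
  "lext F f = Series (\<lambda>w. \<Sum>u | length u \<le> length w. wcoeff f u * wcoeff (F u) w)"

lemma clin_lext:
  fixes F :: "'g::finite list \<Rightarrow> 'h series"
  shows "clin (lext F)"
proof (rule clinI)
  fix n and f :: "'g series"
  assume f: "f \<in> fil n"
  show "lext F f \<in> fil n"
    unfolding fil_def lext_def using f by (auto intro!: sum.neutral simp: fil_coeff)
qed (rule series_eqI, simp add: lext_def algebra_simps sum.distrib sum_distrib_left)+

lemma lext_mon:
  fixes F :: "'g::finite list \<Rightarrow> 'h series"
  assumes "F u \<in> fil (length u)"
  shows "lext F (mon u) = F u"
proof (rule series_eqI)
  fix w
  have "wcoeff (lext F (mon u)) w = (if length u \<le> length w then wcoeff (F u) w else 0)"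
    by (simp add: lext_def wcoeff_mon if_distrib[of "\<lambda>x. x * _"] cong: if_cong)
  then show "wcoeff (lext F (mon u)) w = wcoeff (F u) w"
    using fil_coeff[OF assms, of w] by auto
qed

text \<open>The stage \<open>Suc (length w)\<close> is the first after which successive differences
  in \<open>fil n\<close> forbid a change at \<open>w\<close>.\<close>

definition lim_at :: "(nat \<Rightarrow> 'g series) \<Rightarrow> 'g series" where
  "lim_at a = Series (\<lambda>w. wcoeff (a (Suc (length w))) w)"

lemma lim_at:
  assumes "\<And>n. a (Suc n) - a n \<in> fil n"
  shows "lim_at a - a n \<in> fil n"
proof -
  have stable: "m \<ge> k \<Longrightarrow> a m - a k \<in> fil k" for m k
  proof (induction m rule: dec_induct)
    case (step m)
    have "a (Suc m) - a k = (a (Suc m) - a m) + (a m - a k)"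
      by simp
    then show ?case
      using fil_mono[OF assms[of m]] step by (metis fil_closed(2) less_imp_le_nat)
  qed simp
  show ?thesis
    unfolding fil_def
  proof safe
    fix w :: "'a list"
    assume "length w < n"
    then have "a n - a (Suc (length w)) \<in> fil (Suc (length w))"
      using stable by simp
    then show "wcoeff (lim_at a - a n) w = 0"
      using fil_coeff[of "a n - a (Suc (length w))" "Suc (length w)" w] by (simp add: lim_at_def)
  qed
qed

section \<open>Algebra homomorphisms\<close>

definition chom :: "('g series \<Rightarrow> 'h series) \<Rightarrow> bool" where
  "chom \<phi> \<longleftrightarrow> clin \<phi> \<and> \<phi> 1 = 1 \<and> (\<forall>f g. \<phi> (f * g) = \<phi> f * \<phi> g)"

lemma chomD:
  assumes "chom \<phi>"
  shows "clin \<phi>" "\<phi> 1 = 1" "\<phi> (f * g) = \<phi> f * \<phi> g" "\<phi> (f ^ n) = \<phi> f ^ n"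
    "\<phi> (f + g) = \<phi> f + \<phi> g" "\<phi> (f - g) = \<phi> f - \<phi> g" "\<phi> (- f) = - \<phi> f" "\<phi> 0 = 0"
    "\<phi> (scale c f) = scale c (\<phi> f)" "f \<in> fil n \<Longrightarrow> \<phi> f \<in> fil n"
proof -
  show *: "clin \<phi>" "\<phi> 1 = 1" "\<phi> (f * g) = \<phi> f * \<phi> g" for f g
    using assms by (auto simp: chom_def)
  show "\<phi> (f ^ n) = \<phi> f ^ n"
    by (induction n) (simp_all add: *)
qed (rule clinD[OF chom_def[THEN iffD1, OF assms, THEN conjunct1]]; assumption)+

lemma chom_comp: "chom \<phi> \<Longrightarrow> chom \<psi> \<Longrightarrow> chom (\<lambda>f. \<phi> (\<psi> f))"
  by (simp add: chom_def clin_comp)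

lemma chom_id: "chom (\<lambda>f. f)"
  by (simp add: chom_def clin_id)

definition hom_ext :: "('g \<Rightarrow> 'h series) \<Rightarrow> 'g series \<Rightarrow> 'h series" where
  "hom_ext h = lext (\<lambda>u. prod_list (map h u))"

lemma fil_prod_list: "(\<And>s. h s \<in> fil 1) \<Longrightarrow> prod_list (map h u) \<in> fil (length u)"
  by (induction u) (use fil_mult[of _ 1] in auto)

lemma hom_ext_mon:
  fixes h :: "'g::finite \<Rightarrow> 'h series"
  shows "(\<And>s. h s \<in> fil 1) \<Longrightarrow> hom_ext h (mon u) = prod_list (map h u)"
  unfolding hom_ext_def by (intro lext_mon fil_prod_list)

lemma clin_hom_ext: "clin (hom_ext h)" for h :: "'g::finite \<Rightarrow> 'h series"
  unfolding hom_ext_def by (rule clin_lext)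

lemma chom_hom_ext:
  fixes h :: "'g::finite \<Rightarrow> 'h series"
  assumes h: "\<And>s. h s \<in> fil 1"
  shows "chom (hom_ext h)"
  unfolding chom_def
proof (intro conjI allI clin_hom_ext)
  note L = clin_hom_ext[of h]
  show "hom_ext h 1 = 1"
    using hom_ext_mon[of h "[]"] h by (simp add: mon_Nil)
  fix f g :: "'g series"
  have *: "hom_ext h (mon u * g) = hom_ext h (mon u) * hom_ext h g" for u
    by (rule clin_eqI[where f = g]) (simp_all add: clin_comp[OF L] clin_mult_left L clin_id
        flip: mon_append add: hom_ext_mon[OF h])
  show "hom_ext h (f * g) = hom_ext h f * hom_ext h g"
    by (rule clin_eqI[where f = f]) (simp_all add: clin_comp[OF L] clin_mult_right L clin_id *)
qed

lemma hom_ext_gen: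
  fixes h :: "'g::finite \<Rightarrow> 'h series"
  assumes h: "\<And>s. h s \<in> fil 1"
  shows "hom_ext h (gen s) = h s"
  using hom_ext_mon[of h "[s]"] h by (simp add: mon_single)

definition supported :: "'g set \<Rightarrow> 'g series \<Rightarrow> bool" where
  "supported S f \<longleftrightarrow> (\<forall>w. wcoeff f w \<noteq> 0 \<longrightarrow> set w \<subseteq> S)"

lemma chom_eq_on:
  fixes \<phi> \<psi> :: "'g::finite series \<Rightarrow> 'h series"
  assumes \<phi>: "chom \<phi>" "chom \<psi>" and gen: "\<And>s. s \<in> S \<Longrightarrow> \<phi> (gen s) = \<psi> (gen s)" and f: "supported S f"
  shows "\<phi> f = \<psi> f"
proof (rule clin_eq_on)
  have "\<phi> (mon u) = \<psi> (mon u)" if "set u \<subseteq> S" for u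
    using that by (induction u) (simp_all add: mon_Nil mon_Cons chomD(2,3)[OF \<phi>(1)] chomD(2,3)[OF \<phi>(2)] gen)
  then show "wcoeff f u \<noteq> 0 \<Longrightarrow> \<phi> (mon u) = \<psi> (mon u)" for u
    using f by (auto simp: supported_def)
qed (use \<phi> chomD(1) in auto)

lemma chom_eqI:
  fixes \<phi> \<psi> :: "'g::finite series \<Rightarrow> 'h series"
  assumes "chom \<phi>" "chom \<psi>" "\<And>s. \<phi> (gen s) = \<psi> (gen s)"
  shows "\<phi> f = \<psi> f"
  by (rule chom_eq_on[where S = UNIV, OF assms]) (simp add: supported_def)

text \<open>Only words of length at most one reach the coefficient at \<open>[t]\<close>, and the
  empty word contributes nothing because \<phi> fixes \<open>1\<close>.\<close>

lemma chom_linear_coeff: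
  fixes \<phi> :: "'g::finite series \<Rightarrow> 'h series"
  assumes "chom \<phi>"
  shows "wcoeff (\<phi> f) [t] = (\<Sum>s\<in>UNIV. wcoeff f [s] * wcoeff (\<phi> (gen s)) [t])"
proof -
  have "{u :: 'g list. length u \<le> 1} = insert [] ((\<lambda>s. [s]) ` UNIV)"
    by (auto simp: le_Suc_eq length_Suc_conv)
  then show ?thesis
    unfolding clin_wcoeff[OF chomD(1)[OF assms], of f]
    by (simp, subst sum.insert)
       (auto simp: sum.reindex inj_on_def mon_Nil mon_single chomD(2)[OF assms] wcoeff_one)
qed

section \<open>The parity twist and odd derivations\<close>

definition psgn :: "int \<Rightarrow> rat" where
  "psgn n = (if even n then 1 else - 1)"

lemma psgn_simps [simp]:
  "psgn 0 = 1" "psgn 1 = - 1" "psgn (- n) = psgn n" "psgn (m + n) = psgn m * psgn n"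
  "psgn n * psgn n = 1" "psgn n * (psgn n * c) = c" "psgn n * (c * psgn n) = c"
  by (auto simp: psgn_def)

lemma powi_psgn: "(- 1) powi n = psgn n"
  by (auto simp: psgn_def power_int_minus_left)

lemma wdeg_simps [simp]:
  "wdeg [] = 0" "wdeg (s # u) = gdeg s + wdeg u" "wdeg (u @ v) = wdeg u + wdeg v"
  by (simp_all add: wdeg_def)

text \<open>The parity automorphism. It allows the graded Leibniz rule and the graded commutator to
  be written for inhomogeneous series, without splitting them into homogeneous parts.\<close>

definition tw :: "'g::graded_gen series \<Rightarrow> 'g series" where
  "tw f = Series (\<lambda>w. psgn (wdeg w) * wcoeff f w)"

lemma wcoeff_tw: "wcoeff (tw f) w = psgn (wdeg w) * wcoeff f w"
  by (simp add: tw_def)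

lemma wdeg_take_drop: "wdeg (take i w) + wdeg (drop i w) = wdeg w"
  by (metis append_take_drop_id wdeg_simps(3))

lemma chom_tw: "chom tw"
  unfolding chom_def
proof (intro conjI allI clinI)
  show "tw (f * g) = tw f * tw g" for f g :: "'a series"
  proof (rule series_eqI)
    fix w :: "'a list"
    have "psgn (wdeg w) = psgn (wdeg (take i w)) * psgn (wdeg (drop i w))" for i
      by (simp only: psgn_simps(4)[symmetric] wdeg_take_drop)
    then show "wcoeff (tw (f * g)) w = wcoeff (tw f * tw g) w"
      by (simp add: wcoeff_tw wcoeff_mult sum_distrib_left mult_ac)
  qed
  show "tw 1 = (1 :: 'a series)"
    by (rule series_eqI) (simp add: wcoeff_tw wcoeff_one)
qed (auto intro!: series_eqI simp: wcoeff_tw algebra_simps fil_def)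

lemmas tw_simps = chomD(2-9)[OF chom_tw]

lemma clin_tw: "clin tw"
  using chom_tw chomD by blast

lemma tw_tw [simp]: "tw (tw f) = f"
  by (rule series_eqI) (simp add: wcoeff_tw)

lemma tw_homog: "homog n f \<Longrightarrow> tw f = scale (psgn n) f"
  by (rule series_eqI) (auto simp: wcoeff_tw homog_def)

lemma homog_gen: "homog (gdeg s) (gen s)"
  by (auto simp: homog_def wcoeff_gen)

lemma homog_mon: "homog (wdeg u) (mon u)"
  by (auto simp: homog_def wcoeff_mon)

lemma homog_closed [simp, intro]:
  "homog n 0"
  "homog n f \<Longrightarrow> homog n g \<Longrightarrow> homog n (f + g)"
  "homog n f \<Longrightarrow> homog n g \<Longrightarrow> homog n (f - g)"
  "homog n f \<Longrightarrow> homog n (- f)"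
  "homog n f \<Longrightarrow> homog n (scale c f)"
  "homog 0 1"
  by (auto simp: homog_def wcoeff_one) (metis add.right_neutral, metis diff_self)

lemma homog_mult:
  assumes "homog m f" "homog n g"
  shows "homog (m + n) (f * g)"
  unfolding homog_def
proof safe
  fix w :: "'a list"
  assume "wcoeff (f * g) w \<noteq> 0"
  then obtain i where "wcoeff f (take i w) * wcoeff g (drop i w) \<noteq> 0"
    unfolding wcoeff_mult by (meson sum.neutral)
  then show "wdeg w = m + n"
    using assms wdeg_take_drop[of i w] by (auto simp: homog_def)
qed

lemma homog_0_power: "homog 0 f \<Longrightarrow> homog 0 (f ^ n)"
  by (induction n) (use homog_mult[of 0 f 0] in auto)

lemma homog_clin:
  fixes L :: "'g::{graded_gen, finite} series \<Rightarrow> 'h::graded_gen series"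
  assumes "clin L" "\<And>u. homog (wdeg u + k) (L (mon u))" "homog n f"
  shows "homog (n + k) (L f)"
  unfolding homog_def
proof safe
  fix w
  assume "wcoeff (L f) w \<noteq> 0"
  then obtain u where "wcoeff f u * wcoeff (L (mon u)) w \<noteq> 0"
    unfolding clin_wcoeff[OF assms(1), of f] by (meson sum.neutral)
  then show "wdeg w = n + k"
    using assms(2)[of u] assms(3) by (auto simp: homog_def)
qed

lemma chom_homog:
  fixes \<phi> :: "'g::{graded_gen, finite} series \<Rightarrow> 'h::graded_gen series"
  assumes "chom \<phi>" "\<And>s. homog (gdeg s) (\<phi> (gen s))" "homog n f"
  shows "homog n (\<phi> f)"
proof -
  have "homog (wdeg u + 0) (\<phi> (mon u))" for u
    by (induction u) (use homog_mult[OF assms(2)] in \<open>simp_all add: mon_Nil mon_Cons chomD[OF assms(1)]\<close>)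
  from homog_clin[OF chomD(1)[OF assms(1)] this assms(3)] show ?thesis
    by simp
qed

lemma chom_tw_commute:
  fixes \<phi> :: "'g::{graded_gen, finite} series \<Rightarrow> 'h::graded_gen series"
  assumes "chom \<phi>" "\<And>s. homog (gdeg s) (\<phi> (gen s))"
  shows "\<phi> (tw f) = tw (\<phi> f)"
  by (rule chom_eqI[OF chom_comp[OF assms(1) chom_tw] chom_comp[OF chom_tw assms(1)]])
    (simp add: tw_homog[OF homog_gen] tw_homog[OF assms(2)] chomD(9)[OF assms(1)])

text \<open>The last clause expresses odd degree without homogeneous elements: \<open>D\<close>
  exchanges the even and the odd part.\<close>

definition oder :: "('g::graded_gen series \<Rightarrow> 'g series) \<Rightarrow> bool" where
  "oder D \<longleftrightarrow> clin D \<and> (\<forall>f g. D (f * g) = D f * g + tw f * D g) \<and> (\<forall>f. D (tw f) = - tw (D f))"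

lemma oderD:
  assumes "oder D"
  shows "clin D" "D (f * g) = D f * g + tw f * D g" "D (tw f) = - tw (D f)" "D 1 = 0"
proof -
  show *: "clin D" "D (f * g) = D f * g + tw f * D g" "D (tw f) = - tw (D f)" for f g
    using assms by (auto simp: oder_def)
  show "D 1 = 0"
    using *(2)[of 1 1] by (simp add: tw_simps)
qed

fun der_word :: "('g::graded_gen \<Rightarrow> 'g series) \<Rightarrow> 'g list \<Rightarrow> 'g series" where
  "der_word h [] = 0"
| "der_word h (s # u) = h s * mon u + scale (psgn (gdeg s)) (gen s * der_word h u)"

definition der :: "('g::graded_gen \<Rightarrow> 'g series) \<Rightarrow> 'g series \<Rightarrow> 'g series" where
  "der h = lext (der_word h)"

lemma fil_der_word: "(\<And>s. h s \<in> fil 1) \<Longrightarrow> der_word h u \<in> fil (length u)"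
proof (induction u)
  case (Cons s u)
  then show ?case
    using fil_mult[OF Cons.prems fil_mon, of s u] fil_mult[OF fil_gen, of "der_word h u" "length u" s]
    by auto
qed simp

lemma der_mon:
  fixes h :: "'g::{graded_gen, finite} \<Rightarrow> 'g series"
  shows "(\<And>s. h s \<in> fil 1) \<Longrightarrow> der h (mon u) = der_word h u"
  unfolding der_def by (intro lext_mon fil_der_word)

lemma der_gen:
  fixes h :: "'g::{graded_gen, finite} \<Rightarrow> 'g series"
  shows "(\<And>s. h s \<in> fil 1) \<Longrightarrow> der h (gen s) = h s"
  using der_mon[of h "[s]"] by (simp add: mon_single mon_Nil)

lemma oder_der:
  fixes h :: "'g::{graded_gen, finite} \<Rightarrow> 'g series"
  assumes h: "\<And>s. h s \<in> fil 1" and odd: "\<And>s. tw (h s) = - scale (psgn (gdeg s)) (h s)"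
  shows "oder (der h)"
proof -
  have L: "clin (der h)"
    by (simp add: der_def clin_lext)
  have app: "der_word h (u @ v) = der_word h u * mon v + scale (psgn (wdeg u)) (mon u * der_word h v)"
    for u v
    by (induction u) (simp_all add: mon_Nil mon_Cons mon_append algebra_simps)
  have monr: "der h (mon u * g) = der h (mon u) * g + tw (mon u) * der h g" for u g
    by (rule clin_eqI[where f = g])
       (simp_all add: clin_comp[OF L] clin_intros clin_mult_left[OF L] der_mon[OF h] app
         tw_homog[OF homog_mon] flip: mon_append)
  have rule: "der h (f * g) = der h f * g + tw f * der h g" for f g
    by (rule clin_eqI[where f = f])
       (simp_all add: clin_comp[OF L] clin_intros clin_mult_right[OF L] clin_mult_right[OF clin_tw] monr)
  have "tw (der_word h u) = - scale (psgn (wdeg u)) (der_word h u)" for u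
    by (induction u) (simp_all add: tw_simps odd tw_homog[OF homog_mon] tw_homog[OF homog_gen]
        algebra_simps)
  then have twm: "der h (tw (mon u)) = - tw (der h (mon u))" for u
    by (simp add: tw_homog[OF homog_mon] clinD[OF L] der_mon[OF h])
  have "der h (tw f) = scale (- 1) (tw (der h f))" for f
    by (rule clin_eqI[where f = f])
       (simp_all add: clin_comp[OF L clin_tw] clin_scale[OF clin_comp[OF clin_tw L]] twm
         del: scale_simps(10), simp add: scale_simps(10))
  with L rule show ?thesis
    by (simp add: oder_def)
qed

lemma oder_chom_commute_on:
  fixes \<phi> :: "'g::{graded_gen, finite} series \<Rightarrow> 'h::{graded_gen, finite} series"
  assumes \<phi>: "chom \<phi>" "\<And>f. \<phi> (tw f) = tw (\<phi> f)" and D: "oder D" "oder D'"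
    and gens: "\<And>s. s \<in> S \<Longrightarrow> D' (\<phi> (gen s)) = \<phi> (D (gen s))" and f: "supported S f"
  shows "D' (\<phi> f) = \<phi> (D f)"
proof (rule clin_eq_on[where f = f])
  show "clin (\<lambda>f. D' (\<phi> f))" "clin (\<lambda>f. \<phi> (D f))"
    using chomD(1)[OF \<phi>(1)] oderD(1)[OF D(1)] oderD(1)[OF D(2)] by (auto intro: clin_comp)
  have "D' (\<phi> (mon u)) = \<phi> (D (mon u))" if "set u \<subseteq> S" for u
    using that
    by (induction u) (simp_all add: mon_Nil mon_Cons chomD[OF \<phi>(1)] oderD(2,4)[OF D(1)]
       oderD(2,4)[OF D(2)] gens \<phi>(2) clinD[OF oderD(1)[OF D(1)]] clinD[OF oderD(1)[OF D(2)]])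
  then show "wcoeff f u \<noteq> 0 \<Longrightarrow> D' (\<phi> (mon u)) = \<phi> (D (mon u))" for u
    using f by (auto simp: supported_def)
qed

lemma oder_chom_commute:
  fixes \<phi> :: "'g::{graded_gen, finite} series \<Rightarrow> 'h::{graded_gen, finite} series"
  assumes "chom \<phi>" "\<And>f. \<phi> (tw f) = tw (\<phi> f)" "oder D" "oder D'"
    and "\<And>s. D' (\<phi> (gen s)) = \<phi> (D (gen s))"
  shows "D' (\<phi> f) = \<phi> (D f)"
  by (rule oder_chom_commute_on[where S = UNIV, OF assms]) (simp add: supported_def)

lemma oder_homog:
  fixes D :: "'g::{graded_gen, finite} series \<Rightarrow> 'g series"
  assumes "oder D" "\<And>s. homog (gdeg s + k) (D (gen s))" "homog n f"
  shows "homog (n + k) (D f)"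
proof (rule homog_clin[OF oderD(1)[OF assms(1)] _ assms(3)])
  show "homog (wdeg u + k) (D (mon u))" for u
  proof (induction u)
    case (Cons s u)
    show ?case
      using homog_mult[OF assms(2)[of s] homog_mon[of u]] homog_mult[OF homog_gen[of s] Cons]
      by (simp add: mon_Cons oderD(2)[OF assms(1)] tw_homog[OF homog_gen] algebra_simps)
  qed (simp add: mon_Nil oderD(4)[OF assms(1)])
qed

text \<open>The cross terms cancel because both derivations anticommute with \<open>tw\<close>. An
  anticommutator of odd derivations is thus an even derivation, which serves for squares of
  differentials and for contracting homotopies.\<close>

lemma oder_anticommutator:
  assumes "oder D" "oder T"
  shows "D (T (f * g)) + T (D (f * g)) = (D (T f) + T (D f)) * g + f * (D (T g) + T (D g))"
  by (simp add: oderD(2,3)[OF assms(1)] oderD(2,3)[OF assms(2)] clinD[OF oderD(1)[OF assms(1)]]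
      clinD[OF oderD(1)[OF assms(2)]] algebra_simps)

section \<open>Power series in an operator\<close>

text \<open>As \<open>f - tw f\<close> is twice the odd part of \<open>f\<close>, the correction is
  twice the product of the odd parts and turns \<open>- g * f\<close> into \<open>+ g * f\<close> on
  them.\<close>

lemma gbracket_eq: "gbracket f g = f * g - g * f + scale (1/2) ((g - tw g) * (f - tw f))"
proof (rule series_eqI)
  fix w :: "'a list"
  have "wcoeff (gbracket f g) w = (\<Sum>i\<le>length w. wcoeff f (take i w) * wcoeff g (drop i w)
        - psgn (wdeg (take i w) * wdeg (drop i w)) * (wcoeff g (take i w) * wcoeff f (drop i w)))"
    by transfer (simp add: powi_psgn)
  also have "\<dots> = wcoeff (f * g - g * f + scale (1/2) ((g - tw g) * (f - tw f))) w"
    unfolding wcoeff_add wcoeff_diff wcoeff_scale wcoeff_mult wcoeff_tw sum_distrib_left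
      sum_subtractf[symmetric] sum.distrib[symmetric]
    by (intro sum.cong) (auto simp: psgn_def algebra_simps)
  finally show "wcoeff (gbracket f g) w
      = wcoeff (f * g - g * f + scale (1/2) ((g - tw g) * (f - tw f))) w" .
qed

definition twn :: "int \<Rightarrow> 'g::graded_gen series \<Rightarrow> 'g series" where
  "twn n f = (if even n then f else tw f)"

lemma gbracket_parity:
  assumes "tw f = scale (psgn n) f"
  shows "gbracket f g = f * g - twn n g * f"
proof (cases "even n")
  case True
  then show ?thesis
    using assms by (simp add: gbracket_eq twn_def psgn_def)
next
  case False
  then have "tw f = - f"
    using assms by (simp add: psgn_def)
  then have "gbracket f g = f * g - g * f + scale (1/2) ((g - tw g) * f + (g - tw g) * f)"
    by (simp add: gbracket_eq algebra_simps)
  then show ?thesis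
    using False unfolding scale_half_double by (simp add: twn_def algebra_simps)
qed

lemmas gbracket_homog = gbracket_parity[OF tw_homog]

lemma clin_gbracket: "clin (gbracket f)" "clin (\<lambda>f. gbracket f g)"
  unfolding gbracket_eq by (intro clin_intros clin_mult_left clin_tw clin_diff; rule clin_tw clin_id)+

lemma fil_gbracket:
  assumes "f \<in> fil m" "g \<in> fil n"
  shows "gbracket f g \<in> fil (m + n)"
proof -
  have "tw f \<in> fil m" "tw g \<in> fil n"
    using assms clinD(3)[OF clin_tw] by blast+
  then have "(g - tw g) * (f - tw f) \<in> fil (n + m)"
    using assms by (intro fil_mult) auto
  moreover have "f * g \<in> fil (m + n)" "g * f \<in> fil (n + m)"
    using assms by (auto intro: fil_mult)
  ultimately show ?thesis
    by (simp add: gbracket_eq add.commute)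
qed

text \<open>Such operators are topologically nilpotent, so that every power series in them
  converges.\<close>

definition raising :: "('g series \<Rightarrow> 'g series) \<Rightarrow> bool" where
  "raising T \<longleftrightarrow> clin T \<and> (\<forall>n f. f \<in> fil n \<longrightarrow> T f \<in> fil (Suc n))"

lemma raising_pow: "raising T \<Longrightarrow> f \<in> fil n \<Longrightarrow> (T ^^ k) f \<in> fil (n + k)"
  by (induction k) (auto simp: raising_def)

lemma raising_clin: "raising T \<Longrightarrow> clin (T ^^ k)"
  using clin_pow by (auto simp: raising_def)

lemma raising_gbracket: "x \<in> fil 1 \<Longrightarrow> raising (gbracket x)"
  using fil_gbracket[of x 1] by (simp add: raising_def clin_gbracket)

lemma raising_mult: "x \<in> fil 1 \<Longrightarrow> raising ((*) x)"
  using fil_mult[of x 1] clin_mult_left[OF clin_id, of x] by (simp add: raising_def)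

definition adc :: "'g series \<Rightarrow> 'g series \<Rightarrow> 'g series" where
  "adc x y = x * y - y * x"

lemma raising_adc: "x \<in> fil 1 \<Longrightarrow> raising (adc x)"
  unfolding raising_def adc_def
  using fil_mult[of x 1] fil_mult[of _ _ x 1]
  by (auto intro!: clin_intros clin_mult_left clin_mult_right)

lemma gbracket_adc: "homog 0 x \<Longrightarrow> gbracket x = adc x"
  by (rule ext) (simp add: gbracket_homog twn_def adc_def)

text \<open>The common form of \<open>fps_app\<close> (left multiplication, applied to
  \<open>1\<close>) and \<open>fps_ad\<close> (bracketing), so that one functional calculus covers
  both.\<close>

definition op_app :: "rat fps \<Rightarrow> ('g series \<Rightarrow> 'g series) \<Rightarrow> 'g series \<Rightarrow> 'g series" where
  "op_app a T y = Series (\<lambda>w. \<Sum>k\<le>length w. fps_nth a k * wcoeff ((T ^^ k) y) w)"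

lemma op_app_coeff:
  assumes "raising T" "length w \<le> n"
  shows "wcoeff (op_app a T y) w = (\<Sum>k\<le>n. fps_nth a k * wcoeff ((T ^^ k) y) w)"
proof -
  have "wcoeff ((T ^^ k) y) w = 0" if "k > length w" for k
    using raising_pow[OF assms(1), of y 0 k] that by (auto intro: fil_coeff)
  then show ?thesis
    unfolding op_app_def wcoeff_Series using assms(2) by (intro sum.mono_neutral_left) auto
qed

lemma op_app_approx:
  assumes "raising T"
  shows "op_app a T y - (\<Sum>k\<le>n. scale (fps_nth a k) ((T ^^ k) y)) \<in> fil (Suc n)"
  by (simp add: fil_def op_app_coeff[OF assms] less_Suc_eq_le)

lemma clin_op_app:
  fixes T :: "'g series \<Rightarrow> 'g series"
  assumes T: "raising T"
  shows "clin (op_app a T)"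
proof (rule clinI)
  fix n and f :: "'g series"
  assume f: "f \<in> fil n"
  then have "(T ^^ k) f \<in> fil n" for k
    using raising_pow[OF T f, of k] fil_mono by fastforce
  then show "op_app a T f \<in> fil n"
    unfolding fil_def op_app_def by (auto intro!: sum.neutral simp: fil_coeff)
qed (rule series_eqI, simp add: op_app_def clinD[OF raising_clin[OF T]] algebra_simps sum.distrib
      sum_distrib_left)+

lemma op_app_coeff_clin:
  assumes "raising T" "clin L" "length w \<le> n"
  shows "wcoeff (L (op_app a T y)) w = (\<Sum>k\<le>n. fps_nth a k * wcoeff (L ((T ^^ k) y)) w)"
proof -
  have "L (op_app a T y) - L (\<Sum>k\<le>n. scale (fps_nth a k) ((T ^^ k) y)) \<in> fil (Suc n)"
    using clinD(3)[OF assms(2) op_app_approx[OF assms(1), of a y n]] by (simp only: clinD(6)[OF assms(2)])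
  then have "wcoeff (L (op_app a T y)) w = wcoeff (L (\<Sum>k\<le>n. scale (fps_nth a k) ((T ^^ k) y))) w"
    using assms(3) fil_coeff[of _ "Suc n" w] by fastforce
  then show ?thesis
    by (simp add: clinD(7)[OF assms(2)] clinD(2)[OF assms(2)])
qed

lemma op_app_commute:
  assumes "raising T" "raising T'" "clin L" "\<And>y. L (T y) = T' (L y)"
  shows "L (op_app a T y) = op_app a T' (L y)"
proof (rule series_eqI)
  fix w
  have "L ((T ^^ k) y) = (T' ^^ k) (L y)" for k
    by (induction k) (simp_all add: assms(4))
  then show "wcoeff (L (op_app a T y)) w = wcoeff (op_app a T' (L y)) w"
    by (simp only: op_app_coeff_clin[OF assms(1,3) order.refl] op_app_coeff[OF assms(2) order.refl])
qed

lemma sum_square_triangle: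
  fixes g :: "nat \<Rightarrow> nat \<Rightarrow> rat"
  assumes "\<And>k l. k + l > n \<Longrightarrow> g k l = 0"
  shows "(\<Sum>k\<le>n. \<Sum>l\<le>n. g k l) = (\<Sum>m\<le>n. \<Sum>k\<le>m. g k (m - k))"
proof -
  have "(\<Sum>k\<le>n. \<Sum>l\<le>n. g k l) = (\<Sum>(k, l)\<in>{..n} \<times> {..n}. g k l)"
    by (simp add: sum.cartesian_product)
  also have "\<dots> = (\<Sum>(k, l)\<in>{(k, l). k + l \<le> n}. g k l)"
    using assms by (intro sum.mono_neutral_right) (auto, meson not_le)
  also have "\<dots> = (\<Sum>m\<le>n. \<Sum>k\<le>m. g k (m - k))"
    by (rule sum.triangle_reindex_eq)
  finally show ?thesis .
qed

text \<open>Powers of one operator add, so the double sum regroups into Cauchy products; terms with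
  \<open>k + l\<close> beyond the length of \<open>w\<close> vanish because \<open>T\<close> raises
  length.\<close>

lemma op_app_mult:
  fixes T :: "'g series \<Rightarrow> 'g series"
  assumes T: "raising T"
  shows "op_app (a * b) T y = op_app a T (op_app b T y)"
proof (rule series_eqI)
  fix w :: "'g list"
  let ?n = "length w"
  have "wcoeff (op_app a T (op_app b T y)) w
      = (\<Sum>k\<le>?n. fps_nth a k * (\<Sum>l\<le>?n. fps_nth b l * wcoeff ((T ^^ (k + l)) y) w))"
    unfolding op_app_coeff[OF T order.refl] op_app_coeff_clin[OF T raising_clin[OF T] order.refl]
    by (simp add: funpow_add)
  also have "\<dots> = (\<Sum>k\<le>?n. \<Sum>l\<le>?n. fps_nth a k * fps_nth b l * wcoeff ((T ^^ (k + l)) y) w)"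
    by (simp add: sum_distrib_left mult.assoc)
  also have "\<dots> = (\<Sum>m\<le>?n. \<Sum>k\<le>m. fps_nth a k * fps_nth b (m - k) * wcoeff ((T ^^ (k + (m - k))) y) w)"
    by (rule sum_square_triangle) (use raising_pow[OF T, of y 0] in \<open>auto intro: fil_coeff\<close>)
  also have "\<dots> = wcoeff (op_app (a * b) T y) w"
    unfolding op_app_coeff[OF T order.refl]
    by (simp add: fps_mult_nth sum_distrib_right atLeast0AtMost)
  finally show "wcoeff (op_app (a * b) T y) w = wcoeff (op_app a T (op_app b T y)) w" ..
qed

lemma op_app_simps:
  assumes "raising T"
  shows "op_app (a + b) T y = op_app a T y + op_app b T y"
    "op_app (a - b) T y = op_app a T y - op_app b T y"
    "op_app (- a) T y = - op_app a T y"
    "op_app 1 T y = y" "op_app 0 T y = 0"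
  by (rule series_eqI, simp add: op_app_def algebra_simps sum.distrib sum_subtractf sum_negf
      fps_one_nth if_distrib[of "\<lambda>x. _ * x"] cong: if_cong)+

lemma op_app_X:
  assumes T: "raising T"
  shows "op_app fps_X T y = T y"
proof (rule series_eqI)
  fix w
  have "wcoeff (op_app fps_X T y) w = (\<Sum>k\<le>Suc (length w). if k = 1 then wcoeff ((T ^^ k) y) w else 0)"
    unfolding op_app_coeff[OF T le_SucI[OF order.refl]]
    by (intro sum.cong) auto
  then show "wcoeff (op_app fps_X T y) w = wcoeff (T y) w"
    by (cases w) (auto simp: Suc_le_eq)
qed

lemma fps_ad_eq: "fps_ad a x y = op_app a (gbracket x) y"
  by (simp add: fps_ad_def op_app_def)

lemma funpow_times_one: "((*) f ^^ k) 1 = (f :: 'a::monoid_mult) ^ k"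
  by (induction k) simp_all

section \<open>Substitution of a series into a rational power series\<close>

lemma fps_app_eq: "fps_app a f = op_app a ((*) f) 1"
  by (simp add: fps_app_def op_app_def funpow_times_one)

lemma op_app_times: "f \<in> fil 1 \<Longrightarrow> op_app a ((*) f) y = fps_app a f * y"
  unfolding fps_app_eq
  using op_app_commute[of "(*) f" "(*) f" "\<lambda>z. z * y" a 1]
  by (simp add: raising_mult clin_mult_right clin_id mult.assoc)

lemma fps_app_mult: "f \<in> fil 1 \<Longrightarrow> fps_app (a * b) f = fps_app a f * fps_app b f"
proof -
  assume f: "f \<in> fil 1"
  have "fps_app (a * b) f = op_app a ((*) f) (fps_app b f)"
    unfolding fps_app_eq by (rule op_app_mult[OF raising_mult[OF f]])
  then show ?thesis
    by (simp only: op_app_times[OF f])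
qed

lemma fps_app_simps:
  assumes "f \<in> fil 1"
  shows "fps_app (a + b) f = fps_app a f + fps_app b f" "fps_app (a - b) f = fps_app a f - fps_app b f"
    "fps_app 1 f = 1" "fps_app fps_X f = f"
  using assms by (simp_all add: fps_app_eq op_app_simps op_app_X raising_mult)

lemma chom_fps_app:
  assumes "chom \<phi>" "f \<in> fil 1"
  shows "\<phi> (fps_app a f) = fps_app a (\<phi> f)"
proof (rule series_eqI)
  fix w
  have "wcoeff (\<phi> (fps_app a f)) w = (\<Sum>k\<le>length w. fps_nth a k * wcoeff (\<phi> (f ^ k)) w)"
    unfolding fps_app_eq funpow_times_one
      op_app_coeff_clin[OF raising_mult[OF assms(2)] chomD(1)[OF assms(1)] order.refl] ..
  then show "wcoeff (\<phi> (fps_app a f)) w = wcoeff (fps_app a (\<phi> f)) w"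
    by (simp add: fps_app_def chomD(4)[OF assms(1)])
qed

lemma fps_app_coeff:
  assumes "f \<in> fil 1" "length w \<le> n"
  shows "wcoeff (fps_app a f) w = (\<Sum>k\<le>n. fps_nth a k * wcoeff (f ^ k) w)"
  using op_app_coeff[OF raising_mult[OF assms(1)] assms(2)]
  by (simp add: fps_app_eq funpow_times_one)

lemma fps_app_power: "f \<in> fil 1 \<Longrightarrow> fps_app (a ^ k) f = fps_app a f ^ k"
  by (induction k) (simp_all add: fps_app_simps fps_app_mult)

lemma fps_app_fil_1: "fps_nth a 0 = 0 \<Longrightarrow> fps_app a f \<in> fil 1"
  unfolding fil_1_iff by (simp add: fps_app_def)

lemma fps_app_compose:
  fixes f :: "'g series"
  assumes f: "f \<in> fil 1" and b: "fps_nth b 0 = 0"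
  shows "fps_app (a oo b) f = fps_app a (fps_app b f)"
proof (rule series_eqI)
  fix w :: "'g list"
  let ?n = "length w"
  have "wcoeff (fps_app a (fps_app b f)) w
      = (\<Sum>k\<le>?n. fps_nth a k * (\<Sum>m\<le>?n. fps_nth (b ^ k) m * wcoeff (f ^ m) w))"
    by (simp add: fps_app_coeff[OF fps_app_fil_1[OF b] order.refl] fps_app_power[OF f, symmetric]
        fps_app_coeff[OF f order.refl])
  also have "\<dots> = (\<Sum>k\<le>?n. \<Sum>m\<le>?n. fps_nth a k * fps_nth (b ^ k) m * wcoeff (f ^ m) w)"
    by (simp add: sum_distrib_left mult.assoc)
  also have "\<dots> = (\<Sum>m\<le>?n. \<Sum>k\<le>?n. fps_nth a k * fps_nth (b ^ k) m * wcoeff (f ^ m) w)"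
    by (rule sum.swap)
  also have "\<dots> = (\<Sum>m\<le>?n. \<Sum>k\<le>m. fps_nth a k * fps_nth (b ^ k) m * wcoeff (f ^ m) w)"
    using startsby_zero_power_prefix[OF b]
    by (intro sum.cong refl sum.mono_neutral_right) auto
  also have "\<dots> = wcoeff (fps_app (a oo b) f) w"
    by (simp add: fps_app_coeff[OF f order.refl] fps_compose_nth atLeast0AtMost sum_distrib_right)
  finally show "wcoeff (fps_app (a oo b) f) w = wcoeff (fps_app a (fps_app b f)) w" ..
qed

section \<open>Exponentials\<close>

lemma sexp_minus_one_fil: "sexp f - 1 \<in> fil 1"
  unfolding fil_1_iff by (simp add: sexp_def fps_app_def wcoeff_one)

lemma sexp_uminus_eq: "sexp (- f) = fps_app (fps_exp (- 1)) f"
proof -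
  have "(- f) ^ k = scale ((- 1) ^ k) (f ^ k)" for k
    by (induction k) auto
  then show ?thesis
    unfolding sexp_def fps_app_def by (simp add: field_simps)
qed

lemma sexp_inverse:
  assumes "f \<in> fil 1"
  shows "sexp f * sexp (- f) = 1" "sexp (- f) * sexp f = 1"
  unfolding sexp_uminus_eq unfolding sexp_def fps_app_mult[OF assms, symmetric] fps_exp_add_mult[symmetric]
  by (simp_all add: fps_app_simps[OF assms])

text \<open>Transferred from univariate series, where \<open>fps_ln 1\<close> is the compositional
  inverse of \<open>fps_exp 1 - 1\<close>.\<close>

lemma sexp_slog:
  assumes "g - 1 \<in> fil 1"
  shows "sexp (slog g) = g"
proof -
  let ?e = "fps_exp (1 :: rat) - 1"
  have ln: "fps_ln (1 :: rat) = fps_inv ?e" "fps_nth (fps_ln (1 :: rat)) 0 = 0"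
    by (simp_all add: fps_ln_fps_exp_inv fps_inv_def fps_ln_0)
  have "fps_exp 1 oo fps_ln (1 :: rat) = (?e oo fps_inv ?e) + 1"
    by (simp add: fps_compose_sub_distrib algebra_simps flip: ln(1))
  also have "\<dots> = fps_X + 1"
    by (subst fps_inv_right) auto
  finally have "sexp (slog g) = fps_app (fps_X + 1) (g - 1)"
    unfolding sexp_def slog_def using assms ln(2) by (simp flip: fps_app_compose)
  then show ?thesis
    using assms by (simp add: fps_app_simps)
qed

lemma slog_sexp:
  assumes "f \<in> fil 1"
  shows "slog (sexp f) = f"
proof -
  let ?e = "fps_exp (1 :: rat) - 1"
  have "fps_ln (1 :: rat) oo ?e = fps_X"
    by (subst fps_ln_fps_exp_inv) (auto intro!: fps_inv)
  moreover have "sexp f - 1 = fps_app ?e f"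
    using assms by (simp add: fps_app_simps sexp_def)
  ultimately show ?thesis
    unfolding slog_def using fps_app_compose[of f ?e "fps_ln 1"] assms by (simp add: fps_app_simps)
qed

lemma slog_fil_1: "slog g \<in> fil 1"
  unfolding slog_def by (rule fps_app_fil_1) (simp add: fps_ln_0)

lemma chom_sexp: "chom \<phi> \<Longrightarrow> f \<in> fil 1 \<Longrightarrow> \<phi> (sexp f) = sexp (\<phi> f)"
  unfolding sexp_def by (rule chom_fps_app)

lemma chom_slog: "chom \<phi> \<Longrightarrow> g - 1 \<in> fil 1 \<Longrightarrow> \<phi> (slog g) = slog (\<phi> g)"
  unfolding slog_def by (simp add: chom_fps_app chomD)

lemma mult_minus_one_fil: "g - 1 \<in> fil 1 \<Longrightarrow> h - 1 \<in> fil 1 \<Longrightarrow> g * h - 1 \<in> fil 1"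
proof -
  assume "g - 1 \<in> fil 1" "h - 1 \<in> fil 1"
  moreover have "g * h - 1 = (g - 1) * h + (h - 1)"
    by (simp add: algebra_simps)
  ultimately show ?thesis
    using fil_mult_left by (metis fil_closed(2))
qed

lemma sexp_bch: "sexp (x \<star> y) = sexp x * sexp y"
  unfolding bch_def by (intro sexp_slog mult_minus_one_fil sexp_minus_one_fil)

lemma bch_fil_1: "x \<star> y \<in> fil 1"
  unfolding bch_def by (rule slog_fil_1)

lemma bch_eqI: "f \<in> fil 1 \<Longrightarrow> sexp x * sexp y = sexp f \<Longrightarrow> x \<star> y = f"
  unfolding bch_def by (simp add: slog_sexp)

text \<open>Conjugation is a continuous algebra homomorphism and hence commutes with power
  series.\<close>

lemma sexp_conj:
  assumes "G * H = 1" "H * G = 1" "f \<in> fil 1"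
  shows "sexp (G * f * H) = G * sexp f * H"
proof -
  have "chom (\<lambda>f. G * f * H)"
    unfolding chom_def
  proof (intro conjI allI)
    show "clin (\<lambda>f. G * f * H)"
      by (intro clin_mult_right clin_mult_left clin_id)
    fix f g
    have "G * f * H * (G * g * H) = G * f * (H * G) * g * H"
      by (simp add: mult.assoc)
    then show "G * (f * g) * H = G * f * H * (G * g * H)"
      using assms(2) by (simp add: mult.assoc)
  qed (use assms in simp)
  from chom_sexp[OF this assms(3)] show ?thesis
    by simp
qed

lemma homog_0_sexp: "homog 0 f \<Longrightarrow> homog 0 (sexp f)"
  unfolding homog_def
proof safe
  fix w
  assume f: "\<forall>w. wcoeff f w \<noteq> 0 \<longrightarrow> wdeg w = 0" and "wcoeff (sexp f) w \<noteq> 0"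
  then obtain k where "wcoeff (f ^ k) w \<noteq> 0"
    unfolding sexp_def fps_app_def wcoeff_Series by (metis (no_types, lifting) mult_zero_right sum.neutral)
  then show "wdeg w = 0"
    using homog_0_power[of f k] f by (auto simp: homog_def)
qed

section \<open>Adjoint expansions of powers and exponentials\<close>

lemma sum_pascal:
  "(\<Sum>k\<le>n. scale (of_nat (n choose k)) (M (Suc k) (n - k)))
     + (\<Sum>k\<le>n. scale (of_nat (n choose k)) (M k (Suc n - k)))
   = (\<Sum>k\<le>Suc n. scale (of_nat (Suc n choose k)) (M k (Suc n - k)))"
proof -
  have "(\<Sum>k\<le>Suc n. scale (of_nat (Suc n choose k)) (M k (Suc n - k)))
      = M 0 (Suc n) + (\<Sum>k\<le>n. scale (of_nat (n choose k)) (M (Suc k) (n - k)))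
        + (\<Sum>k\<le>n. scale (of_nat (n choose Suc k)) (M (Suc k) (n - k)))"
    by (simp add: sum.atMost_Suc_shift scale_add_left sum.distrib del: sum.atMost_Suc)
  moreover have "(\<Sum>k\<le>n. scale (of_nat (n choose k)) (M k (Suc n - k)))
      = (\<Sum>k\<le>Suc n. scale (of_nat (n choose k)) (M k (Suc n - k)))"
    by (simp add: binomial_eq_0)
  moreover have "\<dots> = M 0 (Suc n) + (\<Sum>k\<le>n. scale (of_nat (n choose Suc k)) (M (Suc k) (n - k)))"
    by (simp add: sum.atMost_Suc_shift del: sum.atMost_Suc)
  ultimately show ?thesis
    by (simp add: add_ac)
qed

text \<open>Left multiplication by \<open>x\<close> is the sum of \<open>adc x\<close> and right
  multiplication by \<open>x\<close>. These commute, and this is the binomial theorem for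
  them.\<close>

lemma power_mult_adc:
  "x ^ n * y = (\<Sum>k\<le>n. scale (of_nat (n choose k)) ((adc x ^^ k) y * x ^ (n - k)))"
proof (induction n)
  case (Suc n)
  have comm: "x * ((adc x ^^ k) y * x ^ (n - k))
      = (adc x ^^ Suc k) y * x ^ (n - k) + (adc x ^^ k) y * x ^ (Suc n - k)" if "k \<le> n" for k
    using that by (simp add: adc_def Suc_diff_le algebra_simps)
  have "x ^ Suc n * y = x * (\<Sum>k\<le>n. scale (of_nat (n choose k)) ((adc x ^^ k) y * x ^ (n - k)))"
    by (simp add: Suc[symmetric] mult.assoc)
  also have "\<dots> = (\<Sum>k\<le>n. scale (of_nat (n choose k)) (x * ((adc x ^^ k) y * x ^ (n - k))))"
    by (simp add: sum_distrib_left)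
  also have "\<dots> = (\<Sum>k\<le>n. scale (of_nat (n choose k)) ((adc x ^^ Suc k) y * x ^ (n - k)))
     + (\<Sum>k\<le>n. scale (of_nat (n choose k)) ((adc x ^^ k) y * x ^ (Suc n - k)))"
    unfolding sum.distrib[symmetric] by (intro sum.cong refl) (simp only: comm atMost_iff scale_simps(1))
  also have "\<dots> = (\<Sum>k\<le>Suc n. scale (of_nat (Suc n choose k)) ((adc x ^^ k) y * x ^ (Suc n - k)))"
    by (rule sum_pascal[where M = "\<lambda>k l. (adc x ^^ k) y * x ^ l"])
  finally show ?case .
qed simp

text \<open>Moving \<open>D x\<close> to the left past powers of \<open>x\<close> produces iterated
  \<open>adc x\<close>; the binomials \<open>i choose k\<close> for \<open>i \<le> n\<close> add up
  to \<open>Suc n choose Suc k\<close>.\<close>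

lemma derivation_power_adc:
  assumes "\<And>f. D (x * f) = D x * f + x * D f" "D 1 = 0"
  shows "D (x ^ Suc n) = (\<Sum>k\<le>n. scale (of_nat (Suc n choose Suc k)) ((adc x ^^ k) (D x) * x ^ (n - k)))"
proof (induction n)
  case 0
  show ?case
    using assms(1)[of 1] assms(2) by simp
next
  case (Suc n)
  let ?M = "\<lambda>k l. (adc x ^^ k) (D x) * x ^ l"
  have comm: "x * ?M k (n - k) = ?M (Suc k) (n - k) + ?M k (Suc n - k)" if "k \<le> n" for k
    using that by (simp add: adc_def Suc_diff_le algebra_simps)
  have "D (x ^ Suc (Suc n)) = ?M 0 (Suc n) + x * (\<Sum>k\<le>n. scale (of_nat (Suc n choose Suc k)) (?M k (n - k)))"
    using assms(1)[of "x ^ Suc n"] by (simp only: power_Suc[of x "Suc n"] Suc funpow_0)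
  also have "x * (\<Sum>k\<le>n. scale (of_nat (Suc n choose Suc k)) (?M k (n - k)))
     = (\<Sum>k\<le>n. scale (of_nat (Suc n choose Suc k)) (x * ?M k (n - k)))"
    by (simp add: sum_distrib_left)
  also have "\<dots> = (\<Sum>k\<le>n. scale (of_nat (Suc n choose Suc k)) (?M (Suc k) (n - k)))
     + (\<Sum>k\<le>n. scale (of_nat (Suc n choose Suc k)) (?M k (Suc n - k)))"
    unfolding sum.distrib[symmetric] by (intro sum.cong refl) (simp only: comm atMost_iff scale_simps(1))
  also have "(\<Sum>k\<le>n. scale (of_nat (Suc n choose Suc k)) (?M k (Suc n - k)))
     = (\<Sum>k\<le>Suc n. scale (of_nat (Suc n choose Suc k)) (?M k (Suc n - k)))"
    by (simp add: binomial_eq_0)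
  also have "?M 0 (Suc n) + ((\<Sum>k\<le>n. scale (of_nat (Suc n choose Suc k)) (?M (Suc k) (n - k)))
       + (\<Sum>k\<le>Suc n. scale (of_nat (Suc n choose Suc k)) (?M k (Suc n - k))))
     = (\<Sum>k\<le>Suc n. scale (of_nat (Suc n choose k)) (?M k (Suc n - k)))
       + (\<Sum>k\<le>Suc n. scale (of_nat (Suc n choose Suc k)) (?M k (Suc n - k)))"
    unfolding sum.atMost_Suc_shift[of "\<lambda>k. scale (of_nat (Suc n choose k)) (?M k (Suc n - k))"]
    by (simp add: add.assoc)
  also have "\<dots> = (\<Sum>k\<le>Suc n. scale (of_nat (Suc (Suc n) choose Suc k)) (?M k (Suc n - k)))"
    unfolding sum.distrib[symmetric] by (intro sum.cong refl) (simp add: scale_add_left)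
  finally show ?case .
qed

lemma op_app_mult_fps_app_coeff:
  assumes T: "raising T" and x: "x \<in> fil 1"
  shows "wcoeff (op_app a T y * fps_app b x) w
      = (\<Sum>n\<le>length w. \<Sum>k\<le>n. fps_nth a k * fps_nth b (n - k) * wcoeff ((T ^^ k) y * x ^ (n - k)) w)"
proof -
  let ?n = "length w"
  have "wcoeff (op_app a T y * fps_app b x) w
     = (\<Sum>k\<le>?n. fps_nth a k * wcoeff ((T ^^ k) y * fps_app b x) w)"
    by (rule op_app_coeff_clin[OF T clin_mult_right[OF clin_id] order.refl])
  also have "\<dots> = (\<Sum>k\<le>?n. fps_nth a k * (\<Sum>l\<le>?n. fps_nth b l * wcoeff ((T ^^ k) y * x ^ l) w))"
    unfolding fps_app_eq op_app_coeff_clin[OF raising_mult[OF x] clin_mult_left[OF clin_id] order.refl]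
      funpow_times_one ..
  also have "\<dots> = (\<Sum>k\<le>?n. \<Sum>l\<le>?n. fps_nth a k * fps_nth b l * wcoeff ((T ^^ k) y * x ^ l) w)"
    by (simp add: sum_distrib_left mult.assoc)
  also have "\<dots> = (\<Sum>n\<le>?n. \<Sum>k\<le>n. fps_nth a k * fps_nth b (n - k) * wcoeff ((T ^^ k) y * x ^ (n - k)) w)"
  proof (rule sum_square_triangle)
    fix k l
    assume "k + l > ?n"
    moreover have "(T ^^ k) y * x ^ l \<in> fil (k + l)"
      using raising_pow[OF T, of y 0 k] by (intro fil_mult fil_power x) simp
    ultimately show "fps_nth a k * fps_nth b l * wcoeff ((T ^^ k) y * x ^ l) w = 0"
      by (simp add: fil_coeff)
  qed
  finally show ?thesis .
qed

text \<open>\<open>exp (ad x)\<close> is conjugation by \<open>exp x\<close>, stated with the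
  inverse moved to the other side.\<close>

lemma op_app_exp_adc:
  fixes x :: "'g series"
  assumes x: "x \<in> fil 1"
  shows "op_app (fps_exp 1) (adc x) y * sexp x = sexp x * y"
proof (rule series_eqI)
  fix w :: "'g list"
  have "wcoeff (sexp x * y) w = (\<Sum>n\<le>length w. 1 / fact n * wcoeff (x ^ n * y) w)"
    unfolding sexp_def fps_app_eq funpow_times_one
      op_app_coeff_clin[OF raising_mult[OF x] clin_mult_right[OF clin_id] order.refl] by simp
  also have "\<dots> = (\<Sum>n\<le>length w. \<Sum>k\<le>n. 1 / fact k * (1 / fact (n - k)) * wcoeff ((adc x ^^ k) y * x ^ (n - k)) w)"
    unfolding power_mult_adc wcoeff_sum wcoeff_scale sum_distrib_left
    by (intro sum.cong refl) (simp add: binomial_fact field_simps)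
  finally show "wcoeff (op_app (fps_exp 1) (adc x) y * sexp x) w = wcoeff (sexp x * y) w"
    unfolding sexp_def op_app_mult_fps_app_coeff[OF raising_adc[OF x] x] by simp
qed

text \<open>The series \<open>(exp X - 1) / X\<close>. Its constant term is one, so it is
  invertible; the inverse is the generating series of the Bernoulli numbers.\<close>

definition fps_expm1_div :: "rat fps" where
  "fps_expm1_div = Abs_fps (\<lambda>k. 1 / fact (Suc k))"

lemma fps_expm1_div_X: "fps_expm1_div * fps_X = fps_exp 1 - 1"
  by (rule fps_ext) (auto simp: fps_expm1_div_def gr0_conv_Suc)

text \<open>The classical derivative of the exponential. The Leibniz rule is asked only for the left
  factor \<open>x\<close>, so that for even \<open>x\<close> odd derivations are covered along with
  \<open>Nop\<close>.\<close>

lemma derivation_sexp: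
  fixes x :: "'g series"
  assumes x: "x \<in> fil 1" and D: "clin D" "\<And>f. D (x * f) = D x * f + x * D f" "D 1 = 0"
  shows "D (sexp x) = op_app fps_expm1_div (adc x) (D x) * sexp x"
proof (rule series_eqI)
  fix w :: "'g list"
  let ?n = "length w"
  \<comment> \<open>The extra term vanishes at \<open>w\<close>, since \<open>x ^ Suc ?n\<close> has
    only longer words; it makes room for the index shift.\<close>
  have "wcoeff (D (sexp x)) w = (\<Sum>n\<le>Suc ?n. 1 / fact n * wcoeff (D (x ^ n)) w)"
    unfolding sexp_def fps_app_eq
    by (subst op_app_coeff_clin[OF raising_mult[OF x] D(1), of w "Suc ?n"])
       (simp_all add: funpow_times_one)
  also have "\<dots> = (\<Sum>n\<le>?n. 1 / fact (Suc n) * wcoeff (D (x ^ Suc n)) w)"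
    by (subst sum.atMost_Suc_shift) (simp add: D(3))
  also have "\<dots> = (\<Sum>n\<le>?n. \<Sum>k\<le>n. 1 / fact (Suc k) * (1 / fact (n - k))
        * wcoeff ((adc x ^^ k) (D x) * x ^ (n - k)) w)"
    unfolding derivation_power_adc[of D, OF D(2,3)] wcoeff_sum wcoeff_scale sum_distrib_left
    by (intro sum.cong refl) (simp add: binomial_fact field_simps del: fact_Suc binomial_Suc_Suc)
  finally show "wcoeff (D (sexp x)) w = wcoeff (op_app fps_expm1_div (adc x) (D x) * sexp x) w"
    unfolding sexp_def op_app_mult_fps_app_coeff[OF raising_adc[OF x] x]
    by (simp add: fps_expm1_div_def)
qed

section \<open>Lie elements and the Dynkin-Specht-Wever theorem\<close>

lemma gbracket_swap:
  assumes "homog n f" "homog m g"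
  shows "gbracket g f = scale (- psgn (n * m)) (gbracket f g)"
proof -
  have "twn n g = scale (psgn (n * m)) g" "twn m f = scale (psgn (n * m)) f"
    using tw_homog[OF assms(1)] tw_homog[OF assms(2)] by (auto simp: twn_def psgn_def)
  then show ?thesis
    by (simp add: gbracket_homog[OF assms(1)] gbracket_homog[OF assms(2)])
qed

lemma gbracket_homog_both:
  assumes "homog n f" "homog m g"
  shows "gbracket f g = f * g - scale (psgn (n * m)) (g * f)"
proof -
  have "twn n g = scale (psgn (n * m)) g"
    using tw_homog[OF assms(2)] by (auto simp: twn_def psgn_def)
  then show ?thesis
    by (simp add: gbracket_homog[OF assms(1)])
qed

lemma homog_gbracket:
  assumes "homog n f" "homog m g"
  shows "homog (n + m) (gbracket f g)"
  unfolding gbracket_homog_both[OF assms]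
  using homog_mult[OF assms] homog_mult[OF assms(2,1)] by (auto simp: add.commute)

lemma gbracket_jacobi:
  assumes "homog n a" "homog m b"
  shows "gbracket (gbracket a b) y
    = gbracket a (gbracket b y) - scale (psgn (n * m)) (gbracket b (gbracket a y))"
proof -
  have tw: "twn k (f * g) = twn k f * twn k g" "twn k (f - g) = twn k f - twn k g"
    "twn k (twn l f) = twn (k + l) f" for k l and f g :: "'a series"
    by (auto simp: twn_def tw_simps)
  have "twn n b = scale (psgn (n * m)) b" "twn m a = scale (psgn (n * m)) a"
    using tw_homog[OF assms(1)] tw_homog[OF assms(2)] by (auto simp: twn_def psgn_def)
  then show ?thesis
    by (simp add: gbracket_homog[OF homog_gbracket[OF assms]])
       (simp add: gbracket_homog[OF assms(1)] gbracket_homog[OF assms(2)] tw algebra_simps)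
qed

lemma gbracket_wcoeff_nonzero:
  assumes "wcoeff (gbracket f g) w \<noteq> 0"
  obtains i where "wcoeff f (take i w) \<noteq> 0" "wcoeff g (drop i w) \<noteq> 0"
  | i where "wcoeff g (take i w) \<noteq> 0" "wcoeff f (drop i w) \<noteq> 0"
proof -
  have "wcoeff (gbracket f g) w = (\<Sum>i\<le>length w. wcoeff f (take i w) * wcoeff g (drop i w)
        - psgn (wdeg (take i w) * wdeg (drop i w)) * (wcoeff g (take i w) * wcoeff f (drop i w)))"
    by transfer (simp add: powi_psgn)
  with assms obtain i where "wcoeff f (take i w) * wcoeff g (drop i w)
        - psgn (wdeg (take i w) * wdeg (drop i w)) * (wcoeff g (take i w) * wcoeff f (drop i w)) \<noteq> 0"
    by (metis (no_types, lifting) sum.neutral)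
  then show ?thesis
    using that by (cases "wcoeff f (take i w) = 0 \<or> wcoeff g (drop i w) = 0") auto
qed

section \<open>Right-normed brackets and the Dynkin operator\<close>

fun rn :: "'g::graded_gen list \<Rightarrow> 'g series" where
  "rn [] = 0"
| "rn (s # u) = (if u = [] then gen s else gbracket (gen s) (rn u))"

text \<open>Bracketing only permutes letters. Length, degree, weight and support therefore survive
  the Dynkin operator.\<close>

lemma rn_mset: "wcoeff (rn u) w \<noteq> 0 \<Longrightarrow> mset w = mset u"
proof (induction u arbitrary: w)
  case (Cons s u)
  show ?case
  proof (cases "u = []")
    case True
    then show ?thesis
      using Cons.prems by (auto simp: wcoeff_gen split: if_splits)
  next
    case False
    then have "wcoeff (gbracket (gen s) (rn u)) w \<noteq> 0"
      using Cons.prems by simp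
    then show ?thesis
    proof (cases rule: gbracket_wcoeff_nonzero)
      case (1 i)
      then have "take i w = [s]" "mset (drop i w) = mset u"
        using Cons.IH by (auto simp: wcoeff_gen split: if_splits)
      then have "mset (take i w @ drop i w) = mset (s # u)"
        by (simp only: mset_append) simp
      then show ?thesis
        by simp
    next
      case (2 i)
      then have "drop i w = [s]" "mset (take i w) = mset u"
        using Cons.IH by (auto simp: wcoeff_gen split: if_splits)
      then have "mset (take i w @ drop i w) = mset (s # u)"
        by (simp only: mset_append) simp
      then show ?thesis
        by simp
    qed
  qed
qed simp

lemma rn_length: "wcoeff (rn u) w \<noteq> 0 \<Longrightarrow> length w = length u"
  using rn_mset mset_eq_length by blast

lemma mset_wdeg: "mset w = mset u \<Longrightarrow> wdeg w = wdeg u"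
  unfolding wdeg_def by (metis mset_map sum_mset_sum_list)

lemma fil_rn: "rn u \<in> fil (length u)"
  unfolding fil_def using rn_mset mset_eq_length by fastforce

definition RN :: "'g::graded_gen series \<Rightarrow> 'g series" where
  "RN = lext rn"

lemma RN_clin: "clin (RN :: 'g::{graded_gen, finite} series \<Rightarrow> 'g series)"
  unfolding RN_def by (rule clin_lext)

lemma RN_mon: "RN (mon u) = rn u" for u :: "'g::{graded_gen, finite} list"
  unfolding RN_def by (rule lext_mon) (rule fil_rn)

lemma RN_wcoeff_nonzero:
  fixes c :: "'g::{graded_gen, finite} series"
  assumes "wcoeff (RN c) w \<noteq> 0"
  obtains u where "wcoeff c u \<noteq> 0" "mset w = mset u"
proof -
  from assms obtain u where "wcoeff c u * wcoeff (RN (mon u)) w \<noteq> 0"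
    unfolding clin_wcoeff[OF RN_clin, of c] by (meson sum.neutral)
  then show ?thesis
    using that rn_mset by (auto simp: RN_mon)
qed

definition adw :: "'g::graded_gen list \<Rightarrow> 'g series \<Rightarrow> 'g series" where
  "adw u y = foldr (\<lambda>s. gbracket (gen s)) u y"

lemma adw_simps [simp]: "adw [] y = y" "adw (s # u) y = gbracket (gen s) (adw u y)"
  "adw (u @ v) y = adw u (adw v y)"
  by (simp_all add: adw_def)

lemma clin_adw: "clin (adw u)"
  by (induction u) (use clin_comp[OF clin_gbracket(1)] clin_id in \<open>auto simp: fun_eq_iff[symmetric] adw_def comp_def\<close>)

lemma fil_adw: "adw u y \<in> fil (length u)"
  by (induction u) (use fil_gbracket[OF fil_gen] in \<open>auto simp: numeral_eq_Suc\<close>)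

text \<open>The adjoint action extended to the whole associative algebra (\<open>Ad_mult\<close>);
  on a bracket monomial it is the bracket itself (\<open>lie_mon_Ad\<close>).\<close>

definition Ad :: "'g::graded_gen series \<Rightarrow> 'g series \<Rightarrow> 'g series" where
  "Ad x y = lext (\<lambda>u. adw u y) x"

lemma clin_Ad: "clin (\<lambda>x. Ad x y)" for y :: "'g::{graded_gen, finite} series"
  unfolding Ad_def by (rule clin_lext)

lemma Ad_mon: "Ad (mon u) y = adw u y" for y :: "'g::{graded_gen, finite} series"
  unfolding Ad_def by (rule lext_mon) (rule fil_adw)

lemma Ad_mult: "Ad (a * b) y = Ad a (Ad b y)" for y :: "'g::{graded_gen, finite} series"
proof -
  have *: "Ad (mon u * b) y = adw u (Ad b y)" for u
    by (rule clin_eqI[where f = b])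
      (simp_all add: clin_comp[OF clin_Ad] clin_mult_left[OF clin_id] clin_comp[OF clin_adw clin_Ad]
        Ad_mon flip: mon_append)
  show ?thesis
    by (rule clin_eqI[where f = a])
      (simp_all add: clin_comp[OF clin_Ad] clin_mult_right[OF clin_id] clin_Ad Ad_mon *)
qed

lemma RN_mult:
  fixes y :: "'g::{graded_gen, finite} series"
  assumes "y \<in> fil 1"
  shows "RN (x * y) = Ad x (RN y)"
proof -
  \<comment> \<open>The rule fails for \<open>y = 1\<close>, as \<open>RN\<close> kills the empty
    word. Removing the constant term by a continuous map lets the argument run over all
    monomials.\<close>
  define pr :: "'g series \<Rightarrow> 'g series" where "pr y = y - scale (wcoeff y []) 1" for y
  have pr: "clin pr"
    by (rule clinI; (rule series_eqI)?) (auto simp: pr_def algebra_simps fil_def wcoeff_one)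
  have pr_mon: "pr (mon v) = (if v = [] then 0 else mon v)" for v
    by (auto simp: pr_def mon_Nil wcoeff_mon wcoeff_one)
  have rn_app: "rn (u @ v) = adw u (rn v)" if "v \<noteq> []" for u v :: "'g list"
    using that by (induction u) auto
  have *: "RN (mon u * pr y) = adw u (RN (pr y))" for u
    by (rule clin_eqI[where f = y])
      (auto simp: clin_comp[OF RN_clin] clin_comp[OF clin_adw] clin_mult_left[OF pr] pr pr_mon RN_mon
        rn_app clinD(4)[OF RN_clin] clinD(4)[OF clin_adw] simp flip: mon_append)
  have "RN (x * pr y) = Ad x (RN (pr y))"
    by (rule clin_eqI[where f = x])
      (simp_all add: clin_comp[OF RN_clin] clin_mult_right[OF clin_id] clin_Ad Ad_mon *)
  moreover have "pr y = y"
    using assms unfolding fil_1_iff by (simp add: pr_def)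
  ultimately show ?thesis
    by simp
qed

inductive lie_mon :: "'g::graded_gen set \<Rightarrow> int \<Rightarrow> nat \<Rightarrow> 'g series \<Rightarrow> bool" for S where
  gen: "s \<in> S \<Longrightarrow> lie_mon S (gdeg s) 1 (gen s)"
| bracket: "\<lbrakk>lie_mon S n i x; lie_mon S m j y\<rbrakk> \<Longrightarrow> lie_mon S (n + m) (i + j) (gbracket x y)"

lemma lie_mon_homog: "lie_mon S n i x \<Longrightarrow> homog n x"
  by (induction rule: lie_mon.induct) (auto intro: homog_gen homog_gbracket)

lemma lie_mon_word:
  assumes "lie_mon S n i x" "wcoeff x w \<noteq> 0"
  shows "length w = i" "set w \<subseteq> S" "w \<noteq> []"
proof -
  from assms have "length w = i \<and> set w \<subseteq> S \<and> w \<noteq> []"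
  proof (induction arbitrary: w rule: lie_mon.induct)
    case (bracket n i x m j y)
    have "set w = set (take k w) \<union> set (drop k w)" "length w = length (take k w) + length (drop k w)" for k
      by (metis append_take_drop_id set_append, metis append_take_drop_id length_append)
    with bracket.prems show ?case
      by (cases rule: gbracket_wcoeff_nonzero) (metis bracket.IH(1,2) Un_subset_iff add.commute drop_Nil take_Nil)+
  qed (auto simp: wcoeff_gen split: if_splits)
  then show "length w = i" "set w \<subseteq> S" "w \<noteq> []"
    by auto
qed

lemma lie_mon_Ad: "lie_mon S n i x \<Longrightarrow> Ad x y = gbracket x y"
  for y :: "'g::{graded_gen, finite} series"
proof (induction arbitrary: y rule: lie_mon.induct)
  case (gen s)
  then show ?case
    using Ad_mon[of "[s]" y] by (simp add: mon_single)
next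
  case (bracket n i a m j b)
  note h = lie_mon_homog[OF bracket.hyps(1)] lie_mon_homog[OF bracket.hyps(2)]
  show ?case
    unfolding gbracket_jacobi[OF h] unfolding gbracket_homog_both[OF h]
    by (simp add: clinD[OF clin_Ad] Ad_mult bracket.IH)
qed

text \<open>The Dynkin-Specht-Wever identity: by \<open>RN_mult\<close> and
  \<open>lie_mon_Ad\<close> the operator \<open>RN\<close> obeys the Leibniz rule on brackets, so
  its eigenvalues add up to the bracket length.\<close>

lemma lie_mon_RN: "lie_mon S n i x \<Longrightarrow> RN x = scale (of_nat i) x"
  for x :: "'g::{graded_gen, finite} series"
proof (induction rule: lie_mon.induct)
  case (gen s)
  then show ?case
    using RN_mon[of "[s]"] by (simp add: mon_single)
next
  case (bracket n i x m j y)
  note h = lie_mon_homog[OF bracket.hyps(1)] lie_mon_homog[OF bracket.hyps(2)]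
  have fil: "x \<in> fil 1" "y \<in> fil 1"
    unfolding fil_1_iff using lie_mon_word(3)[OF bracket.hyps(1)] lie_mon_word(3)[OF bracket.hyps(2)]
    by blast+
  have "RN (gbracket x y) = gbracket x (RN y) - scale (psgn (n * m)) (gbracket y (RN x))"
    unfolding gbracket_homog_both[OF h]
    by (simp add: clinD[OF RN_clin] RN_mult[OF fil(1)] RN_mult[OF fil(2)]
        lie_mon_Ad[OF bracket.hyps(1)] lie_mon_Ad[OF bracket.hyps(2)])
  also have "\<dots> = scale (of_nat (i + j)) (gbracket x y)"
    by (simp add: bracket.IH clinD[OF clin_gbracket(1)] gbracket_swap[OF h] scale_add_left)
  finally show ?case .
qed

text \<open>The building blocks are homogeneous, which makes the sign rules applicable; the
  inductive steps of \<open>free_lie\<close> mix degrees.\<close>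

inductive_set lie_span :: "'g::graded_gen set \<Rightarrow> 'g series set" for S where
  zero: "0 \<in> lie_span S"
| add: "\<lbrakk>x \<in> lie_span S; lie_mon S n i y\<rbrakk> \<Longrightarrow> x + scale c y \<in> lie_span S"

lemma lie_span_add: "y \<in> lie_span S \<Longrightarrow> x \<in> lie_span S \<Longrightarrow> x + y \<in> lie_span S"
  by (induction rule: lie_span.induct) (auto intro: lie_span.intros simp flip: add.assoc)

lemma lie_span_scale: "x \<in> lie_span S \<Longrightarrow> scale c x \<in> lie_span S"
  by (induction rule: lie_span.induct) (auto intro: lie_span.intros)

lemma lie_span_mon: "lie_mon S n i y \<Longrightarrow> y \<in> lie_span S"
  using lie_span.add[OF lie_span.zero, of S n i y 1] by simp

lemma lie_span_gbracket: "x \<in> lie_span S \<Longrightarrow> y \<in> lie_span S \<Longrightarrow> gbracket x y \<in> lie_span S"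
proof (induction rule: lie_span.induct)
  case (add x n i a c)
  have "gbracket a y \<in> lie_span S"
    using \<open>y \<in> lie_span S\<close>
  proof (induction rule: lie_span.induct)
    case (add z m j b k)
    then show ?case
      using lie_span_add[OF lie_span_scale[OF lie_span_mon[OF lie_mon.bracket[OF \<open>lie_mon S n i a\<close> add(2)]]]]
      by (simp add: clinD[OF clin_gbracket(1)])
  qed (simp add: clinD[OF clin_gbracket(1)] lie_span.zero)
  then show ?case
    using add by (simp add: clinD[OF clin_gbracket(2)] lie_span_add lie_span_scale)
qed (simp add: clinD[OF clin_gbracket(2)] lie_span.zero)

lemma free_lie_subset_lie_span: "x \<in> free_lie S \<Longrightarrow> x \<in> lie_span S"
proof (induction rule: free_lie.induct)
  case (gen s)
  then show ?case
    using lie_span_mon lie_mon.gen by blast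
qed (auto intro: lie_span.zero lie_span_add lie_span_scale lie_span_gbracket)

lemma lie_mon_free_lie: "lie_mon S n i x \<Longrightarrow> x \<in> free_lie S"
  by (induction rule: lie_mon.induct) (auto intro: free_lie.intros)

section \<open>The completed Lie algebra as the image of the Dynkin operator\<close>

definition degs :: "'g::graded_gen series \<Rightarrow> int set" where
  "degs f = {wdeg w | w. wcoeff f w \<noteq> 0}"

lemma Lhat_iff: "f \<in> Lhat S \<longleftrightarrow> (\<forall>i. lcomp i f \<in> free_lie S) \<and> finite (degs f)"
  by (simp add: Lhat_def degs_def)

lemma clin_lcomp: "clin (lcomp i)"
  by (rule clinI; (rule series_eqI)?) (auto simp: wcoeff_lcomp fil_def)

lemma lcomp_idem: "lcomp i (lcomp i f) = lcomp i f"
  by (rule series_eqI) (simp add: wcoeff_lcomp)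

lemma homog_degs: "homog n f \<Longrightarrow> finite (degs f)"
  by (rule finite_subset[of _ "{n}"]) (auto simp: degs_def homog_def)

lemma free_lie_sum: "(\<And>a. a \<in> A \<Longrightarrow> f a \<in> free_lie S) \<Longrightarrow> sum f A \<in> free_lie S"
  by (induction A rule: infinite_finite_induct) (auto intro: free_lie.intros)

lemma Lhat_zero [simp]: "0 \<in> Lhat S"
  by (auto simp: Lhat_iff clinD[OF clin_lcomp] degs_def intro: free_lie.intros)

lemma Lhat_add: "f \<in> Lhat S \<Longrightarrow> g \<in> Lhat S \<Longrightarrow> f + g \<in> Lhat S"
proof -
  have "degs (f + g) \<subseteq> degs f \<union> degs g"
    by (auto simp: degs_def)
  then show "f \<in> Lhat S \<Longrightarrow> g \<in> Lhat S \<Longrightarrow> f + g \<in> Lhat S"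
    unfolding Lhat_iff by (auto simp: clinD[OF clin_lcomp] intro: free_lie.intros finite_subset)
qed

lemma Lhat_scale: "f \<in> Lhat S \<Longrightarrow> scale c f \<in> Lhat S"
proof -
  have "degs (scale c f) \<subseteq> degs f"
    by (auto simp: degs_def)
  then show "f \<in> Lhat S \<Longrightarrow> scale c f \<in> Lhat S"
    unfolding Lhat_iff by (auto simp: clinD[OF clin_lcomp] intro: free_lie.intros finite_subset)
qed

lemma Lhat_uminus: "f \<in> Lhat S \<Longrightarrow> - f \<in> Lhat S"
  using Lhat_scale[of f S "- 1"] by simp

lemma Lhat_sum: "(\<And>a. a \<in> A \<Longrightarrow> f a \<in> Lhat S) \<Longrightarrow> sum f A \<in> Lhat S"
  by (induction A rule: infinite_finite_induct) (auto intro: Lhat_add)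

text \<open>Each length component already occurs in an approximant. This closedness is the criterion
  by which infinite sums and limits are recognized as Lie.\<close>

lemma Lhat_limit:
  assumes "finite (degs f)" "\<And>n. \<exists>g\<in>Lhat S. f - g \<in> fil n"
  shows "f \<in> Lhat S"
  unfolding Lhat_iff
proof (intro conjI allI)
  fix i
  obtain g where g: "g \<in> Lhat S" "f - g \<in> fil (Suc i)"
    using assms(2) by blast
  have "lcomp i f = lcomp i g"
    using fil_coeff[OF g(2)] by (intro series_eqI) (auto simp: wcoeff_lcomp)
  then show "lcomp i f \<in> free_lie S"
    using g(1) by (simp add: Lhat_iff)
qed (rule assms)

lemma lie_mon_Lhat:
  assumes "lie_mon S n i x"
  shows "x \<in> Lhat S"
  unfolding Lhat_iff
proof (intro conjI allI)
  fix j
  have "lcomp j x = (if j = i then x else 0)"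
    using lie_mon_word(1)[OF assms] by (intro series_eqI) (auto simp: wcoeff_lcomp)
  then show "lcomp j x \<in> free_lie S"
    using lie_mon_free_lie[OF assms] free_lie.zero by auto
qed (rule homog_degs[OF lie_mon_homog[OF assms]])

lemma free_lie_Lhat: "x \<in> free_lie S \<Longrightarrow> x \<in> Lhat S"
proof -
  assume "x \<in> free_lie S"
  then have "x \<in> lie_span S"
    by (rule free_lie_subset_lie_span)
  then show ?thesis
    by induction (auto intro: Lhat_add Lhat_scale lie_mon_Lhat)
qed

lemma gen_Lhat: "s \<in> S \<Longrightarrow> gen s \<in> Lhat S"
  by (intro free_lie_Lhat free_lie.gen)

lemma free_lie_RN: "f \<in> free_lie S \<Longrightarrow> RN (lcomp i f) = scale (of_nat i) (lcomp i f)"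
  for f :: "'g::{graded_gen, finite} series"
proof -
  assume "f \<in> free_lie S"
  then have "f \<in> lie_span S"
    by (rule free_lie_subset_lie_span)
  then show ?thesis
  proof induction
    case (add x n j y c)
    have "lcomp i y = (if j = i then y else 0)"
      using lie_mon_word(1)[OF add(2)] by (intro series_eqI) (auto simp: wcoeff_lcomp)
    then have "RN (lcomp i y) = scale (of_nat i) (lcomp i y)"
      using lie_mon_RN[OF add(2)] by (simp add: clinD[OF RN_clin])
    with add.IH show ?case
      by (simp add: clinD[OF RN_clin] clinD[OF clin_lcomp] mult.commute)
  qed (simp add: clinD[OF RN_clin] clinD[OF clin_lcomp])
qed

lemma free_lie_word:
  assumes "x \<in> free_lie S" "wcoeff x w \<noteq> 0"
  shows "set w \<subseteq> S" "w \<noteq> []"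
proof -
  have "x \<in> lie_span S"
    using assms(1) by (rule free_lie_subset_lie_span)
  then have "set w \<subseteq> S \<and> w \<noteq> []"
    using assms(2)
  proof induction
    case (add x n i y c)
    then show ?case
      using lie_mon_word[OF add(2), of w] by (cases "wcoeff x w = 0") auto
  qed simp
  then show "set w \<subseteq> S" "w \<noteq> []"
    by auto
qed

lemma Lhat_word:
  assumes "f \<in> Lhat S" "wcoeff f w \<noteq> 0"
  shows "set w \<subseteq> S" "w \<noteq> []"
proof -
  have "lcomp (length w) f \<in> free_lie S" "wcoeff (lcomp (length w) f) w \<noteq> 0"
    using assms by (auto simp: Lhat_iff wcoeff_lcomp)
  from free_lie_word[OF this] show "set w \<subseteq> S" "w \<noteq> []" .
qed

lemma Lhat_fil_1: "f \<in> Lhat S \<Longrightarrow> f \<in> fil 1"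
  unfolding fil_1_iff using Lhat_word(2) by blast

text \<open>A right inverse of \<open>RN\<close> on Lie elements, whose eigenvalue in length
  \<open>i\<close> is \<open>i\<close>. At the empty word the division by zero is harmless, as Lie
  elements have no constant term.\<close>

definition divlen :: "'g series \<Rightarrow> 'g series" where
  "divlen f = Series (\<lambda>w. wcoeff f w / of_nat (length w))"

lemma lcomp_RN: "lcomp i (RN c) = RN (lcomp i c)" for c :: "'g::{graded_gen, finite} series"
proof (rule clin_eqI[where f = c])
  fix u :: "'g list"
  have "lcomp i (rn u) = (if length u = i then rn u else 0)"
    by (intro series_eqI) (simp add: wcoeff_lcomp, metis rn_length)
  moreover have "lcomp i (mon u) = (if length u = i then mon u else 0)"
    by (intro series_eqI) (auto simp: wcoeff_lcomp wcoeff_mon)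
  ultimately show "lcomp i (RN (mon u)) = RN (lcomp i (mon u))"
    by (simp add: RN_mon clinD[OF RN_clin])
qed (simp_all add: clin_comp[OF clin_lcomp] clin_comp[OF RN_clin] clin_lcomp RN_clin)

lemma RN_divlen:
  fixes f :: "'g::{graded_gen, finite} series"
  assumes "f \<in> Lhat S"
  shows "RN (divlen f) = f"
proof (rule series_eqI)
  fix w :: "'g list"
  let ?i = "length w"
  have "lcomp ?i (divlen f) = scale (1 / of_nat ?i) (lcomp ?i f)"
    by (rule series_eqI) (auto simp: wcoeff_lcomp divlen_def)
  then have "lcomp ?i (RN (divlen f)) = scale (1 / of_nat ?i) (RN (lcomp ?i (lcomp ?i f)))"
    unfolding lcomp_RN by (simp add: clinD[OF RN_clin] lcomp_idem)
  also have "\<dots> = scale (1 / of_nat ?i * of_nat ?i) (lcomp ?i (lcomp ?i f))"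
    using free_lie_RN[of "lcomp ?i f" S ?i] assms by (simp add: Lhat_iff)
  finally have "wcoeff (RN (divlen f)) w = 1 / of_nat ?i * of_nat ?i * wcoeff f w"
    using wcoeff_lcomp[of ?i "RN (divlen f)" w] by (simp add: wcoeff_lcomp)
  then show "wcoeff (RN (divlen f)) w = wcoeff f w"
    using Lhat_word(2)[OF assms, of w] by (cases "w = []") auto
qed

lemma rn_free_lie: "set u \<subseteq> S \<Longrightarrow> rn u \<in> free_lie S"
  by (induction u) (auto intro: free_lie.intros)

lemma RN_trunc: "RN (trunc n c) = (\<Sum>u | length u < n. scale (wcoeff c u) (rn u))"
  for c :: "'g::{graded_gen, finite} series"
  by (simp add: trunc_def clinD[OF RN_clin] RN_mon)

lemma degs_RN: "degs (RN c) \<subseteq> degs c" for c :: "'g::{graded_gen, finite} series"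
  unfolding degs_def using mset_wdeg by (fastforce elim!: RN_wcoeff_nonzero)

lemma RN_Lhat:
  fixes c :: "'g::{graded_gen, finite} series"
  assumes "supported S c" "finite (degs c)"
  shows "RN c \<in> Lhat S"
proof (rule Lhat_limit)
  show "finite (degs (RN c))"
    using finite_subset[OF degs_RN] assms(2) by blast
  fix n
  have "scale (wcoeff c u) (rn u) \<in> free_lie S" for u
    using assms(1) rn_free_lie[of u S] free_lie.scale[of "rn u" S] free_lie.zero[of S]
    by (cases "wcoeff c u = 0") (auto simp: supported_def)
  then have "RN (trunc n c) \<in> Lhat S"
    unfolding RN_trunc by (intro free_lie_Lhat free_lie_sum)
  moreover have "RN c - RN (trunc n c) \<in> fil n"
    using clinD(3)[OF RN_clin trunc_fil] clinD(6)[OF RN_clin] by metis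
  ultimately show "\<exists>g\<in>Lhat S. RN c - g \<in> fil n"
    by blast
qed

text \<open>Together with \<open>RN_Lhat\<close> this describes \<open>Lhat S\<close> as the image
  of the series in \<open>S\<close> with finitely many degrees, so that membership can be checked on
  words.\<close>

lemma Lhat_obtain_RN:
  fixes f :: "'g::{graded_gen, finite} series"
  assumes "f \<in> Lhat S"
  obtains c where "f = RN c" "supported S c" "degs c \<subseteq> degs f" "\<And>w. wcoeff f w = 0 \<Longrightarrow> wcoeff c w = 0"
proof
  show "f = RN (divlen f)"
    using RN_divlen[OF assms] ..
  show "supported S (divlen f)" "degs (divlen f) \<subseteq> degs f"
    using Lhat_word(1)[OF assms] by (auto simp: supported_def degs_def divlen_def)
qed (simp add: divlen_def)

lemma Lhat_gbracket:
  fixes f g :: "'g::graded_gen series"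
  assumes "f \<in> Lhat S" "g \<in> Lhat S"
  shows "gbracket f g \<in> Lhat S"
proof (rule Lhat_limit)
  have "degs (gbracket f g) \<subseteq> (\<lambda>(a, b). a + b) ` (degs f \<times> degs g)"
  proof
    fix n
    assume "n \<in> degs (gbracket f g)"
    then obtain w where w: "n = wdeg w" "wcoeff (gbracket f g) w \<noteq> 0"
      by (auto simp: degs_def)
    from w(2) have "\<exists>u v. wcoeff f u \<noteq> 0 \<and> wcoeff g v \<noteq> 0 \<and> n = wdeg u + wdeg v"
      unfolding w(1) by (cases rule: gbracket_wcoeff_nonzero) (metis wdeg_take_drop add.commute)+
    then show "n \<in> (\<lambda>(a, b). a + b) ` (degs f \<times> degs g)"
      by (fastforce simp: degs_def)
  qed
  then show "finite (degs (gbracket f g))"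
    using assms by (auto simp: Lhat_iff intro: finite_subset)
  fix n
  define P :: "'g series \<Rightarrow> 'g series" where "P f = (\<Sum>i<n. lcomp i f)" for f
  have P: "P h \<in> free_lie S" "h - P h \<in> fil n" if "h \<in> Lhat S" for h
    using that by (auto simp: P_def Lhat_iff fil_def wcoeff_lcomp intro: free_lie_sum)
  have "gbracket f g - gbracket (P f) (P g) = gbracket (f - P f) g + gbracket (P f) (g - P g)"
    by (simp add: clinD[OF clin_gbracket(1)] clinD[OF clin_gbracket(2)])
  also have "\<dots> \<in> fil n"
    using fil_gbracket[OF P(2)[OF assms(1)], of g 0] fil_gbracket[OF _ P(2)[OF assms(2)], of "P f" 0]
    by simp
  finally show "\<exists>h\<in>Lhat S. gbracket f g - h \<in> fil n"
    using P(1) assms by (blast intro: free_lie_Lhat free_lie.bracket)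
qed

text \<open>Write \<open>f = RN c\<close> and sort the words of \<open>c\<close> by their first
  letter: a right-normed bracket is a bracket with its first letter.\<close>

lemma Lhat_decompose:
  fixes f :: "'g::{graded_gen, finite} series"
  assumes "f \<in> Lhat S"
  obtains a g where "f = (\<Sum>s\<in>S. scale (a s) (gen s) + gbracket (gen s) (g s))" "\<And>s. g s \<in> Lhat S"
proof -
  obtain c where c: "f = RN c" "supported S c" "degs c \<subseteq> degs f"
    using Lhat_obtain_RN[OF assms] by metis
  \<comment> \<open>\<open>lder s\<close> strips a leading \<open>s\<close> but forgets the word
    \<open>[s]\<close> itself, which is accounted for by the linear coefficient.\<close>
  define lder :: "'g \<Rightarrow> 'g series \<Rightarrow> 'g series"
    where "lder s c = Series (\<lambda>u. if u = [] then 0 else wcoeff c (s # u))" for s c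
  let ?t = "\<lambda>s c. scale (wcoeff c [s]) (gen s) + gbracket (gen s) (RN (lder s c))"
  have cl: "clin (?t s)" for s
  proof (rule clinI)
    fix n and f :: "'g series"
    assume f: "f \<in> fil n"
    have "lder s f \<in> fil (n - 1)"
      using f by (auto simp: fil_def lder_def)
    then have "gbracket (gen s) (RN (lder s f)) \<in> fil (1 + (n - 1))"
      by (intro fil_gbracket fil_gen clinD(3)[OF RN_clin])
    then have "gbracket (gen s) (RN (lder s f)) \<in> fil n"
      by (rule fil_mono) simp
    moreover have "scale (wcoeff f [s]) (gen s) \<in> fil n"
    proof (cases "n \<le> 1")
      case True
      then show ?thesis
        by (intro fil_closed fil_mono[OF fil_gen])
    next
      case False
      then show ?thesis
        using fil_coeff[OF f, of "[s]"] by simp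
    qed
    ultimately show "?t s f \<in> fil n"
      by simp
  next
    fix f g :: "'g series" and a
    have "lder s (f + g) = lder s f + lder s g" "lder s (scale a f) = scale a (lder s f)"
      by (auto intro!: series_eqI simp: lder_def)
    then show "?t s (f + g) = ?t s f + ?t s g" "?t s (scale a f) = scale a (?t s f)"
      by (simp_all add: clinD[OF RN_clin] clinD[OF clin_gbracket(1)] scale_add_left)
  qed
  have cls: "clin (\<lambda>c. \<Sum>s\<in>A. ?t s c)" for A
    by (rule clin_sum) (rule cl)
  have "RN c = (\<Sum>s\<in>UNIV. ?t s c)"
  proof (rule clin_eqI[where f = c, OF RN_clin cls])
    fix u :: "'g list"
    show "RN (mon u) = (\<Sum>s\<in>UNIV. ?t s (mon u))"
    proof (cases u)
      case Nil
      have "lder s (mon []) = 0" for s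
        by (rule series_eqI) (simp add: lder_def wcoeff_mon)
      then show ?thesis
        unfolding Nil RN_mon by (simp add: wcoeff_mon clinD[OF RN_clin] clinD[OF clin_gbracket(1)])
    next
      case (Cons t v)
      have "lder s (mon (t # v)) = (if s = t \<and> v \<noteq> [] then mon v else 0)" for s
        by (rule series_eqI) (auto simp: lder_def wcoeff_mon)
      then have "?t s (mon u) = (if s = t then rn u else 0)" for s
        unfolding Cons by (auto simp: wcoeff_mon RN_mon clinD[OF RN_clin] clinD[OF clin_gbracket(1)])
      then show ?thesis
        by (simp add: RN_mon)
    qed
  qed
  also have "\<dots> = (\<Sum>s\<in>S. ?t s c)"
  proof (rule sum.mono_neutral_right)
    show "\<forall>s\<in>UNIV - S. ?t s c = 0"
    proof
      fix s
      assume "s \<in> UNIV - S"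
      then have "wcoeff c (s # u) = 0" for u
        using c(2) by (auto simp: supported_def)
      then have "wcoeff c [s] = 0" "lder s c = 0"
        by (auto intro!: series_eqI simp: lder_def)
      then show "?t s c = 0"
        by (simp add: clinD[OF RN_clin] clinD[OF clin_gbracket(1)])
    qed
  qed auto
  finally have "f = (\<Sum>s\<in>S. ?t s c)"
    using c(1) by simp
  moreover have "RN (lder s c) \<in> Lhat S" for s
  proof (rule RN_Lhat)
    show "supported S (lder s c)"
      using c(2) by (force simp: supported_def lder_def)
    have "degs (lder s c) \<subseteq> (\<lambda>n. n - gdeg s) ` degs c"
      by (force simp: degs_def lder_def image_iff split: if_splits)
    moreover have "finite (degs c)"
      using c(3) assms by (auto simp: Lhat_iff intro: finite_subset)
    ultimately show "finite (degs (lder s c))"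
      using finite_surj by blast
  qed
  ultimately show ?thesis
    by (rule that)
qed

text \<open>No continuity of \<open>D\<close> is assumed: decomposing \<open>f\<close> repeatedly into finitely many brackets
  with generators pushes \<open>D f\<close> into every step of the filtration.\<close>

lemma Lhat_map_zero:
  fixes D :: "'g::{graded_gen, finite} series \<Rightarrow> 'h series"
  assumes add: "\<And>x y. x \<in> Lhat S \<Longrightarrow> y \<in> Lhat S \<Longrightarrow> D (x + y) = D x + D y"
    and sc: "\<And>c x. x \<in> Lhat S \<Longrightarrow> D (scale c x) = scale c (D x)"
    and gen: "\<And>s. s \<in> S \<Longrightarrow> D (gen s) = 0"
    and br: "\<And>s y k. s \<in> S \<Longrightarrow> y \<in> Lhat S \<Longrightarrow> D y \<in> fil k \<Longrightarrow> D (gbracket (gen s) y) \<in> fil (Suc k)"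
    and f: "f \<in> Lhat S"
  shows "D f = 0"
proof (rule fil_all_zero)
  fix n
  show "D f \<in> fil n"
    using f
  proof (induction n arbitrary: f)
    case (Suc n)
    obtain a g where f: "f = (\<Sum>s\<in>S. scale (a s) (gen s) + gbracket (gen s) (g s))"
      and g: "\<And>s. g s \<in> Lhat S"
      using Lhat_decompose[OF Suc.prems] by metis
    have D0: "D 0 = 0"
      using sc[of 0 0] by simp
    have "D (\<Sum>s\<in>A. scale (a s) (gen s) + gbracket (gen s) (g s)) \<in> fil (Suc n)" if "A \<subseteq> S" for A
      using finite[of A] that
    proof (induction A rule: finite_induct)
      case (insert s A)
      let ?t = "\<lambda>s. scale (a s) (gen s) + gbracket (gen s) (g s)"
      have mem: "scale (a r) (gen r) \<in> Lhat S" "gbracket (gen r) (g r) \<in> Lhat S" if "r \<in> S" for r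
        using that g by (auto intro: Lhat_scale Lhat_gbracket gen_Lhat)
      have "(\<Sum>r\<in>A. ?t r) \<in> Lhat S"
        using insert.prems mem by (intro Lhat_sum Lhat_add) auto
      then have "D (\<Sum>r\<in>insert s A. ?t r) = D (gbracket (gen s) (g s)) + D (\<Sum>r\<in>A. ?t r)"
        using insert mem[of s] by (simp add: add sc gen gen_Lhat Lhat_add)
      then show ?case
        using insert br[of s "g s" n] Suc.IH[OF g[of s]] g by auto
    qed (simp add: D0)
    then show ?case
      unfolding f by blast
  qed simp
qed

section \<open>Maps and operations that preserve the completed Lie algebra\<close>

lemma degs_clin:
  fixes L :: "'g::{graded_gen, finite} series \<Rightarrow> 'h::graded_gen series"
  assumes "clin L" "\<And>u. homog (wdeg u + k) (L (mon u))"
  shows "degs (L f) \<subseteq> (\<lambda>n. n + k) ` degs f"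
proof
  fix n
  assume "n \<in> degs (L f)"
  then obtain w where w: "n = wdeg w" "wcoeff (L f) w \<noteq> 0"
    by (auto simp: degs_def)
  then obtain u where "wcoeff f u * wcoeff (L (mon u)) w \<noteq> 0"
    unfolding clin_wcoeff[OF assms(1), of f] by (meson sum.neutral)
  then show "n \<in> (\<lambda>n. n + k) ` degs f"
    using assms(2)[of u] w(1) by (force simp: homog_def degs_def)
qed

text \<open>Through the parametrization by \<open>RN\<close>, continuity reduces membership to
  right-normed brackets; the homogeneity of \<open>L\<close> keeps the number of degrees
  finite.\<close>

lemma clin_Lhat:
  fixes L :: "'g::{graded_gen, finite} series \<Rightarrow> 'h::graded_gen series"
  assumes L: "clin L" "\<And>u. homog (wdeg u + k) (L (mon u))"
    and rn: "\<And>u. set u \<subseteq> S \<Longrightarrow> L (rn u) \<in> Lhat T" and f: "f \<in> Lhat S"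
  shows "L f \<in> Lhat T"
proof (rule Lhat_limit)
  show "finite (degs (L f))"
    using finite_surj[OF _ degs_clin[OF L]] f by (auto simp: Lhat_iff)
  fix n
  obtain c where c: "f = RN c" "supported S c"
    using Lhat_obtain_RN[OF f] by metis
  have "scale (wcoeff c u) (L (rn u)) \<in> Lhat T" for u
    using c(2) rn by (cases "wcoeff c u = 0") (auto simp: supported_def intro: Lhat_scale)
  then have "L (RN (trunc n c)) \<in> Lhat T"
    unfolding RN_trunc by (auto simp: clinD[OF L(1)] intro: Lhat_sum)
  moreover have "L (RN c) - L (RN (trunc n c)) \<in> fil n"
    using clinD(3)[OF clin_comp[OF L(1) RN_clin] trunc_fil] clinD(6)[OF clin_comp[OF L(1) RN_clin]]
    by metis
  ultimately show "\<exists>g\<in>Lhat T. L f - g \<in> fil n"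
    using c(1) by blast
qed

lemma Lhat_degI: "f \<in> Lhat S \<Longrightarrow> homog n f \<Longrightarrow> f \<in> Lhat_deg S n"
  by (simp add: Lhat_deg_def)

lemma Lhat_degD: "f \<in> Lhat_deg S n \<Longrightarrow> f \<in> Lhat S" "f \<in> Lhat_deg S n \<Longrightarrow> homog n f"
  by (simp_all add: Lhat_deg_def)

lemma chom_gbracket:
  assumes "chom \<phi>" "\<And>f. \<phi> (tw f) = tw (\<phi> f)"
  shows "\<phi> (gbracket f g) = gbracket (\<phi> f) (\<phi> g)"
  by (simp add: gbracket_eq chomD[OF assms(1)] assms(2))

lemma chom_Lhat:
  fixes \<phi> :: "'g::{graded_gen, finite} series \<Rightarrow> 'h::graded_gen series"
  assumes \<phi>: "chom \<phi>" "\<And>s. homog (gdeg s) (\<phi> (gen s))"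
    and gen: "\<And>s. s \<in> S \<Longrightarrow> \<phi> (gen s) \<in> Lhat T" and f: "f \<in> Lhat S"
  shows "\<phi> f \<in> Lhat T"
proof (rule clin_Lhat[OF chomD(1)[OF \<phi>(1)], where k = 0])
  show "homog (wdeg u + 0) (\<phi> (mon u))" for u
    using chom_homog[OF \<phi> homog_mon] by simp
  show "\<phi> (rn u) \<in> Lhat T" if "set u \<subseteq> S" for u
    using that
    by (induction u) (auto simp: chomD[OF \<phi>(1)] chom_gbracket[OF \<phi>(1) chom_tw_commute[OF \<phi>]]
        gen intro: Lhat_gbracket)
qed (rule f)

lemma oder_gbracket:
  assumes "oder D" "homog n x"
  shows "D (gbracket x y) = gbracket (D x) y + scale (psgn n) (gbracket x (D y))"
proof -
  note L = clinD[OF oderD(1)[OF assms(1)]]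
  have tw: "tw x = scale (psgn n) x"
    by (rule tw_homog[OF assms(2)])
  then have "tw (D x) = scale (psgn (n + 1)) (D x)"
    using oderD(3)[OF assms(1), of x] L(2)[of "psgn n" x] by (metis minus_minus mult_minus1_right psgn_simps(2,4) scale_simps(10))
  note x = gbracket_parity[OF tw] gbracket_parity[OF this]
  have "D (twn n y) = scale (psgn n) (twn n (D y))"
    by (simp add: twn_def psgn_def oderD(3)[OF assms(1)])
  moreover have "tw (twn n y) = twn (n + 1) y"
    by (simp add: twn_def)
  ultimately show ?thesis
    by (simp add: x L oderD(2)[OF assms(1)] tw)
qed

lemma oder_Lhat:
  fixes D :: "'g::{graded_gen, finite} series \<Rightarrow> 'g series"
  assumes D: "oder D" "\<And>s. homog (gdeg s + k) (D (gen s))"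
    and gen: "\<And>s. s \<in> S \<Longrightarrow> D (gen s) \<in> Lhat S" and f: "f \<in> Lhat S"
  shows "D f \<in> Lhat S"
proof (rule clin_Lhat[OF oderD(1)[OF D(1)]])
  show "homog (wdeg u + k) (D (mon u))" for u
    using oder_homog[OF D homog_mon] .
  show "D (rn u) \<in> Lhat S" if "set u \<subseteq> S" for u
    using that
  proof (induction u)
    case (Cons s u)
    have "rn u \<in> Lhat S"
      using Cons.prems by (intro free_lie_Lhat rn_free_lie) auto
    then show ?case
      using Cons gen
      by (auto simp: oder_gbracket[OF D(1) homog_gen] intro!: Lhat_add Lhat_scale Lhat_gbracket gen_Lhat)
  qed (simp add: clinD[OF oderD(1)[OF D(1)]])
qed (rule f)

lemma Lhat_op_app_gbracket:
  assumes "x \<in> Lhat_deg S 0" "y \<in> Lhat_deg S n"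
  shows "op_app a (gbracket x) y \<in> Lhat_deg S n"
proof -
  note x = Lhat_degD[OF assms(1)] and y = Lhat_degD[OF assms(2)]
  note T = raising_gbracket[OF Lhat_fil_1[OF x(1)]]
  have k: "(gbracket x ^^ k) y \<in> Lhat S" "homog n ((gbracket x ^^ k) y)" for k
    by (induction k) (use x y homog_gbracket[OF x(2)] in \<open>auto intro: Lhat_gbracket\<close>)
  have h: "homog n (op_app a (gbracket x) y)"
    unfolding homog_def
  proof safe
    fix w
    assume "wcoeff (op_app a (gbracket x) y) w \<noteq> 0"
    then obtain j where "fps_nth a j * wcoeff ((gbracket x ^^ j) y) w \<noteq> 0"
      unfolding op_app_def wcoeff_Series by (meson sum.neutral)
    then show "wdeg w = n"
      using k(2)[of j] by (auto simp: homog_def)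
  qed
  have "op_app a (gbracket x) y \<in> Lhat S"
  proof (rule Lhat_limit[OF homog_degs[OF h]])
    fix m
    have "op_app a (gbracket x) y - (\<Sum>k\<le>m. scale (fps_nth a k) ((gbracket x ^^ k) y)) \<in> fil m"
      using op_app_approx[OF T] fil_mono le_SucI by blast
    then show "\<exists>g\<in>Lhat S. op_app a (gbracket x) y - g \<in> fil m"
      using k(1) by (blast intro: Lhat_sum Lhat_scale)
  qed
  then show ?thesis
    using h by (rule Lhat_degI)
qed

text \<open>The exponentials are not Lie, but conjugation by them is a series of iterated brackets
  with \<open>x\<close>.\<close>

lemma Lhat_conj_sexp:
  assumes "x \<in> Lhat_deg S 0" "y \<in> Lhat_deg S n"
  shows "sexp x * y * sexp (- x) \<in> Lhat_deg S n"
proof -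
  note x = Lhat_degD[OF assms(1)]
  note fil = Lhat_fil_1[OF x(1)]
  have "sexp x * y * sexp (- x) = op_app (fps_exp 1) (adc x) y * (sexp x * sexp (- x))"
    by (simp add: op_app_exp_adc[OF fil, symmetric] mult.assoc)
  also have "\<dots> = op_app (fps_exp 1) (gbracket x) y"
    by (simp add: sexp_inverse[OF fil] gbracket_adc[OF x(2)])
  finally show ?thesis
    using Lhat_op_app_gbracket[OF assms] by simp
qed

section \<open>Logarithmic derivatives for a weight grading\<close>

definition wtl :: "('g \<Rightarrow> nat) \<Rightarrow> 'g list \<Rightarrow> nat" where
  "wtl wt w = sum_list (map wt w)"

lemma wtl_simps [simp]: "wtl wt [] = 0" "wtl wt (s # u) = wt s + wtl wt u"
  "wtl wt (u @ v) = wtl wt u + wtl wt v"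
  by (simp_all add: wtl_def)

lemma wtl_take_drop: "wtl wt (take i w) + wtl wt (drop i w) = wtl wt w"
  by (metis append_take_drop_id wtl_simps(3))

lemma wtl_mset: "mset u = mset w \<Longrightarrow> wtl wt u = wtl wt w"
  unfolding wtl_def by (metis mset_map sum_mset_sum_list)

text \<open>The Euler derivation of the weight grading.\<close>

definition Nop :: "('g \<Rightarrow> nat) \<Rightarrow> 'g series \<Rightarrow> 'g series" where
  "Nop wt f = Series (\<lambda>w. of_nat (wtl wt w) * wcoeff f w)"

text \<open>On words of weight zero the division by zero gives \<open>0\<close>. The result is thus
  always of positive weight, and \<open>Nop\<close> is inverted on series of positive
  weight.\<close>

definition Ninv :: "('g \<Rightarrow> nat) \<Rightarrow> 'g series \<Rightarrow> 'g series" where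
  "Ninv wt f = Series (\<lambda>w. wcoeff f w / of_nat (wtl wt w))"

definition posw :: "('g \<Rightarrow> nat) \<Rightarrow> 'g series \<Rightarrow> bool" where
  "posw wt f \<longleftrightarrow> (\<forall>w. wtl wt w = 0 \<longrightarrow> wcoeff f w = 0)"

lemma wcoeff_Nop: "wcoeff (Nop wt f) w = of_nat (wtl wt w) * wcoeff f w"
  by (simp add: Nop_def)

lemma clin_Nop: "clin (Nop wt)"
  by (rule clinI; (rule series_eqI)?) (auto simp: Nop_def fil_def algebra_simps)

lemma clin_Ninv: "clin (Ninv wt)"
  by (rule clinI; (rule series_eqI)?) (auto simp: Ninv_def fil_def add_divide_distrib)

lemma Nop_mult: "Nop wt (f * g) = Nop wt f * g + f * Nop wt g"
proof (rule series_eqI)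
  fix w
  have "of_nat (wtl wt w) * (a * b) = of_nat (wtl wt (take i w)) * a * b + a * (of_nat (wtl wt (drop i w)) * b)"
    for i and a b :: rat
    unfolding wtl_take_drop[of wt i w, symmetric] by (simp add: algebra_simps)
  then show "wcoeff (Nop wt (f * g)) w = wcoeff (Nop wt f * g + f * Nop wt g) w"
    unfolding wcoeff_add wcoeff_mult wcoeff_Nop sum_distrib_left sum.distrib[symmetric]
    by (intro sum.cong refl)
qed

lemma Nop_one: "Nop wt 1 = 0"
  by (rule series_eqI) (simp add: wcoeff_Nop wcoeff_one)

lemma Nop_gen: "Nop wt (gen s) = scale (of_nat (wt s)) (gen s)"
  by (rule series_eqI) (simp add: wcoeff_Nop wcoeff_gen)

lemma Nop_Ninv: "posw wt f \<Longrightarrow> Nop wt (Ninv wt f) = f"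
  by (rule series_eqI) (auto simp: Nop_def Ninv_def posw_def)

lemma posw_Ninv: "posw wt (Ninv wt f)"
  by (simp add: posw_def Ninv_def)

lemma posw_mult: "posw wt f \<or> posw wt g \<Longrightarrow> posw wt (f * g)"
  unfolding posw_def wcoeff_mult
proof (intro allI impI sum.neutral ballI)
  fix w i
  assume "wtl wt w = 0" "(\<forall>w. wtl wt w = 0 \<longrightarrow> wcoeff f w = 0) \<or> (\<forall>w. wtl wt w = 0 \<longrightarrow> wcoeff g w = 0)"
  moreover have "wtl wt (take i w) + wtl wt (drop i w) = wtl wt w"
    by (rule wtl_take_drop)
  ultimately show "wcoeff f (take i w) * wcoeff g (drop i w) = 0"
    by auto
qed

lemma posw_op_app_adc: "posw wt y \<Longrightarrow> posw wt (op_app a (adc x) y)"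
proof -
  assume y: "posw wt y"
  have "posw wt ((adc x ^^ k) y)" for k
  proof (induction k)
    case (Suc k)
    then have "posw wt (x * (adc x ^^ k) y)" "posw wt ((adc x ^^ k) y * x)"
      by (auto intro: posw_mult)
    then show ?case
      by (simp add: adc_def[of x "(adc x ^^ k) y"] posw_def)
  qed (simp add: y)
  then show ?thesis
    by (simp add: posw_def op_app_def)
qed

text \<open>All words of \<open>rn u\<close> are rearrangements of \<open>u\<close> and share its
  weight; dividing by the weight hence stays within the Lie algebra.\<close>

lemma Ninv_RN: "Ninv wt (RN c) = RN (Ninv wt c)" for c :: "'g::{graded_gen, finite} series"
proof (rule clin_eqI[where f = c])
  fix u :: "'g list"
  have "Ninv wt (rn u) = scale (1 / of_nat (wtl wt u)) (rn u)"
  proof (rule series_eqI)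
    fix w
    show "wcoeff (Ninv wt (rn u)) w = wcoeff (scale (1 / of_nat (wtl wt u)) (rn u)) w"
      using wtl_mset[OF rn_mset[of u w], of wt] by (cases "wcoeff (rn u) w = 0") (auto simp: Ninv_def)
  qed
  moreover have "Ninv wt (mon u) = scale (1 / of_nat (wtl wt u)) (mon u)"
    by (rule series_eqI) (simp add: Ninv_def wcoeff_mon)
  ultimately show "Ninv wt (RN (mon u)) = RN (Ninv wt (mon u))"
    by (simp add: RN_mon clinD[OF RN_clin])
qed (simp_all add: clin_comp[OF clin_Ninv] clin_comp[OF RN_clin] clin_Ninv RN_clin)

lemma Ninv_Lhat:
  fixes f :: "'g::{graded_gen, finite} series"
  assumes "f \<in> Lhat S"
  shows "Ninv wt f \<in> Lhat S"
proof -
  obtain c where c: "f = RN c" "supported S c" "degs c \<subseteq> degs f"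
    using Lhat_obtain_RN[OF assms] by metis
  have "degs (Ninv wt c) \<subseteq> degs c"
    by (auto simp: degs_def Ninv_def)
  then have "finite (degs (Ninv wt c))"
    using c(3) assms by (auto simp: Lhat_iff intro: finite_subset)
  moreover have "supported S (Ninv wt c)"
    using c(2) by (auto simp: supported_def Ninv_def)
  ultimately show ?thesis
    unfolding c(1) Ninv_RN by (intro RN_Lhat)
qed

lemma homog_Ninv: "homog n f \<Longrightarrow> homog n (Ninv wt f)"
  by (auto simp: homog_def Ninv_def)

text \<open>Since \<open>y\<close> has no constant term, bracketing it with the difference
  \<open>x - x'\<close> gains one length. This gain is the contraction.\<close>

lemma op_app_gbracket_contraction:
  assumes "x - x' \<in> fil k" "x \<in> fil 1" "x' \<in> fil 1" "y \<in> fil 1"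
  shows "op_app a (gbracket x) y - op_app a (gbracket x') y \<in> fil (Suc k)"
proof -
  have *: "(gbracket x ^^ j) y - (gbracket x' ^^ j) y \<in> fil (Suc k)" for j
  proof (induction j)
    case (Suc j)
    let ?X = "(gbracket x ^^ j) y" and ?X' = "(gbracket x' ^^ j) y"
    have "?X \<in> fil 1"
      using raising_pow[OF raising_gbracket[OF assms(2)] assms(4), of j] fil_mono by fastforce
    then have "gbracket (x - x') ?X \<in> fil (k + 1)" "gbracket x' (?X - ?X') \<in> fil (1 + Suc k)"
      using assms Suc by (intro fil_gbracket; simp)+
    then have "gbracket (x - x') ?X \<in> fil (Suc k)" "gbracket x' (?X - ?X') \<in> fil (Suc k)"
      using fil_mono[of _ "1 + Suc k" "Suc k"] by auto
    moreover have "gbracket x ?X - gbracket x' ?X' = gbracket (x - x') ?X + gbracket x' (?X - ?X')"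
      by (simp add: clinD[OF clin_gbracket(1)] clinD[OF clin_gbracket(2)])
    ultimately show ?case
      by simp
  qed simp
  have "wcoeff ((gbracket x ^^ j) y) w = wcoeff ((gbracket x' ^^ j) y) w" if "length w < Suc k" for j w
    using fil_coeff[OF *[of j] that] by simp
  then show ?thesis
    by (simp add: fil_def op_app_def)
qed

text \<open>The equation \<open>N (exp \<alpha>) = \<lambda> exp \<alpha>\<close> amounts to \<open>N \<alpha> = ad\<^sub>\<alpha> / (exp ad\<^sub>\<alpha> - 1) (\<lambda>)\<close>, which is
  solved by iterating a contraction of the Lie algebra.\<close>

lemma log_derivative_solution:
  fixes l :: "'g::{graded_gen, finite} series"
  assumes l: "l \<in> Lhat_deg S 0" "posw wt l"
  obtains \<alpha> where "\<alpha> \<in> Lhat_deg S 0" "posw wt \<alpha>" "Nop wt (sexp \<alpha>) = l * sexp \<alpha>"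
proof -
  \<comment> \<open>The series \<open>X / (exp X - 1)\<close>, inverse to the factor produced by
    \<open>derivation_sexp\<close>.\<close>
  define b where "b = inverse fps_expm1_div"
  define T where "T x = Ninv wt (op_app b (gbracket x) l)" for x
  define a where "a n = (T ^^ n) 0" for n
  have a_Suc: "a (Suc n) = T (a n)" for n
    by (simp add: a_def)
  have T_Lhat: "T x \<in> Lhat_deg S 0" if "x \<in> Lhat_deg S 0" for x
    using Lhat_op_app_gbracket[OF that l(1)] unfolding T_def
    by (intro Lhat_degI Ninv_Lhat homog_Ninv) (auto dest: Lhat_degD)
  have a_Lhat: "a n \<in> Lhat_deg S 0" for n
    by (induction n) (auto simp: a_Suc T_Lhat, simp add: a_def Lhat_deg_def)
  have T_contr: "T x - T x' \<in> fil (Suc k)" if "x - x' \<in> fil k" "x \<in> fil 1" "x' \<in> fil 1" for x x' k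
    unfolding T_def clinD(6)[OF clin_Ninv, symmetric]
    using op_app_gbracket_contraction[OF that Lhat_fil_1[OF Lhat_degD(1)[OF l(1)]]]
    by (rule clinD(3)[OF clin_Ninv])
  have a_fil: "a n \<in> fil 1" for n
    using Lhat_fil_1[OF Lhat_degD(1)[OF a_Lhat]] .
  have step: "a (Suc n) - a n \<in> fil n" for n
  proof (induction n)
    case (Suc n)
    show ?case
      using T_contr[OF Suc a_fil a_fil] by (simp only: a_Suc)
  qed simp
  define \<alpha> where "\<alpha> = lim_at a"
  have lim: "\<alpha> - a n \<in> fil n" for n
    unfolding \<alpha>_def by (rule lim_at[OF step])
  have \<alpha>_fil: "\<alpha> \<in> fil 1"
    using fil_closed(2)[OF lim[of 1] a_fil[of 1]] by simp
  have hom: "homog 0 \<alpha>"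
    using Lhat_degD(2)[OF a_Lhat] by (auto simp: \<alpha>_def lim_at_def homog_def)
  have "\<alpha> \<in> Lhat S"
    using lim Lhat_degD(1)[OF a_Lhat] by (intro Lhat_limit homog_degs[OF hom]) blast
  then have \<alpha>_Lhat: "\<alpha> \<in> Lhat_deg S 0"
    using hom by (rule Lhat_degI)
  have "\<alpha> - T \<alpha> = 0"
  proof (rule fil_all_zero)
    fix n
    have "\<alpha> - T \<alpha> = (\<alpha> - a (Suc n)) - (T \<alpha> - T (a n))"
      by (simp add: a_Suc)
    also have "\<dots> \<in> fil (Suc n)"
      by (intro fil_closed lim T_contr \<alpha>_fil a_fil)
    finally show "\<alpha> - T \<alpha> \<in> fil n"
      by (rule fil_mono) simp
  qed
  then have fp: "\<alpha> = T \<alpha>"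
    by simp
  have adc: "gbracket \<alpha> = adc \<alpha>"
    by (rule gbracket_adc[OF hom])
  have "Nop wt \<alpha> = op_app b (adc \<alpha>) l"
    by (subst fp) (simp add: T_def Nop_Ninv adc posw_op_app_adc[OF l(2)])
  then have "Nop wt (sexp \<alpha>) = op_app fps_expm1_div (adc \<alpha>) (op_app b (adc \<alpha>) l) * sexp \<alpha>"
    using derivation_sexp[OF \<alpha>_fil clin_Nop Nop_mult Nop_one] by simp
  also have "\<dots> = l * sexp \<alpha>"
    unfolding op_app_mult[OF raising_adc[OF \<alpha>_fil], symmetric] b_def
    by (subst inverse_mult_eq_1') (simp_all add: fps_expm1_div_def op_app_simps[OF raising_adc[OF \<alpha>_fil]])
  finally show ?thesis
    using that[OF \<alpha>_Lhat] posw_Ninv fp T_def by metis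
qed

text \<open>Multiplication by \<open>l\<close> raises length, whereas \<open>Nop\<close> preserves
  it and is injective on positive weight; so \<open>f\<close> climbs through every step of the
  filtration.\<close>

lemma log_derivative_unique:
  assumes "l \<in> fil 1" "Nop wt f = l * f" "posw wt f"
  shows "f = 0"
proof (rule fil_all_zero)
  fix n
  show "f \<in> fil n"
  proof (induction n)
    case (Suc n)
    have "Nop wt f \<in> fil (1 + n)"
      unfolding assms(2) by (rule fil_mult[OF assms(1) Suc])
    then show ?case
      using assms(3) by (auto simp: fil_def posw_def wcoeff_Nop)
  qed simp
qed

lemma Nop_RN: "Nop wt (RN c) = RN (Nop wt c)" for c :: "'g::{graded_gen, finite} series"
proof (rule clin_eqI[where f = c])
  fix u :: "'g list"
  have "Nop wt (rn u) = scale (of_nat (wtl wt u)) (rn u)"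
  proof (rule series_eqI)
    fix w
    show "wcoeff (Nop wt (rn u)) w = wcoeff (scale (of_nat (wtl wt u)) (rn u)) w"
      using wtl_mset[OF rn_mset[of u w], of wt] by (cases "wcoeff (rn u) w = 0") (auto simp: Nop_def)
  qed
  moreover have "Nop wt (mon u) = scale (of_nat (wtl wt u)) (mon u)"
    by (rule series_eqI) (simp add: Nop_def wcoeff_mon)
  ultimately show "Nop wt (RN (mon u)) = RN (Nop wt (mon u))"
    by (simp add: RN_mon clinD[OF RN_clin])
qed (simp_all add: clin_comp[OF clin_Nop] clin_comp[OF RN_clin] clin_Nop RN_clin)

lemma Nop_Lhat_deg:
  fixes f :: "'g::{graded_gen, finite} series"
  assumes "f \<in> Lhat_deg S n"
  shows "Nop wt f \<in> Lhat_deg S n"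
proof -
  note f = Lhat_degD[OF assms]
  obtain c where c: "f = RN c" "supported S c" "degs c \<subseteq> degs f"
    using Lhat_obtain_RN[OF f(1)] by metis
  have "degs (Nop wt c) \<subseteq> degs c"
    by (auto simp: degs_def Nop_def)
  then have "finite (degs (Nop wt c))"
    using c(3) f(1) by (auto simp: Lhat_iff intro: finite_subset)
  moreover have "supported S (Nop wt c)"
    using c(2) by (auto simp: supported_def Nop_def)
  ultimately have "Nop wt f \<in> Lhat S"
    unfolding c(1) Nop_RN by (intro RN_Lhat)
  moreover have "homog n (Nop wt f)"
    using f(2) by (auto simp: homog_def wcoeff_Nop)
  ultimately show ?thesis
    by (rule Lhat_degI)
qed

lemma Lhat_deg_add: "f \<in> Lhat_deg S n \<Longrightarrow> g \<in> Lhat_deg S n \<Longrightarrow> f + g \<in> Lhat_deg S n"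
  by (simp add: Lhat_deg_def Lhat_add)

lemma Lhat_deg_uminus: "f \<in> Lhat_deg S n \<Longrightarrow> - f \<in> Lhat_deg S n"
  by (simp add: Lhat_deg_def Lhat_uminus)

text \<open>For the weight given by the word length, \<open>sexp x * sexp y\<close> has a logarithmic derivative in the
  Lie algebra and is therefore the exponential of a Lie element.\<close>

lemma Lhat_bch:
  fixes x y :: "'g::{graded_gen, finite} series"
  assumes x: "x \<in> Lhat_deg S 0" and y: "y \<in> Lhat_deg S 0"
  shows "x \<star> y \<in> Lhat_deg S 0"
proof -
  let ?wt = "\<lambda>_ :: 'g. 1 :: nat"
  define l where "l z = op_app fps_expm1_div (gbracket z) (Nop ?wt z)" for z
  have l: "l z \<in> Lhat_deg S 0" "Nop ?wt (sexp z) = l z * sexp z" if "z \<in> Lhat_deg S 0" for z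
  proof -
    show "l z \<in> Lhat_deg S 0"
      unfolding l_def using that by (intro Lhat_op_app_gbracket Nop_Lhat_deg)
    show "Nop ?wt (sexp z) = l z * sexp z"
      unfolding l_def gbracket_adc[OF Lhat_degD(2)[OF that]]
      by (rule derivation_sexp[OF Lhat_fil_1[OF Lhat_degD(1)[OF that]] clin_Nop Nop_mult Nop_one])
  qed
  note xfil = Lhat_fil_1[OF Lhat_degD(1)[OF x]]
  \<comment> \<open>The logarithmic derivative of a product: that of the first factor plus the
    conjugate, by the first factor, of that of the second.\<close>
  define m where "m = l x + sexp x * l y * sexp (- x)"
  have m: "m \<in> Lhat_deg S 0"
    unfolding m_def by (intro Lhat_deg_add Lhat_conj_sexp l x y)
  have m_fil: "m \<in> fil 1"
    by (rule Lhat_fil_1[OF Lhat_degD(1)[OF m]])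
  have wtl1: "wtl ?wt w = length w" for w :: "'g list"
    by (induction w) auto
  have "posw ?wt m"
    using m_fil unfolding fil_1_iff posw_def wtl1 by simp
  then obtain \<alpha> where \<alpha>: "\<alpha> \<in> Lhat_deg S 0" "Nop ?wt (sexp \<alpha>) = m * sexp \<alpha>"
    using log_derivative_solution[OF m] by metis
  have "Nop ?wt (sexp x * sexp y) = l x * sexp x * sexp y + sexp x * (l y * sexp y)"
    by (simp only: Nop_mult l x y)
  also have "\<dots> = m * (sexp x * sexp y)"
  proof -
    have "sexp x * l y * sexp (- x) * (sexp x * sexp y) = sexp x * l y * (sexp (- x) * sexp x) * sexp y"
      by (simp add: mult.assoc)
    then show ?thesis
      by (simp add: m_def sexp_inverse[OF xfil] algebra_simps)
  qed
  finally have P: "Nop ?wt (sexp x * sexp y) = m * (sexp x * sexp y)" .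
  have "sexp \<alpha> - sexp x * sexp y = 0"
  proof (rule log_derivative_unique[OF m_fil])
    show "Nop ?wt (sexp \<alpha> - sexp x * sexp y) = m * (sexp \<alpha> - sexp x * sexp y)"
      by (simp only: clinD(6)[OF clin_Nop] \<alpha>(2) P right_diff_distrib)
    have "(sexp \<alpha> - 1) - (sexp x * sexp y - 1) \<in> fil 1"
      by (intro fil_closed(3) mult_minus_one_fil sexp_minus_one_fil)
    then show "posw ?wt (sexp \<alpha> - sexp x * sexp y)"
      unfolding fil_1_iff posw_def wtl1 by simp
  qed
  then have "x \<star> y = \<alpha>"
    by (intro bch_eqI Lhat_fil_1[OF Lhat_degD(1)[OF \<alpha>(1)]]) simp
  then show ?thesis
    using \<alpha>(1) by simp
qed

section \<open>Supports\<close>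

lemma supported_mult:
  assumes "supported S f" "supported S g"
  shows "supported S (f * g)"
  unfolding supported_def
proof (intro allI impI)
  fix w
  assume "wcoeff (f * g) w \<noteq> 0"
  then obtain i where "wcoeff f (take i w) * wcoeff g (drop i w) \<noteq> 0"
    unfolding wcoeff_mult by (meson sum.neutral)
  then have "set (take i w) \<union> set (drop i w) \<subseteq> S"
    using assms by (auto simp: supported_def)
  then show "set w \<subseteq> S"
    by (metis append_take_drop_id set_append)
qed

lemma supported_simps:
  "supported S 0" "supported S 1"
  "supported S f \<Longrightarrow> supported S g \<Longrightarrow> supported S (f + g)"
  "supported S f \<Longrightarrow> supported S g \<Longrightarrow> supported S (f - g)"
  "supported S f \<Longrightarrow> supported S (- f)"
  by (auto simp: supported_def wcoeff_one) (metis add.right_neutral in_mono, metis diff_zero in_mono)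

lemma supported_power: "supported S f \<Longrightarrow> supported S (f ^ n)"
  by (induction n) (auto intro: supported_mult supported_simps)

lemma supported_sexp:
  assumes "supported S f"
  shows "supported S (sexp f)"
  unfolding supported_def
proof (intro allI impI)
  fix w
  assume "wcoeff (sexp f) w \<noteq> 0"
  then obtain k where "fps_nth (fps_exp 1) k * wcoeff (f ^ k) w \<noteq> 0"
    unfolding sexp_def fps_app_def wcoeff_Series by (meson sum.neutral)
  then show "set w \<subseteq> S"
    using supported_power[OF assms, of k] by (auto simp: supported_def)
qed

lemma supported_Lhat: "f \<in> Lhat S \<Longrightarrow> supported S f"
  using Lhat_word(1) by (auto simp: supported_def)

lemma supported_gen: "s \<in> S \<Longrightarrow> supported S (gen s)"
  by (auto simp: supported_def wcoeff_gen split: if_splits)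

lemma supported_chom:
  fixes \<phi> :: "'g::finite series \<Rightarrow> 'h series"
  assumes \<phi>: "chom \<phi>" and gen: "\<And>s. s \<in> S \<Longrightarrow> supported T (\<phi> (gen s))" and f: "supported S f"
  shows "supported T (\<phi> f)"
  unfolding supported_def
proof (intro allI impI)
  fix w
  assume "wcoeff (\<phi> f) w \<noteq> 0"
  then obtain u where u: "wcoeff f u * wcoeff (\<phi> (mon u)) w \<noteq> 0"
    unfolding clin_wcoeff[OF chomD(1)[OF \<phi>], of f] by (meson sum.neutral)
  have "supported T (\<phi> (mon u))" if "set u \<subseteq> S" for u
    using that by (induction u) (auto simp: mon_Nil mon_Cons chomD[OF \<phi>] gen intro: supported_simps supported_mult)
  then have "supported T (\<phi> (mon u))"
    using u f by (auto simp: supported_def)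
  then show "set w \<subseteq> T"
    using u by (auto simp: supported_def)
qed

lemma free_lie_mono: "x \<in> free_lie S \<Longrightarrow> S \<subseteq> T \<Longrightarrow> x \<in> free_lie T"
  by (induction rule: free_lie.induct) (auto intro: free_lie.intros)

lemma Lhat_mono: "x \<in> Lhat S \<Longrightarrow> S \<subseteq> T \<Longrightarrow> x \<in> Lhat T"
  unfolding Lhat_iff using free_lie_mono by blast

lemma Lhat_deg_mono: "x \<in> Lhat_deg S n \<Longrightarrow> S \<subseteq> T \<Longrightarrow> x \<in> Lhat_deg T n"
  unfolding Lhat_deg_def using Lhat_mono by blast

lemma gen_Lhat_deg: "s \<in> S \<Longrightarrow> gen s \<in> Lhat_deg S (gdeg s)"
  by (intro Lhat_degI gen_Lhat homog_gen)

lemma sexp_inj: "f \<in> fil 1 \<Longrightarrow> g \<in> fil 1 \<Longrightarrow> sexp f = sexp g \<Longrightarrow> f = g"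
  using slog_sexp by metis

lemma chom_bch: "chom \<phi> \<Longrightarrow> x \<in> fil 1 \<Longrightarrow> y \<in> fil 1 \<Longrightarrow> \<phi> (x \<star> y) = \<phi> x \<star> \<phi> y"
  unfolding bch_def
  by (subst chom_slog) (auto simp: chomD chom_sexp intro: mult_minus_one_fil sexp_minus_one_fil simp del: One_nat_def)

section \<open>The exponential of the edge of a Lawrence-Sullivan interval\<close>

lemma oder_sexp:
  assumes D: "oder D" and x: "x \<in> fil 1" "homog 0 x"
  shows "D (sexp x) = op_app fps_expm1_div (adc x) (D x) * sexp x"
proof (rule derivation_sexp[OF x(1) oderD(1)[OF D] _ oderD(4)[OF D]])
  show "D (x * f) = D x * f + x * D f" for f
    using tw_homog[OF x(2)] by (simp add: oderD(2)[OF D])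
qed

text \<open>Both operations applied to \<open>y\<close> and \<open>z\<close> are invertible. With
  \<open>oder_sexp\<close> this recovers \<open>D x\<close> from \<open>D (sexp x)\<close>.\<close>

lemma op_app_expm1_div_inj:
  assumes x: "x \<in> fil 1"
    and eq: "op_app fps_expm1_div (adc x) y * sexp x = op_app fps_expm1_div (adc x) z * sexp x"
  shows "y = z"
proof -
  let ?P = "op_app fps_expm1_div (adc x)" and ?I = "op_app (inverse fps_expm1_div) (adc x)"
  have I: "?I (?P u) = u" for u
    unfolding op_app_mult[OF raising_adc[OF x], symmetric]
    by (subst inverse_mult_eq_1) (simp_all add: fps_expm1_div_def op_app_simps[OF raising_adc[OF x]])
  have "?P y * (sexp x * sexp (- x)) = ?P z * (sexp x * sexp (- x))"
    using eq by (simp only: mult.assoc[symmetric])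
  then have "?P y = ?P z"
    by (simp add: sexp_inverse[OF x])
  then show ?thesis
    using I by metis
qed

text \<open>Both denominators are \<open>X\<close> times a unit, so the divisions are exact. These
  products are what remains of the Lawrence-Sullivan coefficients after passing to the exponential
  of the edge.\<close>

lemma LS_coefficients:
  "fps_expm1_div * (fps_X / (1 - fps_exp 1)) = - 1"
  "fps_expm1_div * (fps_X / (1 - fps_exp (- 1))) = fps_exp 1"
proof -
  let ?P = fps_expm1_div
  have unit: "?P * inverse ?P = 1"
    by (subst inverse_mult_eq_1') (simp_all add: fps_expm1_div_def)
  have e: "fps_exp 1 * fps_exp (- 1) = (1 :: rat fps)"
    unfolding fps_exp_add_mult[symmetric] by simp
  have f1: "1 - fps_exp 1 = - (?P * fps_X)"
    by (simp add: fps_expm1_div_X)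
  have f2: "1 - fps_exp (- 1) = ?P * fps_X * fps_exp (- 1)"
    unfolding fps_expm1_div_X using e by (simp add: algebra_simps)
  have "fps_X = (1 - fps_exp 1) * (- inverse ?P)"
    unfolding f1 using unit by (simp add: algebra_simps)
  then have A: "(fps_X / (1 - fps_exp 1)) * (1 - fps_exp (1 :: rat)) = fps_X"
    by (intro dvd_div_mult_self) (metis dvd_triv_left)
  have "?P * (fps_X / (1 - fps_exp 1)) * fps_X
      = - ((fps_X / (1 - fps_exp 1)) * (1 - fps_exp (1 :: rat)))"
    by (subst (3) f1) (simp add: mult_ac)
  then have "(- 1) * fps_X = ?P * (fps_X / (1 - fps_exp 1)) * fps_X"
    unfolding A by simp
  then show "?P * (fps_X / (1 - fps_exp 1)) = - 1"
    using mult_right_cancel[of fps_X "- 1" "?P * (fps_X / (1 - fps_exp 1))"] by simp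
  have "fps_X = (1 - fps_exp (- 1)) * (fps_exp 1 * inverse ?P)"
  proof -
    have "(1 - fps_exp (- 1)) * (fps_exp 1 * inverse ?P)
        = fps_X * (?P * inverse ?P) * (fps_exp 1 * fps_exp (- 1))"
      unfolding f2 by (simp only: mult_ac)
    then show ?thesis
      unfolding unit e by simp
  qed
  then have "(fps_X / (1 - fps_exp (- 1))) * (1 - fps_exp (- (1 :: rat))) = fps_X"
    by (intro dvd_div_mult_self) (metis dvd_triv_left)
  then have "fps_exp 1 * fps_X
      = fps_exp 1 * ((fps_X / (1 - fps_exp (- 1))) * (?P * fps_X * fps_exp (- 1)))"
    unfolding f2 by simp
  also have "\<dots> = (fps_exp 1 * fps_exp (- 1)) * (?P * (fps_X / (1 - fps_exp (- 1))) * fps_X)"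
    by (simp only: mult_ac)
  finally show "?P * (fps_X / (1 - fps_exp (- 1))) = fps_exp 1"
    unfolding e using mult_right_cancel[of fps_X "fps_exp 1" "?P * (fps_X / (1 - fps_exp (- 1)))"] by simp
qed

text \<open>In exponential form the edge is a transport from \<open>b\<close> to \<open>a\<close>;
  relations of this shape compose under multiplication.\<close>

lemma LS_interval_sexp:
  assumes D: "oder D" and LS: "LS_interval d a b x" and dx: "D (gen x) = d (gen x)"
  shows "D (sexp (gen x)) = sexp (gen x) * gen b - gen a * sexp (gen x)"
proof -
  have x: "gen x \<in> fil 1" "homog 0 (gen x)"
    using fil_gen homog_gen[of x] LS by (auto simp: LS_interval_def)
  note T = raising_adc[OF x(1)]
  let ?op = "\<lambda>a. op_app a (adc (gen x))"
  have "D (gen x) = ?op (fps_X / (1 - fps_exp 1)) (gen a) + ?op (fps_X / (1 - fps_exp (- 1))) (gen b)"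
    using LS dx by (simp add: LS_interval_def fps_ad_eq gbracket_adc[OF x(2)])
  then have "?op fps_expm1_div (D (gen x)) = ?op (- 1) (gen a) + ?op (fps_exp 1) (gen b)"
    by (simp add: clinD(1)[OF clin_op_app[OF T]] LS_coefficients flip: op_app_mult[OF T])
  also have "\<dots> = ?op (fps_exp 1) (gen b) - gen a"
    by (simp add: op_app_simps[OF T])
  finally show ?thesis
    by (simp add: oder_sexp[OF D x] op_app_exp_adc[OF x(1)] left_diff_distrib)
qed

section \<open>The boundary of the triangle\<close>

instance tri_gen :: finite
proof
  have "x \<in> {V1, V2, V3, X1, X2, X3, E, E'}" for x
    by (cases x) auto
  then show "finite (UNIV :: tri_gen set)"
    by (intro finite_subset[of UNIV "{V1, V2, V3, X1, X2, X3, E, E'}"]) auto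
qed

lemma UNIV_tri_gen: "UNIV = {V1, V2, V3, X1, X2, X3, E, E'}"
proof -
  have "x \<in> {V1, V2, V3, X1, X2, X3, E, E'}" for x
    by (cases x) auto
  then show ?thesis
    by auto
qed

lemma Gam_simps [simp]: "V1 \<in> Gam" "V2 \<in> Gam" "V3 \<in> Gam" "X1 \<in> Gam" "X2 \<in> Gam" "X3 \<in> Gam"
  "E \<notin> Gam" "E' \<notin> Gam"
  by (simp_all add: Gam_def)

lemma homog_gens: "homog (- 1) v1" "homog (- 1) v2" "homog (- 1) v3"
  "homog 0 x1" "homog 0 x2" "homog 0 x3" "homog 1 e" "homog 1 e'"
  using homog_gen[of V1] homog_gen[of V2] homog_gen[of V3] homog_gen[of X1] homog_gen[of X2]
    homog_gen[of X3] homog_gen[of E] homog_gen[of E'] by simp_all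

lemma tw_gens [simp]: "tw v1 = - v1" "tw v2 = - v2" "tw v3 = - v3" "tw x1 = x1" "tw x2 = x2"
  "tw x3 = x3" "tw e = - e" "tw e' = - e'"
  using homog_gens by (simp_all add: tw_homog)

lemma Gam_wdeg: "set u \<subseteq> Gam \<Longrightarrow> wdeg u \<le> 0"
  by (induction u) (auto simp: Gam_def)

lemma Gam_deg_0_word: "set u \<subseteq> Gam \<Longrightarrow> wdeg u = 0 \<Longrightarrow> set u \<subseteq> {X1, X2, X3}"
proof (induction u)
  case (Cons s u)
  then have "gdeg s \<le> 0" "wdeg u \<le> 0" "gdeg s + wdeg u = 0"
    using Gam_wdeg[of u] by (auto simp: Gam_def)
  then show ?case
    using Cons by (auto simp: Gam_def)
qed simp

lemma Gam_deg_0_supported: "supported Gam f \<Longrightarrow> homog 0 f \<Longrightarrow> supported {X1, X2, X3} f"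
  using Gam_deg_0_word by (simp add: supported_def homog_def)

definition Xprod :: "tri_gen series" where
  "Xprod = x1 \<star> x2 \<star> x3"

lemma Xprod_Lhat_deg: "Xprod \<in> Lhat_deg Gam 0"
  unfolding Xprod_def using gen_Lhat_deg[of X1 Gam] gen_Lhat_deg[of X2 Gam] gen_Lhat_deg[of X3 Gam]
  by (intro Lhat_bch) auto

lemma Xprod_fil: "Xprod \<in> fil 1"
  unfolding Xprod_def by (rule bch_fil_1)

lemma sexp_Xprod: "sexp Xprod = sexp x1 * sexp x2 * sexp x3"
  unfolding Xprod_def sexp_bch ..

locale triangle =
  fixes d d2 :: "tri_gen series \<Rightarrow> tri_gen series"
  assumes L_Gamma: "L_Gamma d" and L_2: "L_2 d d2"
begin

section \<open>The differential as a derivation of all series\<close>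

lemma cdgl_d: "cdgl Gam d"
  using L_Gamma by (simp add: L_Gamma_def)

lemma cdgl_d2: "cdgl (insert E Gam) d2"
  using L_2 by (simp add: L_2_def)

lemma d2_eq_d: "x \<in> Lhat Gam \<Longrightarrow> d2 x = d x"
  using L_2 by (simp add: L_2_def)

lemma d2_e: "d2 e = - gbracket v1 e + Xprod"
  using L_2 by (simp add: L_2_def Xprod_def)

text \<open>\<open>d2\<close> is specified on Lie elements, but exponentials have to be
  differentiated. The value at \<open>E'\<close>, which is not a generator of the triangle model, is
  a default.\<close>

definition Dser :: "tri_gen series \<Rightarrow> tri_gen series" where
  "Dser = der (\<lambda>s. if s = E' then 0 else d2 (gen s))"

lemma d2_gen: "s \<noteq> E' \<Longrightarrow> d2 (gen s) \<in> Lhat_deg (insert E Gam) (gdeg s + - 1)"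
proof -
  assume "s \<noteq> E'"
  then have "s \<in> insert E Gam"
    by (cases s) auto
  then show ?thesis
    using cdgl_d2 gen_Lhat_deg unfolding cdgl_def graded_linear_def by metis
qed

lemma oder_Dser: "oder Dser"
  unfolding Dser_def
proof (rule oder_der)
  fix s
  show "(if s = E' then 0 else d2 (gen s)) \<in> fil 1"
    using Lhat_fil_1[OF Lhat_degD(1)[OF d2_gen]] by auto
  show "tw (if s = E' then 0 else d2 (gen s)) = - scale (psgn (gdeg s)) (if s = E' then 0 else d2 (gen s))"
    using tw_homog[OF Lhat_degD(2)[OF d2_gen[of s]]] by (auto simp: tw_simps psgn_def)
qed

lemma Dser_gen: "Dser (gen s) = (if s = E' then 0 else d2 (gen s))"
  unfolding Dser_def
  by (rule der_gen) (use Lhat_fil_1[OF Lhat_degD(1)[OF d2_gen]] in auto)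

lemmas Dser_mult = oderD(2)[OF oder_Dser] and Dser_lin = clinD[OF oderD(1)[OF oder_Dser]]

lemma cdgl_gbracket_gen:
  assumes "cdgl S \<delta>" "s \<in> S" "y \<in> Lhat S"
  shows "\<delta> (gbracket (gen s) y) = gbracket (\<delta> (gen s)) y + scale (psgn (gdeg s)) (gbracket (gen s) (\<delta> y))"
  using assms gen_Lhat_deg[OF assms(2)] unfolding cdgl_def powi_psgn by blast

lemma Dser_d2:
  assumes "f \<in> Lhat (insert E Gam)"
  shows "Dser f = d2 f"
proof -
  have lin: "graded_linear (insert E Gam) (insert E Gam) (- 1) d2"
    using cdgl_d2 by (simp add: cdgl_def)
  have "Dser f - d2 f = 0"
  proof (rule Lhat_map_zero[OF _ _ _ _ assms])
    show "Dser (x + y) - d2 (x + y) = (Dser x - d2 x) + (Dser y - d2 y)"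
      if "x \<in> Lhat (insert E Gam)" "y \<in> Lhat (insert E Gam)" for x y
      using that lin by (simp add: graded_linear_def Dser_lin)
    show "Dser (scale c x) - d2 (scale c x) = scale c (Dser x - d2 x)" if "x \<in> Lhat (insert E Gam)" for c x
      using that lin by (simp add: graded_linear_def Dser_lin)
    show gens: "Dser (gen s) - d2 (gen s) = 0" if "s \<in> insert E Gam" for s
      using that by (auto simp: Dser_gen)
    fix s y k
    assume s: "s \<in> insert E Gam" "y \<in> Lhat (insert E Gam)" and k: "Dser y - d2 y \<in> fil k"
    have "Dser (gbracket (gen s) y) - d2 (gbracket (gen s) y)
        = scale (psgn (gdeg s)) (gbracket (gen s) (Dser y - d2 y))"
      using gens[OF s(1)]
      by (simp add: oder_gbracket[OF oder_Dser homog_gen] cdgl_gbracket_gen[OF cdgl_d2 s]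
          clinD[OF clin_gbracket(1)])
    then show "Dser (gbracket (gen s) y) - d2 (gbracket (gen s) y) \<in> fil (Suc k)"
      using fil_gbracket[OF fil_gen k] by (simp add: fil_closed)
  qed
  then show ?thesis
    by simp
qed

lemma Gam_le: "Gam \<subseteq> insert E Gam" "Gam \<subseteq> insert E' Gam"
  by auto

lemma Dser_d: "f \<in> Lhat Gam \<Longrightarrow> Dser f = d f"
  using Dser_d2 d2_eq_d Lhat_mono[OF _ Gam_le(1)] by simp

lemma Dser_Dser: "f \<in> Lhat (insert E Gam) \<Longrightarrow> Dser (Dser f) = 0"
  using cdgl_d2 Dser_d2 unfolding cdgl_def graded_linear_def by metis

lemma Dser_Lhat_deg: "f \<in> Lhat_deg Gam n \<Longrightarrow> Dser f \<in> Lhat_deg Gam (n + - 1)"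
proof -
  assume f: "f \<in> Lhat_deg Gam n"
  then have "d f \<in> Lhat_deg Gam (n + - 1)"
    using cdgl_d unfolding cdgl_def graded_linear_def by blast
  then show ?thesis
    using Dser_d[OF Lhat_degD(1)[OF f]] by simp
qed

lemma gbracket_odd_gens: "gbracket v1 e = v1 * e + e * v1"
  by (simp add: gbracket_homog[OF homog_gens(1)] twn_def)

lemma gbracket_odd_self: "homog (- 1) f \<Longrightarrow> scale (1/2) (gbracket f f) = f * f"
  using tw_homog[of "- 1" f] scale_half_double[of "f * f"]
  by (simp add: gbracket_homog[of "- 1"] twn_def del: scale_simps(1))

lemma Dser_v: "Dser v1 = - (v1 * v1)" "Dser v2 = - (v2 * v2)" "Dser v3 = - (v3 * v3)"
  using L_Gamma gbracket_odd_self[OF homog_gens(1)] gbracket_odd_self[OF homog_gens(2)]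
    gbracket_odd_self[OF homog_gens(3)] Dser_d[OF gen_Lhat, of V1] Dser_d[OF gen_Lhat, of V2]
    Dser_d[OF gen_Lhat, of V3]
  by (auto simp: L_Gamma_def LS_interval_def)

lemma Dser_e: "Dser e = - (v1 * e + e * v1) + Xprod"
  by (simp add: Dser_gen d2_e gbracket_odd_gens)

text \<open>Read off from \<open>d2 (d2 e) = 0\<close>: that the loop is a cycle of the differential
  twisted by \<open>v1\<close> follows without any Baker-Campbell-Hausdorff computation.\<close>

lemma Dser_Xprod: "Dser Xprod = - (v1 * Xprod - Xprod * v1)"
proof -
  have "Dser (Dser e) = 0"
    by (intro Dser_Dser gen_Lhat) simp
  then have "Dser (- (v1 * e + e * v1) + Xprod) = 0"
    by (simp only: Dser_e)
  then have "v1 * Xprod - Xprod * v1 + Dser Xprod = 0"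
    by (simp add: Dser_lin Dser_mult Dser_v Dser_e algebra_simps)
  then show ?thesis
    by (simp add: algebra_simps eq_neg_iff_add_eq_0)
qed

lemma Dser_sexp:
  "Dser (sexp x1) = sexp x1 * v2 - v1 * sexp x1"
  "Dser (sexp x2) = sexp x2 * v3 - v2 * sexp x2"
  "Dser (sexp x3) = sexp x3 * v1 - v3 * sexp x3"
  using L_Gamma Dser_d[OF gen_Lhat, of X1] Dser_d[OF gen_Lhat, of X2] Dser_d[OF gen_Lhat, of X3]
  by (auto simp: L_Gamma_def intro!: LS_interval_sexp[OF oder_Dser])

subsection \<open>A change of generators\<close>

text \<open>In the model, \<open>X2\<close> stands for the loop \<open>x1 \<star> x2 \<star> x3\<close>, and \<open>V2\<close>, \<open>V3\<close> for the
  boundaries of \<open>x1\<close>, \<open>x3\<close>.\<close>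

fun Dmod_gen :: "tri_gen \<Rightarrow> tri_gen series" where
  "Dmod_gen V1 = - (v1 * v1)"
| "Dmod_gen X1 = v2"
| "Dmod_gen X3 = v3"
| "Dmod_gen X2 = - (v1 * x2 - x2 * v1)"
| "Dmod_gen E = - (v1 * e + e * v1) + x2"
| "Dmod_gen _ = 0"

definition Dmod :: "tri_gen series \<Rightarrow> tri_gen series" where
  "Dmod = der Dmod_gen"

lemma gens_fil: "gen s * f \<in> fil 1" "f * gen s \<in> fil 1"
  by (rule fil_mult_left[OF fil_gen] fil_mult_right[OF fil_gen])+

lemma Dmod_gen_fil: "Dmod_gen s \<in> fil 1"
  by (cases s) (auto intro!: fil_closed gens_fil fil_gen simp del: One_nat_def)

lemma oder_Dmod: "oder Dmod"
  unfolding Dmod_def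
proof (rule oder_der[OF Dmod_gen_fil])
  show "tw (Dmod_gen s) = - scale (psgn (gdeg s)) (Dmod_gen s)" for s
    by (cases s) (simp_all add: tw_simps psgn_def)
qed

lemma Dmod_gens [simp]: "Dmod (gen s) = Dmod_gen s"
  unfolding Dmod_def by (rule der_gen[OF Dmod_gen_fil])

lemmas Dmod_mult = oderD(2)[OF oder_Dmod] and Dmod_lin = clinD[OF oderD(1)[OF oder_Dmod]]

text \<open>Twice the square is the anticommutator of \<open>Dmod\<close> with itself, an even
  derivation, so generators suffice.\<close>

lemma Dmod_Dmod: "Dmod (Dmod f) = 0"
proof -
  have rule: "Dmod (Dmod (f * g)) = Dmod (Dmod f) * g + f * Dmod (Dmod g)" for f g
    using oder_anticommutator[OF oder_Dmod oder_Dmod, of f g]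
      scale_half_double[of "Dmod (Dmod (f * g))"]
    by (simp add: Dmod_mult Dmod_lin oderD(3)[OF oder_Dmod])
  have gens: "Dmod (Dmod (gen s)) = 0" for s
    by (cases s) (simp_all add: Dmod_mult Dmod_lin algebra_simps)
  have "Dmod (Dmod (mon u)) = 0" for u
    by (induction u) (simp_all add: mon_Nil mon_Cons oderD(4)[OF oder_Dmod] Dmod_lin rule gens
        del: Dmod_gens)
  then show ?thesis
    using clin_eqI[OF clin_comp[OF oderD(1)[OF oder_Dmod] oderD(1)[OF oder_Dmod]], of "\<lambda>_. 0"]
    by (simp add: clin_def)
qed

section \<open>The isomorphism between the model and the original generators\<close>

fun psi_gen :: "tri_gen \<Rightarrow> tri_gen series" where
  "psi_gen X2 = Xprod"
| "psi_gen V2 = Dser x1"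
| "psi_gen V3 = Dser x3"
| "psi_gen s = gen s"

definition psi :: "tri_gen series \<Rightarrow> tri_gen series" where
  "psi = hom_ext psi_gen"

lemma Dser_x_Lhat: "Dser x1 \<in> Lhat_deg Gam (- 1)" "Dser x3 \<in> Lhat_deg Gam (- 1)"
  using Dser_Lhat_deg[OF gen_Lhat_deg[of X1 Gam]] Dser_Lhat_deg[OF gen_Lhat_deg[of X3 Gam]] by simp_all

lemma psi_gen_Lhat_deg: "s \<in> Gam \<Longrightarrow> psi_gen s \<in> Lhat_deg Gam (gdeg s)"
  using gen_Lhat_deg[of s Gam] Xprod_Lhat_deg Dser_x_Lhat by (cases s) auto

lemma psi_gen_fil: "psi_gen s \<in> fil 1"
  using Lhat_fil_1[OF Lhat_degD(1)[OF psi_gen_Lhat_deg[of s]]] fil_gen by (cases s) auto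

lemma homog_psi_gen: "homog (gdeg s) (psi_gen s)"
  using Lhat_degD(2)[OF psi_gen_Lhat_deg[of s]] homog_gens by (cases s) auto

lemma chom_psi: "chom psi"
  unfolding psi_def by (rule chom_hom_ext[OF psi_gen_fil])

lemma psi_gens [simp]: "psi (gen s) = psi_gen s"
  unfolding psi_def by (rule hom_ext_gen[OF psi_gen_fil])

lemmas psi_simps = chomD(2-9)[OF chom_psi]

lemma psi_tw: "psi (tw f) = tw (psi f)"
  by (rule chom_tw_commute[OF chom_psi]) (simp add: homog_psi_gen)

lemma psi_Lhat_deg: "f \<in> Lhat_deg Gam n \<Longrightarrow> psi f \<in> Lhat_deg Gam n"
  using chom_Lhat[OF chom_psi, of Gam Gam f] chom_homog[OF chom_psi, of n f]
    Lhat_degD(1)[OF psi_gen_Lhat_deg] homog_psi_gen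
  by (auto simp: Lhat_deg_def)

lemma Dser_psi: "Dser (psi f) = psi (Dmod f)"
proof (rule oder_chom_commute[OF chom_psi psi_tw oder_Dmod oder_Dser])
  fix s
  have "Dser (Dser x1) = 0" "Dser (Dser x3) = 0"
    using Lhat_mono[OF gen_Lhat Gam_le(1)] by (auto intro: Dser_Dser)
  then show "Dser (psi (gen s)) = psi (Dmod (gen s))"
    using Dser_gen[of E']
    by (cases s) (simp_all add: psi_simps Dser_Xprod Dser_v Dser_e)
qed

text \<open>The values solve three equations: \<open>sexp_Xprod\<close> for \<open>x2\<close>, the
  formula for \<open>Dser (sexp x1)\<close> for \<open>v2\<close>, and the one for
  \<open>Dser (sexp x3)\<close> for \<open>v3\<close>, each with the loop and the boundaries
  replaced by the letters of the model.\<close>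

fun psi_inv_gen :: "tri_gen \<Rightarrow> tri_gen series" where
  "psi_inv_gen X2 = - x1 \<star> x2 \<star> - x3"
| "psi_inv_gen V2 = sexp (- x1) * (Dmod (sexp x1) + v1 * sexp x1)"
| "psi_inv_gen V3 = (sexp x3 * v1 - Dmod (sexp x3)) * sexp (- x3)"
| "psi_inv_gen s = gen s"

definition psi_inv :: "tri_gen series \<Rightarrow> tri_gen series" where
  "psi_inv = hom_ext psi_inv_gen"

lemma x_fil: "x1 \<in> fil 1" "x2 \<in> fil 1" "x3 \<in> fil 1" "- x1 \<in> fil 1" "- x2 \<in> fil 1" "- x3 \<in> fil 1"
  by (intro fil_closed fil_gen)+

lemmas sexp_x_inverse [simp] = sexp_inverse[OF x_fil(1)] sexp_inverse[OF x_fil(2)] sexp_inverse[OF x_fil(3)]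

lemma sexp_x_cancel [simp]:
  "sexp x1 * (sexp (- x1) * f) = f" "sexp (- x1) * (sexp x1 * f) = f"
  "sexp x2 * (sexp (- x2) * f) = f" "sexp (- x2) * (sexp x2 * f) = f"
  "sexp x3 * (sexp (- x3) * f) = f" "sexp (- x3) * (sexp x3 * f) = f"
  by (simp_all flip: mult.assoc)

lemma x_Lhat_deg: "x1 \<in> Lhat_deg Gam 0" "x2 \<in> Lhat_deg Gam 0" "x3 \<in> Lhat_deg Gam 0"
  "- x1 \<in> Lhat_deg Gam 0" "- x3 \<in> Lhat_deg Gam 0"
  using gen_Lhat_deg[of X1 Gam] gen_Lhat_deg[of X2 Gam] gen_Lhat_deg[of X3 Gam]
  by (auto intro: Lhat_deg_uminus)

lemma v_Lhat_deg: "v1 \<in> Lhat_deg Gam (- 1)" "v2 \<in> Lhat_deg Gam (- 1)" "v3 \<in> Lhat_deg Gam (- 1)"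
  using gen_Lhat_deg[of V1 Gam] gen_Lhat_deg[of V2 Gam] gen_Lhat_deg[of V3 Gam] by simp_all

lemma Dmod_sexp:
  "Dmod (sexp x1) = op_app fps_expm1_div (gbracket x1) v2 * sexp x1"
  "Dmod (sexp x3) = op_app fps_expm1_div (gbracket x3) v3 * sexp x3"
  using oder_sexp[OF oder_Dmod x_fil(1) homog_gens(4)] oder_sexp[OF oder_Dmod x_fil(3) homog_gens(6)]
  by (simp_all add: gbracket_adc[OF homog_gens(4)] gbracket_adc[OF homog_gens(6)])

lemma psi_inv_gen_Lhat_deg: "s \<in> Gam \<Longrightarrow> psi_inv_gen s \<in> Lhat_deg Gam (gdeg s)"
proof -
  assume s: "s \<in> Gam"
  have "psi_inv_gen V2 = sexp (- x1) * (op_app fps_expm1_div (gbracket x1) v2 + v1) * sexp (- (- x1))"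
    by (simp add: Dmod_sexp algebra_simps)
  also have "\<dots> \<in> Lhat_deg Gam (- 1)"
    by (intro Lhat_conj_sexp Lhat_deg_add Lhat_op_app_gbracket x_Lhat_deg v_Lhat_deg)
  finally have V2: "psi_inv_gen V2 \<in> Lhat_deg Gam (- 1)" .
  have "psi_inv_gen V3 = sexp x3 * v1 * sexp (- x3) + - op_app fps_expm1_div (gbracket x3) v3"
    by (simp add: Dmod_sexp algebra_simps)
  also have "\<dots> \<in> Lhat_deg Gam (- 1)"
    by (intro Lhat_conj_sexp Lhat_deg_add Lhat_deg_uminus Lhat_op_app_gbracket x_Lhat_deg v_Lhat_deg)
  finally have V3: "psi_inv_gen V3 \<in> Lhat_deg Gam (- 1)" .
  have X2: "psi_inv_gen X2 \<in> Lhat_deg Gam 0"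
    by (simp add: Lhat_bch x_Lhat_deg)
  show ?thesis
    using s V2 V3 X2 gen_Lhat_deg[of s Gam] by (cases s) (auto simp del: psi_inv_gen.simps(1-3))
qed

lemma psi_inv_gen_fil: "psi_inv_gen s \<in> fil 1"
proof (cases "s \<in> Gam")
  case True
  then show ?thesis
    by (intro Lhat_fil_1[OF Lhat_degD(1)[OF psi_inv_gen_Lhat_deg]])
next
  case False
  then show ?thesis
    using fil_gen[of s] by (cases s) auto
qed

lemma homog_psi_inv_gen: "homog (gdeg s) (psi_inv_gen s)"
proof (cases "s \<in> Gam")
  case True
  then show ?thesis
    by (intro Lhat_degD(2)[OF psi_inv_gen_Lhat_deg])
next
  case False
  then show ?thesis
    using homog_gens by (cases s) auto
qed

lemma chom_psi_inv: "chom psi_inv"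
  unfolding psi_inv_def by (rule chom_hom_ext[OF psi_inv_gen_fil])

lemma psi_inv_gens [simp]: "psi_inv (gen s) = psi_inv_gen s"
  unfolding psi_inv_def by (rule hom_ext_gen[OF psi_inv_gen_fil])

lemmas psi_inv_simps = chomD(2-9)[OF chom_psi_inv]

lemma psi_inv_Lhat_deg: "f \<in> Lhat_deg Gam n \<Longrightarrow> psi_inv f \<in> Lhat_deg Gam n"
  using chom_Lhat[OF chom_psi_inv, of Gam Gam f] chom_homog[OF chom_psi_inv, of n f]
    Lhat_degD(1)[OF psi_inv_gen_Lhat_deg] homog_psi_inv_gen
  by (auto simp: Lhat_deg_def)

lemma psi_psi_inv: "psi (psi_inv f) = f"
proof (rule chom_eqI[OF chom_comp[OF chom_psi chom_psi_inv] chom_id])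
  have px: "psi (sexp x1) = sexp x1" "psi (sexp x3) = sexp x3" "psi (sexp (- x1)) = sexp (- x1)"
    "psi (sexp (- x3)) = sexp (- x3)"
    by (simp_all add: chom_sexp[OF chom_psi] x_fil[simplified] psi_simps)
  have "psi (- x1 \<star> x2 \<star> - x3) = - x1 \<star> Xprod \<star> - x3"
    using chom_bch[OF chom_psi bch_fil_1[of "- x1" x2] x_fil(6)] chom_bch[OF chom_psi x_fil(4,2)]
    by (simp add: psi_simps)
  also have "\<dots> = x2"
    by (rule sexp_inj[OF bch_fil_1 fil_gen]) (simp add: sexp_bch sexp_Xprod mult.assoc)
  finally have X2: "psi (- x1 \<star> x2 \<star> - x3) = x2" .
  have V: "psi (Dmod (sexp x1)) = sexp x1 * v2 - v1 * sexp x1"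
    "psi (Dmod (sexp x3)) = sexp x3 * v1 - v3 * sexp x3"
    by (simp_all add: px Dser_sexp flip: Dser_psi)
  show "psi (psi_inv (gen s)) = gen s" for s
    by (cases s) (simp_all add: X2 psi_simps V px algebra_simps)
qed

lemma psi_inv_psi: "psi_inv (psi f) = f"
proof (rule chom_eqI[OF chom_comp[OF chom_psi_inv chom_psi] chom_id])
  have px: "psi_inv (sexp x1) = sexp x1" "psi_inv (sexp x3) = sexp x3"
    by (simp_all add: chom_sexp[OF chom_psi_inv] x_fil[simplified])
  have "psi_inv Xprod = x1 \<star> (- x1 \<star> x2 \<star> - x3) \<star> x3"
    unfolding Xprod_def
    using chom_bch[OF chom_psi_inv bch_fil_1[of "x1" x2] x_fil(3)] chom_bch[OF chom_psi_inv x_fil(1,2)]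
    by simp
  also have "\<dots> = x2"
    by (rule sexp_inj[OF bch_fil_1 fil_gen]) (simp add: sexp_bch mult.assoc)
  finally have X2: "psi_inv Xprod = x2" .
  \<comment> \<open>\<open>Dser x\<close> is an infinite series of brackets. Its image is found by
    comparing the differentials of exponentials, which are explicit and determine it.\<close>
  have V: "psi_inv (Dser x) = y"
    if x: "x \<in> fil 1" "homog 0 x" "psi_inv x = x" and y: "Dmod x = y"
      and eq: "psi_inv (Dser (sexp x)) = Dmod (sexp x)" for x y
  proof (rule op_app_expm1_div_inj[OF x(1)])
    have "psi_inv (Dser (sexp x)) = op_app fps_expm1_div (adc x) (psi_inv (Dser x)) * psi_inv (sexp x)"
      unfolding oder_sexp[OF oder_Dser x(1,2)] psi_inv_simps
      by (subst op_app_commute[OF raising_adc[OF x(1)] raising_adc[OF x(1)] chomD(1)[OF chom_psi_inv]])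
         (simp_all add: adc_def psi_inv_simps x(3))
    then show "op_app fps_expm1_div (adc x) (psi_inv (Dser x)) * sexp x
        = op_app fps_expm1_div (adc x) y * sexp x"
      unfolding eq oder_sexp[OF oder_Dmod x(1,2)] y chom_sexp[OF chom_psi_inv x(1)] x(3) by simp
  qed
  have "psi_inv (Dser x1) = v2"
    by (rule V) (simp_all add: x_fil[simplified] homog_gens Dser_sexp psi_inv_simps px algebra_simps)
  moreover have "psi_inv (Dser x3) = v3"
    by (rule V) (simp_all add: x_fil[simplified] homog_gens Dser_sexp psi_inv_simps px algebra_simps)
  ultimately show "psi_inv (psi (gen s)) = gen s" for s
    by (cases s) (simp_all add: X2)
qed

end

lemma sexp_zero: "sexp 0 = 1"
proof (rule series_eqI)
  fix w
  have "fps_nth (fps_exp 1) k * wcoeff (0 ^ k) w = (if k = 0 then wcoeff (1 :: 'a series) w else 0)" for k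
    by (simp add: power_0_left)
  then show "wcoeff (sexp 0) w = wcoeff (1 :: 'a series) w"
    by (simp add: sexp_def fps_app_def)
qed

context triangle
begin

section \<open>The contraction and the weight-zero projection\<close>

fun theta_gen :: "tri_gen \<Rightarrow> tri_gen series" where
  "theta_gen V2 = x1"
| "theta_gen V3 = x3"
| "theta_gen _ = 0"

definition theta :: "tri_gen series \<Rightarrow> tri_gen series" where
  "theta = der theta_gen"

fun xwt :: "tri_gen \<Rightarrow> nat" where
  "xwt X1 = 1" | "xwt X3 = 1" | "xwt V2 = 1" | "xwt V3 = 1" | "xwt _ = 0"

fun pz_gen :: "tri_gen \<Rightarrow> tri_gen series" where
  "pz_gen X1 = 0" | "pz_gen X3 = 0" | "pz_gen V2 = 0" | "pz_gen V3 = 0" | "pz_gen s = gen s"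

definition pz :: "tri_gen series \<Rightarrow> tri_gen series" where
  "pz = hom_ext pz_gen"

lemma theta_gen_fil: "theta_gen s \<in> fil 1"
  by (cases s) (auto intro!: fil_gen simp del: One_nat_def)

lemma oder_theta: "oder theta"
  unfolding theta_def
proof (rule oder_der[OF theta_gen_fil])
  show "tw (theta_gen s) = - scale (psgn (gdeg s)) (theta_gen s)" for s
    by (cases s) (simp_all add: tw_simps psgn_def)
qed

lemma theta_gens [simp]: "theta (gen s) = theta_gen s"
  unfolding theta_def by (rule der_gen[OF theta_gen_fil])

lemmas theta_mult = oderD(2)[OF oder_theta] and theta_lin = clinD[OF oderD(1)[OF oder_theta]]

lemma homog_theta_gen: "homog (gdeg s + 1) (theta (gen s))"
  by (cases s) (use homog_gens in simp_all)

lemma theta_Lhat_deg: "f \<in> Lhat_deg Gam n \<Longrightarrow> theta f \<in> Lhat_deg Gam (n + 1)"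
proof -
  assume f: "f \<in> Lhat_deg Gam n"
  have "theta (gen s) \<in> Lhat Gam" if "s \<in> Gam" for s
    using gen_Lhat[of X1 Gam] gen_Lhat[of X3 Gam] by (cases s) auto
  then show ?thesis
    using oder_Lhat[OF oder_theta homog_theta_gen] oder_homog[OF oder_theta homog_theta_gen] f
    by (auto simp: Lhat_deg_def)
qed

lemma pz_gen_fil: "pz_gen s \<in> fil 1"
  by (cases s) (auto intro!: fil_gen simp del: One_nat_def)

lemma chom_pz: "chom pz"
  unfolding pz_def by (rule chom_hom_ext[OF pz_gen_fil])

lemma pz_gens [simp]: "pz (gen s) = pz_gen s"
  unfolding pz_def by (rule hom_ext_gen[OF pz_gen_fil])

lemmas pz_simps = chomD(2-9)[OF chom_pz]

lemma homog_pz_gen: "homog (gdeg s) (pz_gen s)"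
  using homog_gen[of s] by (cases s) auto

lemma pz_tw: "pz (tw f) = tw (pz f)"
  by (rule chom_tw_commute[OF chom_pz]) (simp add: homog_pz_gen)

lemma pz_homog: "homog n f \<Longrightarrow> homog n (pz f)"
  by (rule chom_homog[OF chom_pz]) (simp_all add: homog_pz_gen)

text \<open>Setting the contracted letters to zero is both an algebra homomorphism and the
  projection to weight zero. The first view makes it commute with \<open>Dmod\<close> and
  exponentials, the second detects positive weight.\<close>

lemma wcoeff_pz: "wcoeff (pz f) w = (if wtl xwt w = 0 then wcoeff f w else 0)"
proof -
  define q :: "tri_gen series \<Rightarrow> tri_gen series"
    where "q f = Series (\<lambda>w. if wtl xwt w = 0 then wcoeff f w else 0)" for f
  have q: "clin q"
    by (rule clinI; (rule series_eqI)?) (auto simp: q_def fil_def)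
  have pz: "pz (mon u) = (if wtl xwt u = 0 then mon u else 0)" for u
  proof (induction u)
    case (Cons s u)
    then show ?case
      by (cases s) (simp_all add: mon_Cons pz_simps)
  qed (simp add: mon_Nil pz_simps)
  have "q (mon u) = (if wtl xwt u = 0 then mon u else 0)" for u
    by (rule series_eqI) (auto simp: q_def wcoeff_mon)
  then have "pz (mon u) = q (mon u)" for u
    unfolding pz by (rule sym)
  then have "pz f = q f"
    by (rule clin_eqI[where L = pz and M = q, OF chomD(1)[OF chom_pz] q])
  then show ?thesis
    by (simp add: q_def)
qed

lemma posw_iff_pz: "posw xwt f \<longleftrightarrow> pz f = 0"
proof
  assume "posw xwt f"
  then show "pz f = 0"
    by (intro series_eqI) (simp add: wcoeff_pz posw_def)
next
  assume "pz f = 0"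
  then show "posw xwt f"
    unfolding posw_def by (metis wcoeff_pz wcoeff_zero)
qed

lemma Dmod_pz: "Dmod (pz f) = pz (Dmod f)"
proof (rule oder_chom_commute[OF chom_pz pz_tw oder_Dmod oder_Dmod])
  show "Dmod (pz (gen s)) = pz (Dmod (gen s))" for s
    by (cases s) (simp_all add: pz_simps Dmod_lin)
qed

lemma pz_theta: "pz (theta f) = 0"
proof -
  have "oder (\<lambda>_. 0 :: tri_gen series)"
    by (simp add: oder_def clin_def tw_simps)
  moreover have "0 = pz (theta (gen s))" for s
    by (cases s) (simp_all add: pz_simps)
  ultimately show ?thesis
    using oder_chom_commute[OF chom_pz pz_tw oder_theta, of "\<lambda>_. 0" f] by simp
qed

text \<open>Both sides are even derivations, so generators suffice: \<open>Dmod\<close> and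
  \<open>theta\<close> exchange \<open>x1\<close> with \<open>v2\<close> and \<open>x3\<close> with
  \<open>v3\<close>, and the anticommutator vanishes on the other generators.\<close>

lemma homotopy: "Dmod (theta f) + theta (Dmod f) = Nop xwt f"
proof (rule clin_eqI[where L = "\<lambda>f. Dmod (theta f) + theta (Dmod f)" and f = f])
  show "clin (\<lambda>f. Dmod (theta f) + theta (Dmod f))"
    by (intro clin_add clin_comp[OF oderD(1)[OF oder_Dmod] oderD(1)[OF oder_theta]]
        clin_comp[OF oderD(1)[OF oder_theta] oderD(1)[OF oder_Dmod]])
  show "clin (Nop xwt)"
    by (rule clin_Nop)
  have gens: "Dmod (theta (gen s)) + theta (Dmod (gen s)) = Nop xwt (gen s)" for s
    by (cases s) (simp_all add: theta_mult theta_lin Dmod_lin Nop_gen)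
  show "Dmod (theta (mon u)) + theta (Dmod (mon u)) = Nop xwt (mon u)" for u
  proof (induction u)
    case Nil
    then show ?case
      by (simp add: mon_Nil Nop_one oderD(4)[OF oder_Dmod] oderD(4)[OF oder_theta] Dmod_lin theta_lin)
  next
    case (Cons s u)
    then show ?case
      by (simp only: mon_Cons oder_anticommutator[OF oder_Dmod oder_theta] gens Nop_mult)
  qed
qed

lemma Nop_Dmod: "Nop xwt (Dmod f) = Dmod (Nop xwt f)"
  by (simp add: Dmod_Dmod Dmod_lin theta_lin flip: homotopy)

text \<open>In the model, \<open>theta\<close> contracts a twisted cycle of degree zero to something of weight zero, that
  is, to a power series in the loop.\<close>

lemma twisted_cycle_commutes:
  assumes K: "supported Gam K" "homog 0 K" and cyc: "Dser K = K * v1 - v1 * K"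
  shows "K * Xprod = Xprod * K"
proof -
  define M where "M = psi_inv K"
  have X: "supported {X1, X2, X3} K"
    by (rule Gam_deg_0_supported[OF K])
  have "supported {X1, X2, X3} M"
    unfolding M_def
  proof (rule supported_chom[OF chom_psi_inv _ X])
    fix s
    assume s: "s \<in> {X1, X2, X3}"
    then have "s \<in> Gam" "gdeg s = 0"
      by auto
    then show "supported {X1, X2, X3} (psi_inv (gen s))"
      using psi_inv_gen_Lhat_deg[of s]
      by (intro Gam_deg_0_supported) (auto dest: Lhat_degD intro: supported_Lhat simp del: psi_inv_gen.simps)
  qed
  then have Mw: "set u \<subseteq> {X1, X2, X3}" if "wcoeff M u \<noteq> 0" for u
    using that by (auto simp: supported_def)
  \<comment> \<open>In degree zero only the letters \<open>X1\<close>, \<open>X2\<close>,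
    \<open>X3\<close> occur, and \<open>theta\<close> kills them all.\<close>
  have "theta M = 0"
  proof (rule clin_eq_on[where M = "\<lambda>_. 0", OF oderD(1)[OF oder_theta]])
    have *: "theta (mon u) = 0" if "set u \<subseteq> {X1, X2, X3}" for u
      using that by (induction u) (auto simp: mon_Nil mon_Cons theta_mult oderD(4)[OF oder_theta])
    show "theta (mon u) = 0" if "wcoeff M u \<noteq> 0" for u
      by (rule *[OF Mw[OF that]])
  qed (simp add: clin_def)
  moreover have "Dmod M = M * v1 - v1 * M"
  proof -
    have "psi (Dmod M) = psi (M * v1 - v1 * M)"
      by (simp add: psi_simps M_def psi_psi_inv cyc flip: Dser_psi)
    then show ?thesis
      by (metis psi_inv_psi)
  qed
  \<comment> \<open>In \<open>homotopy\<close> the other term vanishes too, as \<open>theta\<close>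
    kills \<open>v1\<close> and with it \<open>M * v1 - v1 * M\<close>.\<close>
  ultimately have "Nop xwt M = 0"
    by (simp add: theta_mult theta_lin Dmod_lin tw_simps flip: homotopy)
  then have "of_nat (wtl xwt u) * wcoeff M u = 0" for u
    by (metis wcoeff_Nop wcoeff_zero)
  then have "wtl xwt u = 0" if "wcoeff M u \<noteq> 0" for u
    using that by (metis mult_eq_0_iff of_nat_eq_0_iff)
  moreover have "u = replicate (length u) X2" if "set u \<subseteq> {X1, X2, X3}" "wtl xwt u = 0" for u
    using that by (induction u) auto
  ultimately have M2: "u = replicate (length u) X2" if "wcoeff M u \<noteq> 0" for u
    using that Mw by blast
  have "M * x2 = x2 * M"
  proof (rule clin_eq_on[where L = "\<lambda>f. f * x2" and M = "\<lambda>f. x2 * f" and f = M])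
    show "clin (\<lambda>f. f * x2)" "clin (\<lambda>f. x2 * f)"
      by (intro clin_mult_left clin_mult_right clin_id)+
    show "mon u * x2 = x2 * mon u" if "wcoeff M u \<noteq> 0" for u
      by (subst (1 2) M2[OF that]) (simp add: mon_replicate power_commutes)
  qed
  then have "psi (M * x2) = psi (x2 * M)"
    by simp
  then show ?thesis
    by (simp add: psi_simps M_def psi_psi_inv)
qed

subsection \<open>Maurer-Cartan elements are gauge equivalent to a vertex\<close>

text \<open>The differential of the model twisted by \<open>v1\<close>. It kills \<open>x2\<close>,
  and the Maurer-Cartan equation for \<open>v1 + m\<close> reads
  \<open>Dtw m = - (m * m)\<close>.\<close>

definition Dtw :: "tri_gen series \<Rightarrow> tri_gen series" where
  "Dtw f = Dmod f + v1 * f - tw f * v1"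

lemma clin_Dtw: "clin Dtw"
  unfolding Dtw_def
  by (intro clin_add clin_diff clin_mult_left clin_mult_right clin_id clin_tw oderD(1)[OF oder_Dmod])

lemma Dtw_mult: "Dtw (f * g) = Dtw f * g + tw f * Dtw g"
  by (simp add: Dtw_def Dmod_mult tw_simps algebra_simps)

lemma Dtw_X2_power: "Dtw (x2 ^ n) = 0"
proof (induction n)
  case (Suc n)
  have "Dtw x2 = 0"
    by (simp add: Dtw_def)
  then show ?case
    by (simp add: Dtw_mult Suc)
qed (simp add: Dtw_def oderD(4)[OF oder_Dmod] tw_simps)

text \<open>As \<open>V1\<close> has degree -1 and \<open>X2\<close> degree 0, these are all the
  words of degree -1 in the two letters.\<close>

definition vword :: "nat \<Rightarrow> nat \<Rightarrow> tri_gen list" where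
  "vword i j = replicate i X2 @ V1 # replicate j X2"

definition vvword :: "nat \<Rightarrow> nat \<Rightarrow> tri_gen list" where
  "vvword i j = replicate i X2 @ V1 # V1 # replicate j X2"

lemma mon_vword: "mon (vword i j) = x2 ^ i * (v1 * x2 ^ j)"
  by (simp add: vword_def mon_append mon_Cons mon_replicate)

lemma mon_vvword: "mon (vvword i j) = x2 ^ i * (v1 * (v1 * x2 ^ j))"
  by (simp add: vvword_def mon_append mon_Cons mon_replicate)

lemma Dtw_vword: "Dtw (mon (vword i j)) = mon (vvword i j)"
proof -
  have "Dtw v1 = v1 * v1"
    by (simp add: Dtw_def)
  then show ?thesis
    by (simp add: mon_vword mon_vvword Dtw_mult Dtw_X2_power tw_simps mult.assoc)
qed

lemma replicate_Cons_inj: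
  "a \<noteq> b \<Longrightarrow> replicate i a @ b # xs = replicate k a @ b # ys \<longleftrightarrow> i = k \<and> xs = ys"
proof (induction i arbitrary: k)
  case 0
  then show ?case
    by (cases k) auto
next
  case (Suc i)
  then show ?case
    by (cases k) auto
qed

lemma vword_inj: "vword i j = vword k l \<longleftrightarrow> i = k \<and> j = l"
  by (simp add: vword_def replicate_Cons_inj)

lemma vvword_inj: "vvword i j = vvword k l \<longleftrightarrow> i = k \<and> j = l"
  by (simp add: vvword_def replicate_Cons_inj)

lemma wdeg_replicate_X2 [simp]: "wdeg (replicate i X2) = 0"
  by (induction i) auto

lemma V1_X2_word: "set u \<subseteq> {V1, X2} \<Longrightarrow> wdeg u \<le> 0 \<and> (wdeg u = 0 \<longrightarrow> u = replicate (length u) X2)"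
  by (induction u) auto

lemma V1_X2_deg_1_word:
  assumes "set u \<subseteq> {V1, X2}" "wdeg u = - 1"
  obtains i j where "u = vword i j"
proof -
  have "u \<noteq> replicate (length u) X2"
    using assms(2) wdeg_replicate_X2 by (metis zero_neq_neg_one)
  then have "V1 \<in> set u"
    using assms(1) by (metis insertE replicate_eqI singletonD subsetD)
  then obtain xs ys where u: "u = xs @ V1 # ys"
    by (meson split_list)
  then have "set xs \<subseteq> {V1, X2}" "set ys \<subseteq> {V1, X2}" "wdeg xs + wdeg ys = 0"
    using assms by auto
  then have "xs = replicate (length xs) X2" "ys = replicate (length ys) X2"
    using V1_X2_word[of xs] V1_X2_word[of ys] by auto
  then show ?thesis
    using that u unfolding vword_def by metis
qed

text \<open>In degree \<open>-1\<close> and weight zero, comparing the coefficients of \<open>x2\<^sup>i v1 v1 x2\<^sup>j\<close> in the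
  Maurer-Cartan equation leaves only \<open>0\<close> and \<open>v1\<close>.\<close>

lemma weight_zero_MC:
  assumes W: "homog (- 1) W" "supported {V1, X2} W" and MC: "Dmod W = - (W * W)"
    and lin: "wcoeff W [V1] \<noteq> 0"
  shows "W = v1"
proof -
  define m where "m = W - v1"
  have hm: "homog (- 1) m"
    using W(1) homog_gens(1) by (auto simp: m_def)
  have sm: "supported {V1, X2} m"
    using W(2) supported_gen[of V1 "{V1, X2}"] by (simp add: m_def supported_simps)
  have "Dtw m = - (m * m)"
    using MC tw_homog[OF W(1)] by (simp add: m_def Dtw_def Dmod_lin tw_simps algebra_simps)
  have coeff1: "wcoeff (Dtw m) (vvword i j) = wcoeff m (vword i j)" for i j
  proof -
    let ?z = "vvword i j"
    have "wcoeff m u * wcoeff (Dtw (mon u)) ?z = (if u = vword i j then wcoeff m u else 0)" for u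
    proof (cases "wcoeff m u = 0")
      case False
      then have "set u \<subseteq> {V1, X2}" "wdeg u = - 1"
        using sm hm by (auto simp: supported_def homog_def)
      then obtain k l where "u = vword k l"
        by (rule V1_X2_deg_1_word)
      then show ?thesis
        by (auto simp: Dtw_vword wcoeff_mon vword_inj vvword_inj)
    qed auto
    then show ?thesis
      unfolding clin_wcoeff[OF clin_Dtw, of m] by (simp add: vword_def vvword_def)
  qed
  have coeff2: "wcoeff (m * m) (vvword i j) = wcoeff m (vword i 0) * wcoeff m (vword 0 j)" for i j
  proof -
    let ?z = "vvword i j"
    have "wcoeff m (take k ?z) * wcoeff m (drop k ?z)
        = (if k = Suc i then wcoeff m (vword i 0) * wcoeff m (vword 0 j) else 0)" for k
    proof (cases "k = Suc i")
      case True
      then show ?thesis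
        by (simp add: vvword_def vword_def)
    next
      case False
      \<comment> \<open>The two letters \<open>V1\<close> are adjacent, so only the cut between
        them, at \<open>Suc i\<close>, leaves degree -1 on either side.\<close>
      have "wdeg (take k ?z) \<noteq> - 1 \<or> wdeg (drop k ?z) \<noteq> - 1"
      proof (cases "k \<le> i")
        case True
        then show ?thesis
          by (simp add: vvword_def)
      next
        case f: False
        then have "k - i = Suc (Suc (k - i - 2))"
          using False by simp
        then obtain l where "k - i = Suc (Suc l)"
          by blast
        then show ?thesis
          using f by (simp add: vvword_def)
      qed
      then show ?thesis
        using hm False by (auto simp: homog_def)
    qed
    then show ?thesis
      unfolding wcoeff_mult by (simp add: vvword_def)
  qed
  have rec: "wcoeff m (vword i j) = - (wcoeff m (vword i 0) * wcoeff m (vword 0 j))" for i j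
    using coeff1[of i j] coeff2[of i j] \<open>Dtw m = - (m * m)\<close> by simp
  \<comment> \<open>For \<open>i = j = 0\<close> the recursion is \<open>c = - c * c\<close>. The
    root -1 is excluded because \<open>1 + c\<close> is the coefficient of \<open>v1\<close> in
    \<open>W\<close>.\<close>
  have "wcoeff m (vword 0 0) \<noteq> - 1"
    using lin by (simp add: m_def vword_def wcoeff_gen)
  then have m00: "wcoeff m (vword 0 0) = 0"
    using rec[of 0 0] by (metis minus_mult_left mult_cancel_right1 neg_equal_iff_equal minus_minus)
  have "wcoeff m (vword i 0) = 0" for i
    using rec[of i 0] m00 by simp
  then have mij: "wcoeff m (vword i j) = 0" for i j
    using rec[of i j] by simp
  have "m = 0"
  proof (rule series_eqI)
    fix u
    show "wcoeff m u = wcoeff 0 u"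
    proof (rule ccontr)
      assume "wcoeff m u \<noteq> wcoeff 0 u"
      then have "set u \<subseteq> {V1, X2}" "wdeg u = - 1" "wcoeff m u \<noteq> 0"
        using sm hm by (auto simp: supported_def homog_def)
      then show False
        using mij V1_X2_deg_1_word by metis
    qed
  qed
  then show ?thesis
    by (simp add: m_def)
qed

text \<open>A necessary condition determines the gauge as the solution of a logarithmic differential
  equation; sufficiency is the uniqueness theorem applied to the defect of the gauge
  equation.\<close>

lemma MC_gauge:
  assumes MC: "maurer_cartan Gam d \<Omega>"
    and lin: "wcoeff \<Omega> [V1] + wcoeff \<Omega> [V2] + wcoeff \<Omega> [V3] \<noteq> 0"
  obtains \<alpha> where "\<alpha> \<in> Lhat_deg Gam 0" "Dser (sexp \<alpha>) = sexp \<alpha> * v1 - \<Omega> * sexp \<alpha>"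
proof -
  have \<Omega>: "\<Omega> \<in> Lhat_deg Gam (- 1)"
    using MC by (simp add: maurer_cartan_def)
  have D\<Omega>: "Dser \<Omega> = - (\<Omega> * \<Omega>)"
    using MC gbracket_odd_self[OF Lhat_degD(2)[OF \<Omega>]] Dser_d[OF Lhat_degD(1)[OF \<Omega>]]
    by (simp add: maurer_cartan_def eq_neg_iff_add_eq_0)
  define W where "W = psi_inv \<Omega>"
  have W: "W \<in> Lhat_deg Gam (- 1)"
    unfolding W_def by (rule psi_inv_Lhat_deg[OF \<Omega>])
  note tW = tw_homog[OF Lhat_degD(2)[OF W]]
  have "psi (Dmod W) = psi (- (W * W))"
    by (simp add: psi_simps W_def psi_psi_inv D\<Omega> flip: Dser_psi)
  then have DW: "Dmod W = - (W * W)"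
    by (metis psi_inv_psi)
  have pzW: "pz W = v1"
  proof (rule weight_zero_MC)
    show "homog (- 1) (pz W)"
      by (rule pz_homog[OF Lhat_degD(2)[OF W]])
    show "supported {V1, X2} (pz W)"
    proof (unfold supported_def, intro allI impI)
      fix u
      assume "wcoeff (pz W) u \<noteq> 0"
      then have "wtl xwt u = 0" "set u \<subseteq> Gam"
        using Lhat_word(1)[OF Lhat_degD(1)[OF W], of u] by (auto simp: wcoeff_pz split: if_splits)
      then show "set u \<subseteq> {V1, X2}"
        by (induction u) (auto simp: Gam_def)
    qed
    show "Dmod (pz W) = - (pz W * pz W)"
      by (simp add: Dmod_pz DW pz_simps)
    have px: "pz (sexp x1) = 1" "pz (sexp x3) = 1" "pz (sexp (- x1)) = 1" "pz (sexp (- x3)) = 1"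
      using chom_sexp[OF chom_pz x_fil(1)] chom_sexp[OF chom_pz x_fil(3)]
        chom_sexp[OF chom_pz x_fil(4)] chom_sexp[OF chom_pz x_fil(6)]
      by (simp_all add: pz_simps sexp_zero)
    have "wcoeff (pz W) [V1] = (\<Sum>s\<in>UNIV. wcoeff \<Omega> [s] * wcoeff (pz (psi_inv (gen s))) [V1])"
      unfolding W_def by (rule chom_linear_coeff[OF chom_comp[OF chom_pz chom_psi_inv]])
    also have "\<dots> = wcoeff \<Omega> [V1] + wcoeff \<Omega> [V2] + wcoeff \<Omega> [V3]"
    proof -
      have "wcoeff (pz (psi_inv x2)) [V1] = 0"
        using pz_homog[OF homog_psi_inv_gen[of X2]] by (auto simp: homog_def simp del: psi_inv_gen.simps)
      \<comment> \<open>Contracting the edges identifies the three vertices, so the coefficient of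
        \<open>v1\<close> becomes the sum of the three coefficients of \<Omega>.\<close>
      moreover have "pz (psi_inv v2) = v1" "pz (psi_inv v3) = v1"
        by (simp_all add: pz_simps px oderD(4)[OF oder_Dmod] flip: Dmod_pz)
      ultimately show ?thesis
        unfolding UNIV_tri_gen by (simp add: wcoeff_gen del: psi_inv_gen.simps(1-3))
    qed
    finally show "wcoeff (pz W) [V1] \<noteq> 0"
      using lin by simp
  qed
  \<comment> \<open>This choice is forced: apply \<open>theta\<close> to
    \<open>Dmod g = g * v1 - W * g\<close> for \<open>g\<close> of degree zero. As
    \<open>theta\<close> kills \<open>g\<close> and \<open>v1\<close>, \<open>homotopy\<close>
    leaves \<open>Nop xwt g = - theta W * g\<close>.\<close>
  define l where "l = - theta W"
  have l: "l \<in> Lhat_deg Gam 0"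
    unfolding l_def using theta_Lhat_deg[OF W] by (intro Lhat_deg_uminus) simp
  have tl: "tw l = l"
    using tw_homog[OF Lhat_degD(2)[OF l]] by simp
  have "posw xwt l"
    unfolding posw_iff_pz by (simp add: l_def pz_simps pz_theta)
  then obtain a where a: "a \<in> Lhat_deg Gam 0" "posw xwt a" "Nop xwt (sexp a) = l * sexp a"
    using log_derivative_solution[OF l] by metis
  note a_fil = Lhat_fil_1[OF Lhat_degD(1)[OF a(1)]]
  \<comment> \<open>The defect of the gauge equation. The Maurer-Cartan equation for
    \<open>W\<close> gives it the same logarithmic derivative \<open>l\<close> as
    \<open>sexp a\<close>, and \<open>pz W = v1\<close> gives it positive weight.\<close>
  define Y where "Y = W * sexp a - sexp a * v1 + Dmod (sexp a)"
  have "Y = 0"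
  proof (rule log_derivative_unique[OF Lhat_fil_1[OF Lhat_degD(1)[OF l]]])
    have NW: "Nop xwt W = - Dmod l + l * W - W * l"
      using tW by (simp add: l_def DW Dmod_lin theta_lin theta_mult flip: homotopy)
    show "Nop xwt Y = l * Y"
      by (simp add: Y_def NW Nop_gen clinD[OF clin_Nop] Nop_mult Nop_Dmod a(3) Dmod_mult tl algebra_simps)
    have "pz (sexp a) = 1"
      using chom_sexp[OF chom_pz a_fil] a(2) by (simp add: posw_iff_pz sexp_zero)
    then show "posw xwt Y"
      by (simp add: posw_iff_pz Y_def pz_simps pzW oderD(4)[OF oder_Dmod] flip: Dmod_pz)
  qed
  then have "Dmod (sexp a) = sexp a * v1 - W * sexp a"
    by (simp add: Y_def algebra_simps eq_neg_iff_add_eq_0)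
  then have "psi (Dmod (sexp a)) = psi (sexp a * v1 - W * sexp a)"
    by simp
  then have "Dser (sexp (psi a)) = sexp (psi a) * v1 - \<Omega> * sexp (psi a)"
    by (simp add: psi_simps W_def psi_psi_inv chom_sexp[OF chom_psi a_fil] flip: Dser_psi)
  then show ?thesis
    using that psi_Lhat_deg[OF a(1)] by blast
qed

end

section \<open>Transport of structure\<close>

lemma graded_linearD:
  assumes "graded_linear S T k f"
  shows "x \<in> Lhat S \<Longrightarrow> f x \<in> Lhat T"
    "x \<in> Lhat S \<Longrightarrow> y \<in> Lhat S \<Longrightarrow> f (x + y) = f x + f y"
    "x \<in> Lhat S \<Longrightarrow> f (scale c x) = scale c (f x)"
    "x \<in> Lhat_deg S n \<Longrightarrow> f x \<in> Lhat_deg T (n + k)"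
  using assms by (auto simp: graded_linear_def)

lemma cdglD:
  assumes "cdgl S \<delta>"
  shows "graded_linear S S (- 1) \<delta>"
    "x \<in> Lhat_deg S n \<Longrightarrow> y \<in> Lhat S \<Longrightarrow>
      \<delta> (gbracket x y) = gbracket (\<delta> x) y + scale ((- 1) powi n) (gbracket x (\<delta> y))"
    "x \<in> Lhat S \<Longrightarrow> \<delta> (\<delta> x) = 0"
  using assms by (auto simp: cdgl_def)

lemma cdgl_transport:
  assumes \<delta>: "cdgl S \<delta>" and \<phi>: "chom \<phi>" "\<And>f. \<phi> (tw f) = tw (\<phi> f)" "\<And>f. \<phi> (\<phi> f) = f"
    and ST: "\<And>f. f \<in> Lhat S \<Longrightarrow> \<phi> f \<in> Lhat T" and TS: "\<And>f. f \<in> Lhat T \<Longrightarrow> \<phi> f \<in> Lhat S"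
    and homog: "\<And>n f. homog n f \<Longrightarrow> homog n (\<phi> f)"
  shows "cdgl T (\<lambda>f. \<phi> (\<delta> (\<phi> f)))"
proof -
  note lin = graded_linearD[OF cdglD(1)[OF \<delta>]]
  have deg: "f \<in> Lhat_deg T n \<Longrightarrow> \<phi> f \<in> Lhat_deg S n" "f \<in> Lhat_deg S n \<Longrightarrow> \<phi> f \<in> Lhat_deg T n" for f n
    using ST TS homog by (auto simp: Lhat_deg_def)
  have "\<phi> (\<delta> (\<phi> f)) \<in> Lhat_deg T (n + - 1)" if "f \<in> Lhat_deg T n" for f n
    by (intro deg lin(4) that)
  then show ?thesis
    unfolding cdgl_def graded_linear_def
    by (auto simp: chomD[OF \<phi>(1)] chom_gbracket[OF \<phi>(1,2)] \<phi>(3) lin(2,3) TS cdglD(3)[OF \<delta>]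
        cdglD(2)[OF \<delta> deg(1) TS] intro!: ST TS lin(1))
qed

lemma cdgl_hom_chom:
  assumes \<phi>: "chom \<phi>" "\<And>f. \<phi> (tw f) = tw (\<phi> f)"
    and ST: "\<And>f. f \<in> Lhat S \<Longrightarrow> \<phi> f \<in> Lhat T"
    and homog: "\<And>n f. homog n f \<Longrightarrow> homog n (\<phi> f)"
    and comm: "\<And>f. f \<in> Lhat S \<Longrightarrow> \<phi> (\<delta> f) = \<delta>' (\<phi> f)"
  shows "cdgl_hom S \<delta> T \<delta>' \<phi>"
  unfolding cdgl_hom_def graded_linear_def
  using ST homog comm
  by (auto simp: chomD[OF \<phi>(1)] chom_gbracket[OF \<phi>] Lhat_deg_def)

lemma cdgl_hom_cong:
  assumes "cdgl_hom S \<delta> T \<delta>' \<phi>" "\<And>f. f \<in> Lhat S \<Longrightarrow> \<phi>' f = \<phi> f" "\<And>f. f \<in> Lhat S \<Longrightarrow> \<delta> f \<in> Lhat S"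
  shows "cdgl_hom S \<delta> T \<delta>' \<phi>'"
  using assms unfolding cdgl_hom_def graded_linear_def
  by (auto simp: Lhat_add Lhat_scale Lhat_gbracket Lhat_deg_def)

text \<open>The elements of \<open>BijGroup A\<close> are extensional functions, hence the
  restriction to \<open>A\<close>.\<close>

lemma group_action_restrict:
  assumes G: "group G"
    and closed: "\<And>g x. g \<in> carrier G \<Longrightarrow> x \<in> A \<Longrightarrow> R g x \<in> A"
    and mult: "\<And>g h x. g \<in> carrier G \<Longrightarrow> h \<in> carrier G \<Longrightarrow> x \<in> A \<Longrightarrow> R (g \<otimes>\<^bsub>G\<^esub> h) x = R g (R h x)"
    and one: "\<And>x. x \<in> A \<Longrightarrow> R \<one>\<^bsub>G\<^esub> x = x"
  shows "group_action G A (\<lambda>g. restrict (R g) A)"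
proof -
  interpret group G
    by (rule G)
  have bij: "restrict (R g) A \<in> Bij A" if g: "g \<in> carrier G" for g
  proof -
    have "bij_betw (R g) A A"
      by (rule bij_betw_byWitness[where f' = "R (inv\<^bsub>G\<^esub> g)"])
        (use g closed in \<open>auto simp: one simp flip: mult\<close>)
    then show ?thesis
      by (simp add: Bij_def)
  qed
  have "(\<lambda>g. restrict (R g) A) \<in> hom G (BijGroup A)"
  proof (rule homI)
    fix g h
    assume gh: "g \<in> carrier G" "h \<in> carrier G"
    have "restrict (R (g \<otimes>\<^bsub>G\<^esub> h)) A = compose A (restrict (R g) A) (restrict (R h) A)"
      using gh by (auto simp: compose_def restrict_def closed mult fun_eq_iff)
    then show "restrict (R (g \<otimes>\<^bsub>G\<^esub> h)) A = restrict (R g) A \<otimes>\<^bsub>BijGroup A\<^esub> restrict (R h) A"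
      using bij gh by (simp add: BijGroup_def)
  qed (simp add: BijGroup_def bij)
  then show ?thesis
    unfolding group_action_def group_hom_def group_hom_axioms_def using G group_BijGroup by blast
qed

lemma gcdgl_restrict:
  assumes G: "group G" and \<delta>: "cdgl S \<delta>"
    and R: "\<And>g. g \<in> carrier G \<Longrightarrow> chom (R g)" "\<And>g f. g \<in> carrier G \<Longrightarrow> R g (tw f) = tw (R g f)"
      "\<And>g f. g \<in> carrier G \<Longrightarrow> f \<in> Lhat S \<Longrightarrow> R g f \<in> Lhat S"
      "\<And>g n f. g \<in> carrier G \<Longrightarrow> homog n f \<Longrightarrow> homog n (R g f)"
    and mult: "\<And>g h x. g \<in> carrier G \<Longrightarrow> h \<in> carrier G \<Longrightarrow> R (g \<otimes>\<^bsub>G\<^esub> h) x = R g (R h x)"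
    and one: "\<And>x. R \<one>\<^bsub>G\<^esub> x = x"
    and comm: "\<And>g f. g \<in> carrier G \<Longrightarrow> f \<in> Lhat S \<Longrightarrow> R g (\<delta> f) = \<delta> (R g f)"
  shows "gcdgl G S \<delta> (\<lambda>g. restrict (R g) (Lhat S))"
  unfolding gcdgl_def
proof (intro conjI ballI)
  show "group_action G (Lhat S) (\<lambda>g. restrict (R g) (Lhat S))"
    by (rule group_action_restrict[OF G]) (simp_all add: R mult one)
  fix g
  assume g: "g \<in> carrier G"
  have "cdgl_hom S \<delta> S \<delta> (R g)"
    by (rule cdgl_hom_chom) (simp_all add: R g comm)
  then show "cdgl_hom S \<delta> S \<delta> (restrict (R g) (Lhat S))"
    by (rule cdgl_hom_cong) (use graded_linearD(1)[OF cdglD(1)[OF \<delta>]] in auto)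
qed (rule \<delta>)

section \<open>The symmetric group\<close>

text \<open>Permutations are products of transpositions, and each transposition of three points is a
  word in \<sigma> and \<tau>.\<close>

lemma Sigma3_induct [consumes 1, case_names id sigma tau mult]:
  assumes g: "g \<in> carrier Sigma3" and "P id" "P \<sigma>" "P \<tau>"
    and mult: "\<And>g h. g \<in> carrier Sigma3 \<Longrightarrow> h \<in> carrier Sigma3 \<Longrightarrow> P g \<Longrightarrow> P h \<Longrightarrow> P (g \<circ> h)"
  shows "P g"
proof -
  note c = Sigma3_relations(1,2)
  have cc: "g \<circ> h \<in> carrier Sigma3" if "g \<in> carrier Sigma3" "h \<in> carrier Sigma3" for g h
    using that by (simp add: sym_group_carrier permutes_compose)
  have t: "transpose 1 2 = \<sigma> \<circ> (\<sigma> \<circ> (\<tau> \<circ> \<sigma>))" "transpose 3 1 = \<sigma> \<circ> (\<tau> \<circ> (\<sigma> \<circ> \<sigma>))"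
    "transpose 2 3 = \<tau>"
    by (auto simp: fun_eq_iff \<sigma>_def \<tau>_def transpose_def)
  have "P (transpose 1 2)" "P (transpose 3 1)" "P (transpose 2 3)"
    unfolding t by (intro mult cc c assms)+
  then have tr: "P (transpose a b)" if "a \<in> {1..3}" "b \<in> {1..3}" "a \<noteq> b" for a b
  proof -
    have "a = 1 \<or> a = 2 \<or> a = 3" "b = 1 \<or> b = 2 \<or> b = 3"
      using that by auto
    then show ?thesis
      using that(3) \<open>P (transpose 1 2)\<close> \<open>P (transpose 3 1)\<close> \<open>P (transpose 2 3)\<close>
      by (metis transpose_commute)
  qed
  have "g permutes {1..3}" "finite {1..3 :: nat}"
    using g by (simp_all add: sym_group_carrier)
  then show ?thesis
  proof (induction rule: permutes_induct)
    case (swap a b p)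
    then show ?case
      by (intro mult tr) (simp_all add: sym_group_carrier permutes_swap_id)
  qed (rule assms)
qed

lemma sign_sigma: "sign \<sigma> = 1" and sign_tau: "sign \<tau> = - 1"
proof -
  have "\<sigma> = transpose 1 2 \<circ> transpose 2 3"
    by (auto simp: fun_eq_iff \<sigma>_def transpose_def)
  then have "sign \<sigma> = sign (transpose (1 :: nat) 2) * sign (transpose (2 :: nat) 3)"
    by (metis sign_compose permutation_swap_id)
  then show "sign \<sigma> = 1"
    by (simp add: sign_swap_id)
  show "sign \<tau> = - 1"
    by (simp add: \<tau>_def sign_swap_id)
qed

locale triangle_action = triangle +
  fixes \<rho> :: "(nat \<Rightarrow> nat) \<Rightarrow> tri_gen series \<Rightarrow> tri_gen series"
  assumes action: "Sigma3_action d \<rho>"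
begin

section \<open>Extension of the action to all series\<close>

lemma rho_hom: "g \<in> carrier Sigma3 \<Longrightarrow> cdgl_hom Gam d Gam d (\<rho> g)"
  using action by (simp add: Sigma3_action_def gcdgl_def)

lemma rho_action: "group_action Sigma3 (Lhat Gam) \<rho>"
  using action by (simp add: Sigma3_action_def gcdgl_def)

lemma rho_mult: "g \<in> carrier Sigma3 \<Longrightarrow> h \<in> carrier Sigma3 \<Longrightarrow> x \<in> Lhat Gam \<Longrightarrow> \<rho> (g \<circ> h) x = \<rho> g (\<rho> h x)"
  using group_action.composition_rule[OF rho_action] by (simp add: sym_group_mult)

lemma rho_id: "x \<in> Lhat Gam \<Longrightarrow> \<rho> id x = x"
  using group_action.id_eq_one[OF rho_action] by (metis restrict_apply' sym_group_one)

lemma rho_Lhat_deg: "g \<in> carrier Sigma3 \<Longrightarrow> x \<in> Lhat_deg Gam n \<Longrightarrow> \<rho> g x \<in> Lhat_deg Gam n"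
  using rho_hom[of g] graded_linearD(4)[of Gam Gam 0 "\<rho> g" x n] by (simp add: cdgl_hom_def)

text \<open>The value at \<open>E\<close>, which is not a generator of the attached algebra, is arbitrary.\<close>

definition act_gen :: "(nat \<Rightarrow> nat) \<Rightarrow> tri_gen \<Rightarrow> tri_gen series" where
  "act_gen g s = (if s \<in> Gam then \<rho> g (gen s) else if s = E' then scale (of_int (sign g)) e' else e)"

definition act :: "(nat \<Rightarrow> nat) \<Rightarrow> tri_gen series \<Rightarrow> tri_gen series" where
  "act g = hom_ext (act_gen g)"

context
  fixes g
  assumes g: "g \<in> carrier Sigma3"
begin

lemma act_gen_Gam: "s \<in> Gam \<Longrightarrow> act_gen g s \<in> Lhat_deg Gam (gdeg s)"
  using rho_Lhat_deg[OF g gen_Lhat_deg] by (simp add: act_gen_def)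

lemma act_gen_fil: "act_gen g s \<in> fil 1"
proof (cases "s \<in> Gam")
  case True
  then show ?thesis
    by (intro Lhat_fil_1[OF Lhat_degD(1)[OF act_gen_Gam]])
next
  case False
  then show ?thesis
    using fil_gen[of E'] fil_gen[of E] by (auto simp: act_gen_def)
qed

lemma homog_act_gen: "homog (gdeg s) (act_gen g s)"
proof (cases "s \<in> Gam")
  case True
  then show ?thesis
    by (intro Lhat_degD(2)[OF act_gen_Gam])
next
  case False
  then show ?thesis
    using homog_gens by (cases s) (auto simp: act_gen_def)
qed

lemma chom_act: "chom (act g)"
  unfolding act_def by (rule chom_hom_ext[OF act_gen_fil])

lemma act_gen: "act g (gen s) = act_gen g s"
  unfolding act_def by (rule hom_ext_gen[OF act_gen_fil])

lemma act_tw: "act g (tw f) = tw (act g f)"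
  by (rule chom_tw_commute[OF chom_act]) (simp add: act_gen homog_act_gen)

lemma act_homog: "homog n f \<Longrightarrow> homog n (act g f)"
  by (rule chom_homog[OF chom_act]) (simp_all add: act_gen homog_act_gen)

lemma act_Lhat:
  assumes "f \<in> Lhat (insert E' Gam)"
  shows "act g f \<in> Lhat (insert E' Gam)"
proof (rule chom_Lhat[OF chom_act _ _ assms])
  show "homog (gdeg s) (act g (gen s))" for s
    by (simp add: act_gen homog_act_gen)
  show "act g (gen s) \<in> Lhat (insert E' Gam)" if "s \<in> insert E' Gam" for s
  proof (cases "s = E'")
    case True
    then show ?thesis
      by (simp add: act_gen) (simp add: act_gen_def Lhat_scale gen_Lhat)
  next
    case False
    then show ?thesis
      using that Lhat_mono[OF Lhat_degD(1)[OF act_gen_Gam] Gam_le(2)] by (simp add: act_gen)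
  qed
qed

lemma act_rho:
  assumes "f \<in> Lhat Gam"
  shows "act g f = \<rho> g f"
proof -
  have hom: "graded_linear Gam Gam 0 (\<rho> g)"
    and br: "\<And>x y. x \<in> Lhat Gam \<Longrightarrow> y \<in> Lhat Gam \<Longrightarrow> \<rho> g (gbracket x y) = gbracket (\<rho> g x) (\<rho> g y)"
    using rho_hom[OF g] by (auto simp: cdgl_hom_def)
  have "act g f - \<rho> g f = 0"
  proof (rule Lhat_map_zero[OF _ _ _ _ assms])
    show gens: "act g (gen s) - \<rho> g (gen s) = 0" if "s \<in> Gam" for s
      using that by (simp add: act_gen act_gen_def)
    fix s y k
    assume s: "s \<in> Gam" and y: "y \<in> Lhat Gam" and k: "act g y - \<rho> g y \<in> fil k"
    have "act g (gbracket (gen s) y) - \<rho> g (gbracket (gen s) y) = gbracket (act g (gen s)) (act g y - \<rho> g y)"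
      using gens[OF s] by (simp add: chom_gbracket[OF chom_act act_tw] br[OF gen_Lhat[OF s] y]
          clinD[OF clin_gbracket(1)])
    then show "act g (gbracket (gen s) y) - \<rho> g (gbracket (gen s) y) \<in> fil (Suc k)"
      using fil_gbracket[OF act_gen_fil k, of s] by (simp add: act_gen)
  qed (simp_all add: chomD[OF chom_act] graded_linearD(2,3)[OF hom])
  then show ?thesis
    by simp
qed

lemma act_Dser:
  assumes "supported Gam f"
  shows "Dser (act g f) = act g (Dser f)"
proof (rule oder_chom_commute_on[OF chom_act act_tw oder_Dser oder_Dser _ assms])
  fix s
  assume s: "s \<in> Gam"
  have "\<rho> g (gen s) \<in> Lhat Gam" "d (gen s) \<in> Lhat Gam"
    using rho_hom[OF g] cdgl_d gen_Lhat[OF s] by (auto simp: cdgl_hom_def cdgl_def graded_linear_def)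
  then show "Dser (act g (gen s)) = act g (Dser (gen s))"
    using rho_hom[OF g] gen_Lhat[OF s] by (simp add: act_rho Dser_d cdgl_hom_def)
qed

end

lemma act_mult:
  assumes "g \<in> carrier Sigma3" "h \<in> carrier Sigma3"
  shows "act (g \<circ> h) f = act g (act h f)"
proof -
  have gh: "g \<circ> h \<in> carrier Sigma3"
    using assms by (simp add: sym_group_carrier permutes_compose)
  have "sign (g \<circ> h) = sign g * sign h"
    by (intro sign_compose sym_group_carrier'[of _ 3] assms)
  then have gens: "act (g \<circ> h) (gen s) = act g (act h (gen s))" for s
  proof (cases "s \<in> Gam")
    case True
    then show ?thesis
      using rho_mult[OF assms gen_Lhat[OF True]] act_rho[OF assms(1) Lhat_degD(1)[OF act_gen_Gam[OF assms(2) True]]]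
      by (simp add: act_gen gh assms) (simp add: act_gen_def)
  next
    case False
    then show ?thesis
      using \<open>sign (g \<circ> h) = sign g * sign h\<close> act_gen[OF assms(1), of E'] act_gen[OF assms(1), of E]
      by (cases s) (simp_all add: act_gen gh assms act_gen_def chomD[OF chom_act[OF assms(1)]] mult.commute)
  qed
  show ?thesis
    by (rule chom_eqI[OF chom_act[OF gh] chom_comp[OF chom_act[OF assms(1)] chom_act[OF assms(2)]] gens])
qed

lemma id_carrier: "id \<in> carrier Sigma3"
  by (simp add: sym_group_carrier permutes_id)

lemma act_id: "act id f = f"
proof (rule chom_eqI[OF chom_act[OF id_carrier] chom_id])
  show "act id (gen s) = gen s" for s
    by (cases s) (simp_all add: act_gen[OF id_carrier] act_gen_def rho_id gen_Lhat)
qed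

section \<open>Symmetry of the conjugated loop\<close>

lemma oder_sexp_uminus:
  assumes "oder D" "x \<in> fil 1" "homog 0 x"
  shows "D (sexp (- x)) = - (sexp (- x) * D (sexp x) * sexp (- x))"
proof -
  have "tw (sexp (- x)) = sexp (- x)"
    using tw_homog[OF homog_0_sexp[OF homog_closed(4)[OF assms(3)]]] by simp
  then have "sexp (- x) * D (sexp x) + D (sexp (- x)) * sexp x = 0"
    using oderD(2)[OF assms(1), of "sexp (- x)" "sexp x"] oderD(4)[OF assms(1)]
    by (simp add: sexp_inverse[OF assms(2)] add.commute)
  then have "D (sexp (- x)) * sexp x = - (sexp (- x) * D (sexp x))"
    by (simp add: add_eq_0_iff)
  then have "D (sexp (- x)) * sexp x * sexp (- x) = - (sexp (- x) * D (sexp x)) * sexp (- x)"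
    by simp
  then show ?thesis
    by (simp add: mult.assoc sexp_inverse[OF assms(2)])
qed

text \<open>Here \<gamma> is a path from the base point to its image under \<open>g\<close>. The
  left side is the loop carried to \<Omega> along the transformed gauge and that path, the right
  side the loop carried along \<alpha>.\<close>

lemma conj_Xprod_equivariant:
  assumes g: "g \<in> carrier Sigma3" and a: "\<alpha> \<in> Lhat_deg Gam 0" and c: "\<gamma> \<in> Lhat_deg Gam 0"
    and gauge: "Dser (sexp \<alpha>) = sexp \<alpha> * v1 - \<Omega> * sexp \<alpha>" and \<Omega>: "act g \<Omega> = \<Omega>"
    and D\<gamma>: "Dser (sexp \<gamma>) = sexp \<gamma> * v1 - act g v1 * sexp \<gamma>"
  shows "act g (sexp \<alpha>) * (sexp \<gamma> * Xprod * sexp (- \<gamma>)) * act g (sexp (- \<alpha>))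
    = sexp \<alpha> * Xprod * sexp (- \<alpha>)"
proof -
  define b where "b = \<rho> g \<alpha>"
  have b: "b \<in> Lhat_deg Gam 0"
    unfolding b_def by (rule rho_Lhat_deg[OF g a])
  note fil = Lhat_fil_1[OF Lhat_degD(1)[OF a]] Lhat_fil_1[OF Lhat_degD(1)[OF b]]
    Lhat_fil_1[OF Lhat_degD(1)[OF c]]
  have supp: "supported Gam (sexp z)" "homog 0 (sexp z)" if "z \<in> Lhat_deg Gam 0" for z
    using that by (auto intro: supported_sexp supported_Lhat homog_0_sexp dest: Lhat_degD)
  have act_a: "act g (sexp \<alpha>) = sexp b" "act g (sexp (- \<alpha>)) = sexp (- b)"
    using fil act_rho[OF g Lhat_degD(1)[OF a]]
    by (simp_all add: chom_sexp[OF chom_act[OF g]] chomD(7)[OF chom_act[OF g]] b_def)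
  have Db: "Dser (sexp b) = sexp b * act g v1 - \<Omega> * sexp b"
    using act_Dser[OF g supp(1)[OF a]] \<Omega>
    by (simp add: gauge act_a chomD[OF chom_act[OF g]])
  \<comment> \<open>Three transports, from \<open>v1\<close> to \<open>act g v1\<close>, on to
    \<Omega> and back to \<open>v1\<close>. Their composite is a twisted cycle and therefore
    commutes with the loop.\<close>
  define K where "K = sexp (- \<alpha>) * sexp b * sexp \<gamma>"
  have tws: "tw (sexp z) = sexp z" if "z \<in> Lhat_deg Gam 0" for z
    using tw_homog[OF supp(2)[OF that]] by simp
  note ma = Lhat_deg_uminus[OF a]
  have Da: "Dser (sexp (- \<alpha>)) = - (v1 * sexp (- \<alpha>)) + sexp (- \<alpha>) * \<Omega>"
  proof -
    have "sexp (- \<alpha>) * (sexp \<alpha> * v1 - \<Omega> * sexp \<alpha>) * sexp (- \<alpha>)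
        = (sexp (- \<alpha>) * sexp \<alpha>) * v1 * sexp (- \<alpha>) - sexp (- \<alpha>) * \<Omega> * (sexp \<alpha> * sexp (- \<alpha>))"
      by (simp add: algebra_simps)
    then show ?thesis
      using oder_sexp_uminus[OF oder_Dser fil(1) Lhat_degD(2)[OF a]]
      by (simp add: gauge sexp_inverse[OF fil(1)])
  qed
  have "K * Xprod = Xprod * K"
  proof (rule twisted_cycle_commutes)
    show "supported Gam K" "homog 0 K"
      unfolding K_def using supp(1)[OF ma] supp(1)[OF b] supp(1)[OF c]
        homog_mult[OF homog_mult[OF supp(2)[OF ma] supp(2)[OF b]] supp(2)[OF c]]
      by (auto intro: supported_mult)
    show "Dser K = K * v1 - v1 * K"
      unfolding K_def
      by (simp add: Dser_mult tws[OF ma] tws[OF b] tw_simps Da Db D\<gamma> algebra_simps)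
  qed
  then have "sexp \<alpha> * (K * Xprod) * sexp (- \<gamma>) * sexp (- b) = sexp \<alpha> * (Xprod * K) * sexp (- \<gamma>) * sexp (- b)"
    by simp
  moreover have "sexp \<alpha> * (K * Xprod) * sexp (- \<gamma>) * sexp (- b)
      = (sexp \<alpha> * sexp (- \<alpha>)) * sexp b * sexp \<gamma> * Xprod * sexp (- \<gamma>) * sexp (- b)"
    by (simp add: K_def mult.assoc)
  moreover have "sexp \<alpha> * (Xprod * K) * sexp (- \<gamma>) * sexp (- b)
      = sexp \<alpha> * Xprod * sexp (- \<alpha>) * (sexp b * (sexp \<gamma> * sexp (- \<gamma>)) * sexp (- b))"
    by (simp add: K_def mult.assoc)
  ultimately show ?thesis
    by (simp add: act_a sexp_inverse[OF fil(1)] sexp_inverse[OF fil(2)] sexp_inverse[OF fil(3)] mult.assoc)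
qed

lemma act_Xprod:
  assumes "g \<in> carrier Sigma3"
  shows "act g Xprod = act g x1 \<star> act g x2 \<star> act g x3"
  unfolding Xprod_def
  using chom_bch[OF chom_act[OF assms] bch_fil_1[of x1 x2] x_fil(3)]
    chom_bch[OF chom_act[OF assms] x_fil(1,2)] by simp

lemma act_sigma: "act \<sigma> v1 = v2" "act \<sigma> x1 = x2" "act \<sigma> x2 = x3" "act \<sigma> x3 = x1"
  and act_tau: "act \<tau> v1 = v1" "act \<tau> x1 = - x3" "act \<tau> x2 = - x2" "act \<tau> x3 = - x1"
  using action Sigma3_relations(1,2) by (simp_all add: act_gen act_gen_def Sigma3_action_def)

lemma conj_Xprod_sign:
  assumes a: "\<alpha> \<in> Lhat_deg Gam 0" and gauge: "Dser (sexp \<alpha>) = sexp \<alpha> * v1 - \<Omega> * sexp \<alpha>"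
    and \<Omega>: "\<And>g. g \<in> carrier Sigma3 \<Longrightarrow> act g \<Omega> = \<Omega>" and g: "g \<in> carrier Sigma3"
  shows "act g (sexp \<alpha> * Xprod * sexp (- \<alpha>)) = scale (of_int (sign g)) (sexp \<alpha> * Xprod * sexp (- \<alpha>))"
  using g
proof (induction rule: Sigma3_induct)
  case id
  then show ?case
    by (simp only: act_id sign_id of_int_1 scale_simps(5))
next
  case sigma
  note \<sigma> = Sigma3_relations(1)
  \<comment> \<open>The rotated loop is based at \<open>v2\<close>, and the edge \<open>x1\<close>
    relates it to the loop at \<open>v1\<close>. This gives \<open>- x1\<close> as the connecting
    path; the double minus matches the shape of \<open>conj_Xprod_equivariant\<close>.\<close>
  have "x2 \<star> x3 \<star> x1 = sexp (- x1) * Xprod * sexp (- (- x1))"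
  proof (rule sexp_inj[OF bch_fil_1])
    show "sexp (- x1) * Xprod * sexp (- (- x1)) \<in> fil 1"
      by (intro fil_mult_left fil_mult_right Xprod_fil)
    have "sexp (sexp (- x1) * Xprod * sexp (- (- x1))) = sexp (- x1) * sexp Xprod * sexp (- (- x1))"
      by (rule sexp_conj[OF _ _ Xprod_fil]) simp_all
    then show "sexp (x2 \<star> x3 \<star> x1) = sexp (sexp (- x1) * Xprod * sexp (- (- x1)))"
      by (simp add: sexp_bch sexp_Xprod mult.assoc)
  qed
  then have "act \<sigma> Xprod = sexp (- x1) * Xprod * sexp (- (- x1))"
    by (simp add: act_Xprod[OF \<sigma>] act_sigma)
  moreover have "Dser (sexp (- x1)) = sexp (- x1) * v1 - act \<sigma> v1 * sexp (- x1)"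
    by (simp add: oder_sexp_uminus[OF oder_Dser x_fil(1) homog_gens(4)] Dser_sexp act_sigma algebra_simps)
  ultimately show ?case
    using conj_Xprod_equivariant[OF \<sigma> a x_Lhat_deg(4) gauge \<Omega>[OF \<sigma>]]
    by (simp add: chomD(3)[OF chom_act[OF \<sigma>]] sign_sigma)
next
  case tau
  note \<tau> = Sigma3_relations(2)
  \<comment> \<open>\<tau> fixes the base point, so \<open>0\<close> serves as connecting path;
    reversing the order and the signs of the edges inverts the loop.\<close>
  have "(- x3) \<star> (- x2) \<star> (- x1) = - Xprod"
  proof (rule sexp_inj[OF bch_fil_1 fil_closed(4)[OF Xprod_fil]])
    have inv: "sexp Xprod * (sexp (- x3) * sexp (- x2) * sexp (- x1)) = 1"
      by (simp add: sexp_Xprod mult.assoc)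
    have "sexp (- Xprod) * sexp Xprod * (sexp (- x3) * sexp (- x2) * sexp (- x1)) = sexp (- Xprod)"
      unfolding mult.assoc[of "sexp (- Xprod)"] inv by simp
    then show "sexp ((- x3) \<star> (- x2) \<star> (- x1)) = sexp (- Xprod)"
      by (simp add: sexp_bch sexp_inverse[OF Xprod_fil])
  qed
  then have "act \<tau> Xprod = - Xprod"
    by (simp add: act_Xprod[OF \<tau>] act_tau)
  moreover have "Dser (sexp 0) = sexp 0 * v1 - act \<tau> v1 * sexp 0"
    by (simp add: sexp_zero oderD(4)[OF oder_Dser] act_tau)
  moreover have "(0 :: tri_gen series) \<in> Lhat_deg Gam 0"
    by (simp add: Lhat_deg_def)
  ultimately show ?case
    using conj_Xprod_equivariant[OF \<tau> a _ gauge \<Omega>[OF \<tau>], of 0]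
    by (simp add: chomD(3)[OF chom_act[OF \<tau>]] sign_tau sexp_zero)
next
  case (mult g h)
  have "sign (g \<circ> h) = sign g * sign h"
    by (intro sign_compose sym_group_carrier'[of _ 3] mult)
  then show ?case
    unfolding act_mult[OF mult.hyps] mult.IH chomD(9)[OF chom_act[OF mult.hyps(1)]]
    by (simp only: of_int_mult scale_simps(4) mult.commute)
qed

end

context triangle_action
begin

text \<open>Exchanging the two attached generators makes \<open>attach\<close> an involution of all series, which
  restricts to mutually inverse isomorphisms.\<close>

definition attach_gen :: "tri_gen series \<Rightarrow> tri_gen \<Rightarrow> tri_gen series" where
  "attach_gen \<alpha> s = (if s = E then sexp (- \<alpha>) * e' * sexp \<alpha>
     else if s = E' then sexp \<alpha> * e * sexp (- \<alpha>) else gen s)"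

definition attach :: "tri_gen series \<Rightarrow> tri_gen series \<Rightarrow> tri_gen series" where
  "attach \<alpha> = hom_ext (attach_gen \<alpha>)"

context
  fixes \<alpha>
  assumes \<alpha>: "\<alpha> \<in> Lhat_deg Gam 0"
begin

lemma attach_gen_E: "attach_gen \<alpha> E \<in> Lhat_deg (insert E' Gam) 1"
  using Lhat_conj_sexp[OF Lhat_deg_mono[OF Lhat_deg_uminus[OF \<alpha>] Gam_le(2)] gen_Lhat_deg[of E' "insert E' Gam"]]
  by (simp add: attach_gen_def)

lemma attach_gen_E': "attach_gen \<alpha> E' \<in> Lhat_deg (insert E Gam) 1"
  using Lhat_conj_sexp[OF Lhat_deg_mono[OF \<alpha> Gam_le(1)] gen_Lhat_deg[of E "insert E Gam"]]
  by (simp add: attach_gen_def)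

lemma attach_gen_Gam: "s \<in> Gam \<Longrightarrow> attach_gen \<alpha> s = gen s"
  by (auto simp: attach_gen_def)

lemma attach_gen_fil: "attach_gen \<alpha> s \<in> fil 1"
  using Lhat_fil_1[OF Lhat_degD(1)[OF attach_gen_E]] Lhat_fil_1[OF Lhat_degD(1)[OF attach_gen_E']]
    attach_gen_Gam[of s] fil_gen[of s]
  by (cases s) simp_all

lemma homog_attach_gen: "homog (gdeg s) (attach_gen \<alpha> s)"
  using Lhat_degD(2)[OF attach_gen_E] Lhat_degD(2)[OF attach_gen_E']
    attach_gen_Gam[of s] homog_gen[of s]
  by (cases s) simp_all

lemma chom_attach: "chom (attach \<alpha>)"
  unfolding attach_def by (rule chom_hom_ext[OF attach_gen_fil])

lemma attach_gens: "attach \<alpha> (gen s) = attach_gen \<alpha> s"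
  unfolding attach_def by (rule hom_ext_gen[OF attach_gen_fil])

lemma attach_tw: "attach \<alpha> (tw f) = tw (attach \<alpha> f)"
  by (rule chom_tw_commute[OF chom_attach]) (simp add: attach_gens homog_attach_gen)

lemma attach_homog: "homog n f \<Longrightarrow> homog n (attach \<alpha> f)"
  by (rule chom_homog[OF chom_attach]) (simp_all add: attach_gens homog_attach_gen)

lemma attach_Gam: "supported Gam f \<Longrightarrow> attach \<alpha> f = f"
  by (rule chom_eq_on[where \<psi> = "\<lambda>f. f" and S = Gam, OF chom_attach chom_id])
     (simp_all add: attach_gens attach_gen_Gam)

lemma attach_Lhat:
  "f \<in> Lhat (insert E Gam) \<Longrightarrow> attach \<alpha> f \<in> Lhat (insert E' Gam)"
  "f \<in> Lhat (insert E' Gam) \<Longrightarrow> attach \<alpha> f \<in> Lhat (insert E Gam)"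
proof -
  have h: "homog (gdeg s) (attach \<alpha> (gen s))" for s
    unfolding attach_gens by (rule homog_attach_gen)
  have "attach \<alpha> (gen s) \<in> Lhat (insert E' Gam)" if "s \<in> insert E Gam" for s
    using that Lhat_degD(1)[OF attach_gen_E] gen_Lhat[of s "insert E' Gam"]
    by (cases "s = E") (auto simp: attach_gens attach_gen_Gam)
  then show "f \<in> Lhat (insert E Gam) \<Longrightarrow> attach \<alpha> f \<in> Lhat (insert E' Gam)"
    by (rule chom_Lhat[OF chom_attach h])
  have "attach \<alpha> (gen s) \<in> Lhat (insert E Gam)" if "s \<in> insert E' Gam" for s
    using that Lhat_degD(1)[OF attach_gen_E'] gen_Lhat[of s "insert E Gam"]
    by (cases "s = E'") (auto simp: attach_gens attach_gen_Gam)
  then show "f \<in> Lhat (insert E' Gam) \<Longrightarrow> attach \<alpha> f \<in> Lhat (insert E Gam)"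
    by (rule chom_Lhat[OF chom_attach h])
qed

lemma \<alpha>_fil: "\<alpha> \<in> fil 1"
  by (rule Lhat_fil_1[OF Lhat_degD(1)[OF \<alpha>]])

lemma supported_sexp_\<alpha>: "supported Gam (sexp \<alpha>)" "supported Gam (sexp (- \<alpha>))"
  using supported_sexp[OF supported_Lhat[OF Lhat_degD(1)[OF \<alpha>]]]
    supported_sexp[OF supported_Lhat[OF Lhat_degD(1)[OF Lhat_deg_uminus[OF \<alpha>]]]] .

lemma attach_attach: "attach \<alpha> (attach \<alpha> f) = f"
proof (rule chom_eqI[OF chom_comp[OF chom_attach chom_attach] chom_id])
  fix s
  have c: "sexp \<alpha> * (sexp (- \<alpha>) * f) = f" "sexp (- \<alpha>) * (sexp \<alpha> * f) = f" for f
    by (simp_all add: sexp_inverse[OF \<alpha>_fil] flip: mult.assoc)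
  show "attach \<alpha> (attach \<alpha> (gen s)) = gen s"
  proof (cases "s \<in> Gam")
    case True
    then show ?thesis
      by (simp add: attach_gens attach_gen_Gam)
  next
    case False
    then have "s = E \<or> s = E'"
      by (cases s) auto
    then show ?thesis
      by (auto simp: attach_gens attach_gen_def chomD(3)[OF chom_attach] attach_Gam[OF supported_sexp_\<alpha>(1)]
          attach_Gam[OF supported_sexp_\<alpha>(2)] mult.assoc c sexp_inverse[OF \<alpha>_fil])
  qed
qed

section \<open>The transported differential and the equivariant isomorphism\<close>

definition d_attach :: "tri_gen series \<Rightarrow> tri_gen series" where
  "d_attach f = attach \<alpha> (d2 (attach \<alpha> f))"

lemma cdgl_d_attach: "cdgl (insert E' Gam) d_attach"
  unfolding d_attach_def
  by (rule cdgl_transport[OF cdgl_d2 chom_attach attach_tw attach_attach attach_Lhat attach_homog])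

lemma d_attach_d:
  assumes "f \<in> Lhat Gam"
  shows "d_attach f = d f"
proof -
  have "d f \<in> Lhat Gam"
    using graded_linearD(1)[OF cdglD(1)[OF cdgl_d]] assms by blast
  then show ?thesis
    using assms by (simp add: d_attach_def attach_Gam[OF supported_Lhat] d2_eq_d)
qed

context
  fixes \<Omega>
  assumes \<Omega>: "\<Omega> \<in> Lhat_deg Gam (- 1)" and gauge: "Dser (sexp \<alpha>) = sexp \<alpha> * v1 - \<Omega> * sexp \<alpha>"
    and inv: "\<And>g. g \<in> carrier Sigma3 \<Longrightarrow> act g \<Omega> = \<Omega>"
begin

text \<open>Conjugating \<open>e\<close> by the gauge replaces the twist by \<open>v1\<close> in its
  differential by the twist by \<Omega>, and conjugates the loop.\<close>

lemma d_attach_e': "d_attach e' = - gbracket \<Omega> e' + sexp \<alpha> * Xprod * sexp (- \<alpha>)"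
proof -
  have c: "sexp \<alpha> * (sexp (- \<alpha>) * f) = f" "sexp (- \<alpha>) * (sexp \<alpha> * f) = f" for f
    by (simp_all add: sexp_inverse[OF \<alpha>_fil] flip: mult.assoc)
  have t: "tw (sexp \<alpha>) = sexp \<alpha>"
    using tw_homog[OF homog_0_sexp[OF Lhat_degD(2)[OF \<alpha>]]] by simp
  let ?e = "sexp \<alpha> * e * sexp (- \<alpha>)"
  have "attach \<alpha> e' = ?e"
    by (simp add: attach_gens attach_gen_def)
  moreover have "?e \<in> Lhat (insert E Gam)"
    using Lhat_degD(1)[OF attach_gen_E'] by (simp add: attach_gen_def)
  ultimately have "d_attach e' = attach \<alpha> (Dser ?e)"
    by (simp add: d_attach_def Dser_d2)
  also have "Dser ?e = - (\<Omega> * ?e + ?e * \<Omega>) + sexp \<alpha> * Xprod * sexp (- \<alpha>)"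
    by (simp add: Dser_mult tw_simps t oder_sexp_uminus[OF oder_Dser \<alpha>_fil Lhat_degD(2)[OF \<alpha>]]
        gauge Dser_e c sexp_inverse[OF \<alpha>_fil] algebra_simps)
  also have "attach \<alpha> \<dots> = - (\<Omega> * attach \<alpha> ?e + attach \<alpha> ?e * \<Omega>) + sexp \<alpha> * Xprod * sexp (- \<alpha>)"
    by (simp add: chomD[OF chom_attach] attach_Gam supported_sexp_\<alpha> supported_Lhat Lhat_degD(1)[OF \<Omega>]
        Lhat_degD(1)[OF Xprod_Lhat_deg])
  also have "attach \<alpha> ?e = e'"
    using attach_attach[of e'] by (simp add: attach_gens attach_gen_def)
  finally show ?thesis
    by (simp add: gbracket_homog[OF Lhat_degD(2)[OF \<Omega>]] twn_def)
qed

text \<open>On \<open>e'\<close> this combines the invariance of \<Omega> with the symmetry of the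
  conjugated loop; on the other generators it is the equivariance of the given action.\<close>

lemma act_d_attach:
  assumes g: "g \<in> carrier Sigma3" and f: "f \<in> Lhat (insert E' Gam)"
  shows "act g (d_attach f) = d_attach (act g f)"
proof -
  note lin = graded_linearD[OF cdglD(1)[OF cdgl_d_attach]]
  note act = chomD[OF chom_act[OF g]]
  have "act g (d_attach f) - d_attach (act g f) = 0"
  proof (rule Lhat_map_zero[OF _ _ _ _ f])
    show gens: "act g (d_attach (gen s)) - d_attach (act g (gen s)) = 0" if "s \<in> insert E' Gam" for s
    proof (cases "s = E'")
      case True
      let ?c = "of_int (sign g)"
      have "act g (d_attach e') = - gbracket \<Omega> (scale ?c e') + scale ?c (sexp \<alpha> * Xprod * sexp (- \<alpha>))"
        using conj_Xprod_sign[OF \<alpha> gauge inv g]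
        by (simp add: d_attach_e' act(5-7) chom_gbracket[OF chom_act[OF g] act_tw[OF g]] inv[OF g]
            act_gen[OF g] act_gen_def)
      also have "\<dots> = scale ?c (d_attach e')"
        by (simp add: d_attach_e' clinD[OF clin_gbracket(1)])
      also have "\<dots> = d_attach (act g e')"
        by (simp add: act_gen[OF g] act_gen_def lin(3) gen_Lhat)
      finally show ?thesis
        using True by simp
    next
      case False
      then have s: "gen s \<in> Lhat Gam"
        using that by (auto intro: gen_Lhat)
      have "\<rho> g (gen s) \<in> Lhat Gam" "d (gen s) \<in> Lhat Gam"
        using rho_hom[OF g] cdgl_d s by (auto simp: cdgl_hom_def cdgl_def graded_linear_def)
      then show ?thesis
        using rho_hom[OF g] s by (simp add: act_rho[OF g] d_attach_d cdgl_hom_def)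
    qed
    fix s y k
    assume s: "s \<in> insert E' Gam" and y: "y \<in> Lhat (insert E' Gam)"
      and k: "act g (d_attach y) - d_attach (act g y) \<in> fil k"
    note sd = gen_Lhat_deg[OF s]
    have s': "act g (gen s) \<in> Lhat_deg (insert E' Gam) (gdeg s)"
      using act_Lhat[OF g] act_homog[OF g] sd by (simp add: Lhat_deg_def)
    have "act g (d_attach (gbracket (gen s) y)) - d_attach (act g (gbracket (gen s) y))
        = scale ((- 1) powi gdeg s) (gbracket (act g (gen s)) (act g (d_attach y) - d_attach (act g y)))"
      using gens[OF s]
      by (simp add: cdglD(2)[OF cdgl_d_attach sd y] cdglD(2)[OF cdgl_d_attach s' act_Lhat[OF g y]]
          chom_gbracket[OF chom_act[OF g] act_tw[OF g]] act clinD[OF clin_gbracket(1)])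
    moreover have "gbracket (act g (gen s)) (act g (d_attach y) - d_attach (act g y)) \<in> fil (1 + k)"
      by (rule fil_gbracket[OF Lhat_fil_1[OF Lhat_degD(1)[OF s']] k])
    ultimately show "act g (d_attach (gbracket (gen s) y)) - d_attach (act g (gbracket (gen s) y)) \<in> fil (Suc k)"
      by auto
  qed (simp_all add: act lin Lhat_add Lhat_scale act_Lhat[OF g])
  then show ?thesis
    by simp
qed

lemma gcdgl_d_attach:
  "gcdgl Sigma3 (insert E' Gam) d_attach (\<lambda>g. restrict (act g) (Lhat (insert E' Gam)))"
  by (rule gcdgl_restrict[OF sym_group_is_group cdgl_d_attach])
     (simp_all only: chom_act act_tw act_Lhat act_homog act_d_attach sym_group_mult sym_group_one act_mult act_id)

text \<open>The action is pulled back along \<open>attach\<close>, so that the equivariance of the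
  isomorphism holds by construction.\<close>

definition act2 :: "(nat \<Rightarrow> nat) \<Rightarrow> tri_gen series \<Rightarrow> tri_gen series" where
  "act2 g f = attach \<alpha> (act g (attach \<alpha> f))"

lemma gcdgl_d2: "gcdgl Sigma3 (insert E Gam) d2 (\<lambda>g. restrict (act2 g) (Lhat (insert E Gam)))"
proof (rule gcdgl_restrict[OF sym_group_is_group cdgl_d2])
  show "chom (act2 g)" if "g \<in> carrier Sigma3" for g
    using chom_comp[OF chom_attach chom_comp[OF chom_act[OF that] chom_attach]]
    by (simp add: act2_def[abs_def])
  show "act2 g (d2 f) = d2 (act2 g f)" if g: "g \<in> carrier Sigma3" and f: "f \<in> Lhat (insert E Gam)" for g f
  proof -
    have "act g (d_attach (attach \<alpha> f)) = d_attach (act g (attach \<alpha> f))"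
      by (intro act_d_attach g attach_Lhat f)
    then show ?thesis
      by (simp add: d_attach_def act2_def attach_attach)
  qed
qed (simp_all only: act2_def attach_tw act_tw attach_Lhat act_Lhat attach_homog act_homog
    sym_group_mult sym_group_one act_mult act_id attach_attach)

lemma gcdgl_iso_attach:
  "gcdgl_iso Sigma3 (insert E Gam) d2 (\<lambda>g. restrict (act2 g) (Lhat (insert E Gam)))
     (insert E' Gam) d_attach (\<lambda>g. restrict (act g) (Lhat (insert E' Gam))) (attach \<alpha>)"
  unfolding gcdgl_iso_def cdgl_iso_def
proof (intro conjI ballI)
  show "cdgl_hom (insert E Gam) d2 (insert E' Gam) d_attach (attach \<alpha>)"
    by (rule cdgl_hom_chom[OF chom_attach attach_tw attach_Lhat(1) attach_homog])
       (simp_all add: d_attach_def attach_attach)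
  show "bij_betw (attach \<alpha>) (Lhat (insert E Gam)) (Lhat (insert E' Gam))"
    by (rule bij_betw_byWitness[where f' = "attach \<alpha>"]) (auto simp: attach_attach attach_Lhat)
qed (simp add: act2_def attach_attach attach_Lhat)

end

end

end

theorem theorem3p2:
  fixes d d\<^sub>2 :: "tri_gen series \<Rightarrow> tri_gen series"
    and \<rho> :: "(nat \<Rightarrow> nat) \<Rightarrow> tri_gen series \<Rightarrow> tri_gen series"
    and \<Omega> :: "tri_gen series"
  assumes "L_Gamma d"
    and "Sigma3_action d \<rho>"
    and "L_2 d d\<^sub>2"
    and "maurer_cartan Gam d \<Omega>"
    and "\<forall>g\<in>carrier Sigma3. \<rho> g \<Omega> = \<Omega>"
    and "linear_part \<Omega> \<noteq> 0"
  shows "\<exists>\<rho>\<^sub>2 d' \<rho>' \<phi>.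
      gcdgl Sigma3 (insert E Gam) d\<^sub>2 \<rho>\<^sub>2 \<and>
      gcdgl Sigma3 (insert E' Gam) d' \<rho>' \<and>
      (\<forall>x\<in>Lhat Gam. d' x = d x) \<and>
      (\<forall>g\<in>carrier Sigma3. \<forall>x\<in>Lhat Gam. \<rho>' g x = \<rho> g x) \<and>
      gcdgl_iso Sigma3 (insert E Gam) d\<^sub>2 \<rho>\<^sub>2 (insert E' Gam) d' \<rho>' \<phi> \<and>
      (\<exists>\<beta>\<in>Lhat_deg (insert E' Gam) 0.
         d' e' = - gbracket \<Omega> e' + \<beta> \<star> x1 \<star> x2 \<star> x3 \<star> (- \<beta>)) \<and>
      \<rho>' \<sigma> e' = e' \<and> \<rho>' \<tau> e' = - e'"
proof -
  interpret triangle_action d d\<^sub>2 \<rho>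
    by unfold_locales (fact assms)+
  have \<Omega>: "\<Omega> \<in> Lhat_deg Gam (- 1)"
    using assms(4) by (simp add: maurer_cartan_def)
  have inv: "act g \<Omega> = \<Omega>" if "g \<in> carrier Sigma3" for g
    using assms(5) that act_rho[OF that Lhat_degD(1)[OF \<Omega>]] by simp
  note \<sigma> = Sigma3_relations(1) and \<tau> = Sigma3_relations(2)
  have act_v: "act \<sigma> v1 = v2" "act \<sigma> v2 = v3" "act \<sigma> v3 = v1"
    using assms(2) by (simp_all add: act_gen[OF \<sigma>] act_gen_def Sigma3_action_def)
  have act_linear: "wcoeff \<Omega> [t] = (\<Sum>s\<in>UNIV. wcoeff \<Omega> [s] * wcoeff (act \<sigma> (gen s)) [t])" for t
    using chom_linear_coeff[OF chom_act[OF \<sigma>], of \<Omega> t] by (simp add: inv[OF \<sigma>])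
  have zero: "wcoeff \<Omega> [s] = 0" if "s \<notin> {V1, V2, V3}" for s
  proof (rule ccontr)
    assume "wcoeff \<Omega> [s] \<noteq> 0"
    then have "wdeg [s] = - 1"
      using Lhat_degD(2)[OF \<Omega>] unfolding homog_def by blast
    then show False
      using that by (cases s) auto
  qed
  have sum: "(\<Sum>s\<in>UNIV. wcoeff \<Omega> [s] * f s)
      = wcoeff \<Omega> [V1] * f V1 + wcoeff \<Omega> [V2] * f V2 + wcoeff \<Omega> [V3] * f V3" for f
    unfolding UNIV_tri_gen by (simp add: zero)
  \<comment> \<open>\<sigma> permutes the vertices cyclically, so invariance makes the three
    coefficients equal. Their sum then vanishes only if the linear part does.\<close>
  have eq: "wcoeff \<Omega> [V2] = wcoeff \<Omega> [V1]" "wcoeff \<Omega> [V3] = wcoeff \<Omega> [V2]"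
    by (subst act_linear, simp add: sum act_v wcoeff_gen)+
  have "wcoeff \<Omega> [V1] \<noteq> 0"
  proof
    assume "wcoeff \<Omega> [V1] = 0"
    then have "wcoeff \<Omega> [s] = 0" for s
      using eq zero by (cases s) auto
    then have "linear_part \<Omega> = 0"
      by (intro series_eqI) (auto simp: linear_part_def wcoeff_lcomp length_Suc_conv)
    then show False
      using assms(6) by simp
  qed
  then have "wcoeff \<Omega> [V1] + wcoeff \<Omega> [V2] + wcoeff \<Omega> [V3] \<noteq> 0"
    by (simp add: eq)
  then obtain \<alpha> where \<alpha>: "\<alpha> \<in> Lhat_deg Gam 0" "Dser (sexp \<alpha>) = sexp \<alpha> * v1 - \<Omega> * sexp \<alpha>"
    using MC_gauge[OF assms(4)] by metis
  \<comment> \<open>The conjugated loop is an iterated Baker-Campbell-Hausdorff product, so the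
    gauge parameter \<alpha> itself serves as \<beta>.\<close>
  have conj: "\<alpha> \<star> x1 \<star> x2 \<star> x3 \<star> (- \<alpha>) = sexp \<alpha> * Xprod * sexp (- \<alpha>)"
  proof (rule bch_eqI)
    note fil = Lhat_fil_1[OF Lhat_degD(1)[OF \<alpha>(1)]]
    show "sexp \<alpha> * Xprod * sexp (- \<alpha>) \<in> fil 1"
      by (intro fil_mult_left fil_mult_right Xprod_fil)
    show "sexp (\<alpha> \<star> x1 \<star> x2 \<star> x3) * sexp (- \<alpha>) = sexp (sexp \<alpha> * Xprod * sexp (- \<alpha>))"
      unfolding sexp_conj[OF sexp_inverse[OF fil] Xprod_fil] by (simp add: sexp_bch sexp_Xprod mult.assoc)
  qed
  let ?\<rho>2 = "\<lambda>g. restrict (act2 \<alpha> g) (Lhat (insert E Gam))"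
  let ?\<rho>' = "\<lambda>g. restrict (act g) (Lhat (insert E' Gam))"
  have "\<forall>g\<in>carrier Sigma3. \<forall>x\<in>Lhat Gam. ?\<rho>' g x = \<rho> g x"
    using Lhat_mono[OF _ Gam_le(2)] by (simp add: act_rho)
  moreover have "?\<rho>' \<sigma> e' = e'" "?\<rho>' \<tau> e' = - e'"
    by (simp_all add: gen_Lhat act_gen[OF \<sigma>] act_gen[OF \<tau>] act_gen_def sign_sigma sign_tau)
  moreover have "d_attach \<alpha> e' = - gbracket \<Omega> e' + \<alpha> \<star> x1 \<star> x2 \<star> x3 \<star> (- \<alpha>)"
    unfolding conj by (rule d_attach_e'[OF \<alpha>(1) \<Omega> \<alpha>(2) inv])
  moreover have "\<alpha> \<in> Lhat_deg (insert E' Gam) 0"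
    by (rule Lhat_deg_mono[OF \<alpha>(1) Gam_le(2)])
  moreover note gcdgl_d2[OF \<alpha>(1) \<Omega> \<alpha>(2) inv] gcdgl_d_attach[OF \<alpha>(1) \<Omega> \<alpha>(2) inv]
    gcdgl_iso_attach[OF \<alpha>(1) \<Omega> \<alpha>(2) inv] d_attach_d[OF \<alpha>(1)]
  ultimately show ?thesis
    by (intro exI[of _ ?\<rho>2] exI[of _ "d_attach \<alpha>"] exI[of _ ?\<rho>'] exI[of _ "attach \<alpha>"] conjI ballI
        bexI[of _ \<alpha>]) blast+
qed

end
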